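(* Let $p\ge1$, $N\ge0$, and let $S=\{s_{j-k}\}_{k,j=0}^N$ be a positive definite block Toeplitz matrix with $p\times p$ blocks, $s_{-k}=s_k^*$. Fix $\alpha_0$ with $\alpha_0+\alpha_0^*=s_0$, and put $\alpha_k=s_{-k}$ for $1\le k\le N$. Let $\Phi_1$ be the $(N+1)p\times p$ block column with all blocks $I_p$, $\Phi_2$ the block column with blocks $\alpha_0,\ \alpha_0+\alpha_1,\ \dots,\ \alpha_0+\dots+\alpha_N$, $\Pi=[\Phi_1\ \ \Phi_2]$, and $A=\{a_{j-k}\}_{k,j=0}^N$ with $a_r=0$ ($r>0$), $a_0=\frac i2I_p$, $a_r=iI_p$ ($r<0$). Let $w_A(N,\mu)=I_{2p}-iJ\Pi^*S^{-1}(A-\mu I_{(N+1)p})^{-1}\Pi$ and $$\mathcal W(\lambda)=\{\mathcal W_{ij}(\lambda)\}_{i,j=1}^2=\Big(\frac{\lambda-i}{\lambda}\Big)^{N+1}w_A\big(N,-\bar\lambda/2\big)^*K.$$ Let $R,Q$ be $p\times p$ matrix functions meromorphic in $\mathbb C_-$, well defined at $\lambda=-i$, with $R^*R+Q^*Q>0$ and $R^*R\le Q^*Q$, and let $\varphi=i(\mathcal W_{21}R+\mathcal W_{22}Q)(\mathcal W_{11}R+\mathcal W_{12}Q)^{-1}$. Then $i\varphi(-i)=\alpha_0$, and the Taylor coefficients $\alpha_k$ at $z=0$ of $i\varphi\big(i\frac{z+1}{z-1}\big)$ satisfy $\alpha_k=s_{-k}$ for $0<k\le N$. Moreover, setting $s_{-k}=s_k^*:=\alpha_k$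 for $k>N$, one has $\{s_{j-k}\}_{k,j=0}^M\ge0$ for all $M>N$; and every sequence $(s_{-k})_{k>N}$ of $p\times p$ matrices such that, with $s_k:=s_{-k}^*$, all $\{s_{j-k}\}_{k,j=0}^M$ ($M>N$) are nonnegative (i.e. every nonnegative extension of $S$) is obtained in this way for a suitable pair $R,Q$.
   Context: $\mathbb C_-$ is the open lower half-plane; $J=\begin{bmatrix}0&I_p\\ I_p&0\end{bmatrix}$, $K=\frac1{\sqrt2}\begin{bmatrix}I_p&-I_p\\ I_p&I_p\end{bmatrix}$; $I_r$ is the $r\times r$ identity matrix; $\mathcal W_{ij}$ are $p\times p$ blocks. *)

theory Defs
  imports "HOL-Complex_Analysis.Complex_Analysis" "Jordan_Normal_Form.Schur_Decomposition"
begin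

definition lower_half :: "complex set" where
  "lower_half = {z. Im z < 0}"

(* Matrix inverse (junk value if not invertible) *)
definition minv :: "complex mat \<Rightarrow> complex mat" where
  "minv A = (SOME B. B \<in> carrier_mat (dim_row A) (dim_row A) \<and>
                     A * B = 1\<^sub>m (dim_row A) \<and> B * A = 1\<^sub>m (dim_row A))"

definition qform :: "complex mat \<Rightarrow> complex vec \<Rightarrow> complex" where
  "qform A v = (\<Sum>i<dim_row A. \<Sum>j<dim_row A. cnj (v $ i) * A $$ (i,j) * v $ j)"

definition psd :: "complex mat \<Rightarrow> bool" where
  "psd A \<longleftrightarrow> A \<in> carrier_mat (dim_row A) (dim_row A) \<and>
     (\<forall>v \<in> carrier_vec (dim_row A). qform A v \<in> \<real> \<and> Re (qform A v) \<ge> 0)"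

definition pd :: "complex mat \<Rightarrow> bool" where
  "pd A \<longleftrightarrow> A \<in> carrier_mat (dim_row A) (dim_row A) \<and>
     (\<forall>v \<in> carrier_vec (dim_row A). v \<noteq> 0\<^sub>v (dim_row A) \<longrightarrow>
        qform A v \<in> \<real> \<and> Re (qform A v) > 0)"

(* block Toeplitz matrix {s_{j-k}}_{k,j=0}^M with p x p blocks; k = block row, j = block column *)
definition block_toeplitz :: "nat \<Rightarrow> nat \<Rightarrow> (int \<Rightarrow> complex mat) \<Rightarrow> complex mat" where
  "block_toeplitz p M s = mat ((M+1)*p) ((M+1)*p)
     (\<lambda>(a,b). s (int (b div p) - int (a div p)) $$ (a mod p, b mod p))"

definition Jmat :: "nat \<Rightarrow> complex mat" where
  "Jmat p = four_block_mat (0\<^sub>m p p) (1\<^sub>m p) (1\<^sub>m p) (0\<^sub>m p p)"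

definition Kmat :: "nat \<Rightarrow> complex mat" where
  "Kmat p = complex_of_real (1 / sqrt 2) \<cdot>\<^sub>m
     four_block_mat (1\<^sub>m p) (- 1\<^sub>m p) (1\<^sub>m p) (1\<^sub>m p)"

definition alph :: "(int \<Rightarrow> complex mat) \<Rightarrow> complex mat \<Rightarrow> nat \<Rightarrow> complex mat" where
  "alph s a0 k = (if k = 0 then a0 else s (- int k))"

definition Pi_mat :: "nat \<Rightarrow> nat \<Rightarrow> (int \<Rightarrow> complex mat) \<Rightarrow> complex mat \<Rightarrow> complex mat" where
  "Pi_mat p N s a0 = mat ((N+1)*p) (2*p) (\<lambda>(a,b).
     if b < p then (if a mod p = b then 1 else 0)
     else (\<Sum>k\<le>a div p. alph s a0 k $$ (a mod p, b - p)))"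

definition A_mat :: "nat \<Rightarrow> nat \<Rightarrow> complex mat" where
  "A_mat p N = mat ((N+1)*p) ((N+1)*p) (\<lambda>(a,b).
     let r = int (b div p) - int (a div p) in
     if a mod p \<noteq> b mod p then 0
     else if r > 0 then 0 else if r = 0 then \<i> / 2 else \<i>)"

definition wA :: "nat \<Rightarrow> nat \<Rightarrow> (int \<Rightarrow> complex mat) \<Rightarrow> complex mat \<Rightarrow> complex \<Rightarrow> complex mat" where
  "wA p N s a0 \<mu> = 1\<^sub>m (2*p) - \<i> \<cdot>\<^sub>m (Jmat p * mat_adjoint (Pi_mat p N s a0)
       * minv (block_toeplitz p N s)
       * minv (A_mat p N - \<mu> \<cdot>\<^sub>m 1\<^sub>m ((N+1)*p)) * Pi_mat p N s a0)"

definition Wfun :: "nat \<Rightarrow> nat \<Rightarrow> (int \<Rightarrow> complex mat) \<Rightarrow> complex mat \<Rightarrow> complex \<Rightarrow> complex mat" where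
  "Wfun p N s a0 lam = ((lam - \<i>) / lam) ^ (N+1) \<cdot>\<^sub>m
      (mat_adjoint (wA p N s a0 (- cnj lam / 2)) * Kmat p)"

(* p x p block (i,j), i,j \<in> {1,2}, of a 2p x 2p matrix *)
definition blk :: "nat \<Rightarrow> complex mat \<Rightarrow> nat \<Rightarrow> nat \<Rightarrow> complex mat" where
  "blk p W i j = mat p p (\<lambda>(a,b). W $$ (a + (i - 1) * p, b + (j - 1) * p))"

definition phi :: "nat \<Rightarrow> nat \<Rightarrow> (int \<Rightarrow> complex mat) \<Rightarrow> complex mat
     \<Rightarrow> (complex \<Rightarrow> complex mat) \<Rightarrow> (complex \<Rightarrow> complex mat) \<Rightarrow> complex \<Rightarrow> complex mat" where
  "phi p N s a0 R Q lam = (let W = Wfun p N s a0 lam in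
     \<i> \<cdot>\<^sub>m ((blk p W 2 1 * R lam + blk p W 2 2 * Q lam) *
            minv (blk p W 1 1 * R lam + blk p W 1 2 * Q lam)))"

definition admissible_pair :: "nat \<Rightarrow> (complex \<Rightarrow> complex mat) \<Rightarrow> (complex \<Rightarrow> complex mat) \<Rightarrow> bool" where
  "admissible_pair p R Q \<longleftrightarrow>
     (\<forall>z. R z \<in> carrier_mat p p \<and> Q z \<in> carrier_mat p p) \<and>
     (\<forall>a<p. \<forall>b<p. (\<lambda>z. R z $$ (a,b)) meromorphic_on lower_half \<and>
                   (\<lambda>z. Q z $$ (a,b)) meromorphic_on lower_half \<and>
                   (\<lambda>z. R z $$ (a,b)) analytic_on {- \<i>} \<and>
                   (\<lambda>z. Q z $$ (a,b)) analytic_on {- \<i>}) \<and>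
     (\<forall>z\<in>lower_half. (\<forall>a<p. \<forall>b<p. (\<lambda>z. R z $$ (a,b)) analytic_on {z} \<and>
                                   (\<lambda>z. Q z $$ (a,b)) analytic_on {z}) \<longrightarrow>
        pd (mat_adjoint (R z) * R z + mat_adjoint (Q z) * Q z) \<and>
        psd (mat_adjoint (Q z) * Q z - mat_adjoint (R z) * R z))"

definition taylor_coeff :: "nat \<Rightarrow> (complex \<Rightarrow> complex mat) \<Rightarrow> nat \<Rightarrow> complex mat" where
  "taylor_coeff p g k = mat p p (\<lambda>(a,b). (deriv ^^ k) (\<lambda>z. g z $$ (a,b)) 0 / fact k)"

definition taylor_rep :: "nat \<Rightarrow> (complex \<Rightarrow> complex mat) \<Rightarrow> (complex \<Rightarrow> complex mat) \<Rightarrow> bool" where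
  "taylor_rep p f g \<longleftrightarrow> (\<forall>z. g z \<in> carrier_mat p p) \<and>
     (\<forall>a<p. \<forall>b<p. (\<lambda>z. g z $$ (a,b)) analytic_on {0}) \<and>
     (\<forall>\<^sub>F z in at 0. g z = \<i> \<cdot>\<^sub>m f (\<i> * (z + 1) / (z - 1)))"

definition ext_seq :: "nat \<Rightarrow> (int \<Rightarrow> complex mat) \<Rightarrow> (nat \<Rightarrow> complex mat) \<Rightarrow> int \<Rightarrow> complex mat" where
  "ext_seq N s t k = (if \<bar>k\<bar> \<le> int N then s k
       else if k < 0 then t (nat (- k)) else mat_adjoint (t (nat k)))"

end

theory Submission
  imports Defs
begin

text \<open>Put \<open>\<lambda> = \<i>(z + 1)/(z - 1)\<close>, so that \<open>|z| < 1\<close> corresponds to the lower half-plane. With the block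
  shift T and \<open>C = (I - T)\<Pi>\<close>, the displacement identity \<open>S - T S T\<^sup>* = C J C\<^sup>*\<close> holds, and
  \<open>w\<^sub>A(N, -cnj \<lambda>/2)\<^sup>*\<close> becomes \<open>\<Theta>(z) = I + (z - 1) C\<^sup>* E(z)\<close>, where \<open>(I - T) S (I - z T\<^sup>*) E(z) = C J\<close>.
  Two identities follow: with \<open>F = (I - T\<^sup>*) E\<close>, one has \<open>\<Theta>\<^sup>* J \<Theta> = J - (1 - |z|\<^sup>2) F\<^sup>* S F\<close> and
  \<open>C J \<Theta> = (z - T) S F\<close>.

  For a pair (R, Q) the quotient \<open>R Q\<^sup>-\<^sup>1\<close> extends to a contractive holomorphic function. The first identity
  makes the denominator of the linear fractional transformation invertible and the real part of its
  value g nonnegative, so the Toeplitz forms of g are nonnegative by Cauchy's formula on circles. The second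
  identity writes the column of the prescribed coefficients minus g as \<open>z - T\<close> times a holomorphic function,
  which is the interpolation condition.

  Conversely, a nonnegative extension defines a power series g in the disc. Testing the extended Toeplitz
  forms on vectors (..., z^2 v, z v, v, x) gives Potapov's fundamental matrix inequality, which says exactly
  that \<open>\<Theta>\<^sup>-\<^sup>1\<close> applied to the column (I, -g) is J-nonpositive; this column is the required pair up to the unitary K.\<close>

text \<open>The partial sums in \<open>Pi_mat\<close> and the matrix A share one factor: A is (i/2)
  times the inverse of I - T times I + T. Multiplication by I - T therefore turns the second block
  column into the plain column of the \<alpha>_k, and turns the resolvent of A into that of the
  nilpotent T. The scalar power in \<open>Wfun\<close> cancels in \<open>phi\<close>.

  Two obstacles shape the argument. A pair is only meromorphic, and its inequalities hold only where
  both functions are analytic; it is therefore replaced by a holomorphic contraction before anything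
  is inverted. And \<Theta>(0) is singular, so the converse never inverts \<Theta>: its candidate is
  written down explicitly and recognised because E(z) is the unique solution of its equation.

  One recursion serves both directions: C J applied to the column of I and -g equals (z - T) h. In
  the direct half h comes from S F and yields the interpolation. In the converse h consists of the
  negated tails of the power series, and the inverse of S applied to h is also the vector at which
  the fundamental inequality is sharpest.\<close>

no_notation vec_nth (infixl "$" 90)
no_notation fps_nth (infixl "$" 75)

section \<open>Complex matrices\<close>

lemma dim_mat_adjoint [simp]:
  fixes A :: "complex mat"
  shows "dim_row (mat_adjoint A) = dim_col A" "dim_col (mat_adjoint A) = dim_row A"
  by (simp_all add: mat_adjoint_def)

lemma mat_adjoint_carrier [simp, intro]:
  fixes A :: "complex mat"
  shows "A \<in> carrier_mat n m \<Longrightarrow> mat_adjoint A \<in> carrier_mat m n"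
  by (metis dim_mat_adjoint carrier_matD carrier_matI)

lemma index_mat_adjoint [simp]:
  fixes A :: "complex mat"
  assumes "i < dim_col A" "j < dim_row A"
  shows "mat_adjoint A $$ (i, j) = cnj (A $$ (j, i))"
  using assms by (simp add: mat_adjoint_def mat_of_rows_index)

lemma mat_adjoint_adjoint [simp]:
  fixes A :: "complex mat"
  shows "mat_adjoint (mat_adjoint A) = A"
  by (rule eq_matI) auto

lemma index_mult_sum:
  fixes A B :: "complex mat"
  assumes "A \<in> carrier_mat n m" "B \<in> carrier_mat m l" "i < n" "j < l"
  shows "(A * B) $$ (i, j) = (\<Sum>k<m. A $$ (i, k) * B $$ (k, j))"
  using assms by (simp add: scalar_prod_def lessThan_atLeast0)

lemma index_mult_vec_sum:
  fixes A :: "complex mat"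
  assumes "A \<in> carrier_mat n m" "v \<in> carrier_vec m" "i < n"
  shows "(A *\<^sub>v v) $ i = (\<Sum>k<m. A $$ (i, k) * v $ k)"
  using assms by (simp add: scalar_prod_def lessThan_atLeast0)

lemma mat_adjoint_mult:
  fixes A B :: "complex mat"
  assumes "A \<in> carrier_mat n m" "B \<in> carrier_mat m l"
  shows "mat_adjoint (A * B) = mat_adjoint B * mat_adjoint A"
proof (rule eq_matI)
  fix i j assume "i < dim_row (mat_adjoint B * mat_adjoint A)" "j < dim_col (mat_adjoint B * mat_adjoint A)"
  then have ij: "i < l" "j < n" using assms by auto
  have "mat_adjoint (A * B) $$ (i, j) = cnj ((A * B) $$ (j, i))"
    using assms ij by (subst index_mat_adjoint) auto
  also have "\<dots> = (\<Sum>k<m. cnj (A $$ (j, k)) * cnj (B $$ (k, i)))"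
    using index_mult_sum[OF assms ij(2,1)] by simp
  also have "\<dots> = (mat_adjoint B * mat_adjoint A) $$ (i, j)"
    using assms ij by (subst index_mult_sum[of _ l m _ n]) (auto intro!: sum.cong)
  finally show "mat_adjoint (A * B) $$ (i, j) = (mat_adjoint B * mat_adjoint A) $$ (i, j)" .
qed (use assms in auto)

lemma mat_adjoint_one [simp]: "mat_adjoint (1\<^sub>m n :: complex mat) = 1\<^sub>m n"
  by (rule eq_matI) auto

lemma mat_adjoint_smult: "mat_adjoint (c \<cdot>\<^sub>m A) = cnj c \<cdot>\<^sub>m mat_adjoint (A :: complex mat)"
  by (rule eq_matI) auto

lemma mat_adjoint_minus:
  fixes A B :: "complex mat"
  assumes "A \<in> carrier_mat n m" "B \<in> carrier_mat n m"
  shows "mat_adjoint (A - B) = mat_adjoint A - mat_adjoint B"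
  using assms by (intro eq_matI) auto

lemma sum_split_add: "(\<Sum>k<m+l. f k) = (\<Sum>k<m. f k) + (\<Sum>k<l. f (m + k))"
  for f :: "nat \<Rightarrow> 'a :: comm_monoid_add"
  by (induction l) (auto simp: add_ac)

lemma sum_split_double: "(\<Sum>k<2*p. f k) = (\<Sum>k<p. f k) + (\<Sum>k<p. f (k + p))"
  for f :: "nat \<Rightarrow> 'a :: comm_monoid_add"
  using sum_split_add[of f p p] by (simp add: mult_2 add.commute)

section \<open>Inner product, adjoints and definiteness\<close>

definition cip :: "complex vec \<Rightarrow> complex vec \<Rightarrow> complex" where
  "cip v w = (\<Sum>i<dim_vec w. cnj (v $ i) * w $ i)"

lemma cip_add:
  assumes "u \<in> carrier_vec n" "v \<in> carrier_vec n" "w \<in> carrier_vec n"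
  shows "cip u (v + w) = cip u v + cip u w" "cip u (v - w) = cip u v - cip u w"
    "cip (u + v) w = cip u w + cip v w" "cip (u - v) w = cip u w - cip v w"
  using assms by (auto simp: cip_def algebra_simps sum.distrib sum_subtractf)

lemma cip_smult:
  assumes "u \<in> carrier_vec n" "v \<in> carrier_vec n"
  shows "cip u (c \<cdot>\<^sub>v v) = c * cip u v" "cip (c \<cdot>\<^sub>v u) v = cnj c * cip u v"
  using assms by (auto simp: cip_def sum_distrib_left mult_ac)

lemmas cip_linear = cip_add cip_smult

lemma cip_commute:
  assumes "u \<in> carrier_vec n" "v \<in> carrier_vec n"
  shows "cip v u = cnj (cip u v)"
  using assms by (auto simp: cip_def mult.commute)

lemma cip_self: "v \<in> carrier_vec n \<Longrightarrow> cip v v = of_real (\<Sum>i<n. (cmod (v $ i))\<^sup>2)"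
  by (auto simp: cip_def mult.commute simp flip: complex_norm_square intro!: sum.cong)

lemma cip_adjoint:
  assumes A: "A \<in> carrier_mat n m" and v: "v \<in> carrier_vec n" and w: "w \<in> carrier_vec m"
  shows "cip v (A *\<^sub>v w) = cip (mat_adjoint A *\<^sub>v v) w"
proof -
  have "cip v (A *\<^sub>v w) = (\<Sum>i<n. \<Sum>k<m. cnj (v $ i) * (A $$ (i, k) * w $ k))"
    using assms by (simp add: cip_def index_mult_vec_sum[OF A w] sum_distrib_left del: index_mult_mat_vec)
  also have "\<dots> = (\<Sum>k<m. \<Sum>i<n. cnj (v $ i) * (A $$ (i, k) * w $ k))"
    by (rule sum.swap)
  also have "\<dots> = cip (mat_adjoint A *\<^sub>v v) w"
    using assms
    by (auto simp add: cip_def index_mult_vec_sum[of _ m n] sum_distrib_left sum_distrib_right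
        algebra_simps simp del: index_mult_mat_vec intro!: sum.cong)
  finally show ?thesis .
qed

lemma qform_eq_cip:
  assumes "A \<in> carrier_mat n n" "v \<in> carrier_vec n"
  shows "qform A v = cip v (A *\<^sub>v v)"
  using assms
  by (simp add: qform_def cip_def index_mult_vec_sum[OF assms] sum_distrib_left mult.assoc
      del: index_mult_mat_vec)

lemma psd_iff:
  assumes "A \<in> carrier_mat n n"
  shows "psd A \<longleftrightarrow> (\<forall>v\<in>carrier_vec n. cip v (A *\<^sub>v v) \<in> \<real> \<and> Re (cip v (A *\<^sub>v v)) \<ge> 0)"
  using assms qform_eq_cip[OF assms] unfolding psd_def by auto

lemma pd_iff:
  assumes "A \<in> carrier_mat n n"
  shows "pd A \<longleftrightarrow> (\<forall>v\<in>carrier_vec n. v \<noteq> 0\<^sub>v n \<longrightarrow> cip v (A *\<^sub>v v) \<in> \<real> \<and> Re (cip v (A *\<^sub>v v)) > 0)"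
  using assms qform_eq_cip[OF assms] unfolding pd_def by auto

section \<open>Invertibility and inverse matrices\<close>

lemma det_nonzero_if_ker_trivial:
  fixes A :: "complex mat"
  assumes "A \<in> carrier_mat n n" "\<And>v. v \<in> carrier_vec n \<Longrightarrow> A *\<^sub>v v = 0\<^sub>v n \<Longrightarrow> v = 0\<^sub>v n"
  shows "det A \<noteq> 0"
  using det_0_iff_vec_prod_zero_field[OF assms(1)] assms(2) by auto

lemma minv_works:
  assumes A: "A \<in> carrier_mat n n" and d: "det A \<noteq> 0"
  shows "minv A \<in> carrier_mat n n" "A * minv A = 1\<^sub>m n" "minv A * A = 1\<^sub>m n"
proof -
  have "\<exists>B. B \<in> carrier_mat n n \<and> A * B = 1\<^sub>m n \<and> B * A = 1\<^sub>m n"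
    using A d det_non_zero_imp_unit[OF A d] unfolding Units_def ring_mat_def by auto
  from someI_ex[OF this] show "minv A \<in> carrier_mat n n" "A * minv A = 1\<^sub>m n" "minv A * A = 1\<^sub>m n"
    using A unfolding minv_def by auto
qed

lemma minv_eqI:
  assumes A: "A \<in> carrier_mat n n" and B: "B \<in> carrier_mat n n" and AB: "A * B = 1\<^sub>m n"
  shows "minv A = B" "det A \<noteq> 0"
proof -
  have "det A * det B = 1" using det_mult[OF A B] AB by simp
  then show d: "det A \<noteq> 0" by auto
  note m = minv_works[OF A d]
  have "minv A = minv A * (A * B)" using m AB by auto
  also have "\<dots> = B" using m A B by (simp flip: assoc_mult_mat[of _ n n _ n _ n])
  finally show "minv A = B" .
qed

text \<open>Cramer's rule shows each entry of an inverse as a rational expression in the entries of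
  the matrix; this is how holomorphy passes to inverses and meromorphy to quotients.\<close>

lemma minv_cramer:
  assumes A: "A \<in> carrier_mat n n" and d: "det A \<noteq> 0" and ij: "i < n" "j < n"
  shows "minv A $$ (i, j) = adj_mat A $$ (i, j) / det A"
proof -
  have "A * (inverse (det A) \<cdot>\<^sub>m adj_mat A) = 1\<^sub>m n"
    using adj_mat(1,2)[OF A] d mult_smult_distrib[OF A adj_mat(1)[OF A]] by auto
  then have "minv A = inverse (det A) \<cdot>\<^sub>m adj_mat A"
    using adj_mat(1)[OF A] by (intro minv_eqI(1)[OF A]) auto
  then show ?thesis using adj_mat(1)[OF A] ij by (simp add: field_simps)
qed

lemma mult_cancel_vec:
  fixes A :: "complex mat"
  assumes "B \<in> carrier_mat n n" "A \<in> carrier_mat n n" "B * A = 1\<^sub>m n" "v \<in> carrier_vec n"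
  shows "B *\<^sub>v (A *\<^sub>v v) = v"
  using assms by (metis assoc_mult_mat_vec one_mult_mat_vec)

lemma mat_eq_if_mult_vec_eq:
  fixes A B :: "complex mat"
  assumes "A \<in> carrier_mat n m" "B \<in> carrier_mat n m"
    "\<And>v. v \<in> carrier_vec m \<Longrightarrow> A *\<^sub>v v = B *\<^sub>v v"
  shows "A = B"
proof (rule eq_matI)
  fix i j assume ij: "i < dim_row B" "j < dim_col B"
  have "(A *\<^sub>v unit_vec m j) $ i = (B *\<^sub>v unit_vec m j) $ i" using assms(3)[of "unit_vec m j"] by simp
  then show "A $$ (i, j) = B $$ (i, j)" using assms(1,2) ij
    by (simp add: scalar_prod_right_unit)
qed (use assms in auto)

section \<open>The transfer function of a block Toeplitz matrix\<close>

lemma eq_if_div_mod_eq: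
  fixes a b p :: nat
  assumes "a mod p = b mod p" "a div p = b div p"
  shows "a = b"
  using assms by (metis div_mult_mod_eq)

locale toeplitz_data =
  fixes p N :: nat and s :: "int \<Rightarrow> complex mat" and a0 :: "complex mat"
  assumes p_ge_1: "p \<ge> 1"
    and s_carrier: "\<And>k. \<bar>k\<bar> \<le> int N \<Longrightarrow> s k \<in> carrier_mat p p"
    and s_herm: "\<And>k. \<bar>k\<bar> \<le> int N \<Longrightarrow> s (- k) = mat_adjoint (s k)"
    and toeplitz_pd: "pd (block_toeplitz p N s)"
    and a0_carrier: "a0 \<in> carrier_mat p p"
    and a0_herm: "a0 + mat_adjoint a0 = s 0"
begin

definition n :: nat where "n = (N + 1) * p"

abbreviation "S \<equiv> block_toeplitz p N s"
abbreviation "P \<equiv> Pi_mat p N s a0"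
abbreviation "J \<equiv> Jmat p"

text \<open>The nilpotent block shift T, written without block indices: one block down is p rows
  down.\<close>

definition shift :: "complex mat" where
  "shift = mat n n (\<lambda>(a, b). if a = b + p then 1 else 0)"

text \<open>The product (I - T) Pi in closed form: differencing undoes the partial sums and leaves a
  single identity block in the first block column.\<close>

definition C :: "complex mat" where
  "C = mat n (2 * p) (\<lambda>(a, b). if b < p then (if a = b then 1 else 0)
     else alph s a0 (a div p) $$ (a mod p, b - p))"

text \<open>The inverse of I - z adj(T) as a finite Neumann sum. Nilpotency makes it a polynomial in
  z, so it exists also at z = 1, which both directions use.\<close>

definition H :: "complex \<Rightarrow> complex mat" where
  "H z = mat n n (\<lambda>(a, b). if a \<le> b \<and> a mod p = b mod p then z ^ (b div p - a div p) else 0)"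

definition E :: "complex \<Rightarrow> complex mat" where
  "E z = H z * (minv S * (P * J))"

definition Theta :: "complex \<Rightarrow> complex mat" where
  "Theta z = 1\<^sub>m (2 * p) + (z - 1) \<cdot>\<^sub>m (mat_adjoint C * E z)"

lemma p_pos: "p > 0" using p_ge_1 by simp

lemma div_le: "a < n \<Longrightarrow> a div p \<le> N"
  using p_pos unfolding n_def by (metis Suc_eq_plus1 div_less_iff_less_mult less_Suc_eq_le)

lemma carriers [simp, intro]:
  "S \<in> carrier_mat n n" "P \<in> carrier_mat n (2 * p)" "J \<in> carrier_mat (2 * p) (2 * p)"
  "shift \<in> carrier_mat n n" "C \<in> carrier_mat n (2 * p)" "H z \<in> carrier_mat n n"
  "mat_adjoint shift \<in> carrier_mat n n" "mat_adjoint C \<in> carrier_mat (2 * p) n"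
  "mat_adjoint P \<in> carrier_mat (2 * p) n" "A_mat p N \<in> carrier_mat n n"
  by (auto simp: block_toeplitz_def Pi_mat_def Jmat_def shift_def C_def H_def A_mat_def n_def)

lemmas dims [simp] = carriers[THEN carrier_matD(1)] carriers[THEN carrier_matD(2)]

lemma entries:
  "a < n \<Longrightarrow> b < n \<Longrightarrow> S $$ (a, b) = s (int (b div p) - int (a div p)) $$ (a mod p, b mod p)"
  "a < n \<Longrightarrow> b < 2 * p \<Longrightarrow> P $$ (a, b) = (if b < p then (if a mod p = b then 1 else 0)
     else (\<Sum>k\<le>a div p. alph s a0 k $$ (a mod p, b - p)))"
  "a < n \<Longrightarrow> b < n \<Longrightarrow> shift $$ (a, b) = (if a = b + p then 1 else 0)"
  "a < n \<Longrightarrow> b < 2 * p \<Longrightarrow> C $$ (a, b) = (if b < p then (if a = b then 1 else 0)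
     else alph s a0 (a div p) $$ (a mod p, b - p))"
  "a < n \<Longrightarrow> b < n \<Longrightarrow>
     H z $$ (a, b) = (if a \<le> b \<and> a mod p = b mod p then z ^ (b div p - a div p) else 0)"
  "a < n \<Longrightarrow> b < n \<Longrightarrow> A_mat p N $$ (a, b) = (if a mod p \<noteq> b mod p then 0
     else if b div p > a div p then 0 else if b div p = a div p then \<i> / 2 else \<i>)"
  "a < 2 * p \<Longrightarrow> b < 2 * p \<Longrightarrow> J $$ (a, b) = (if a = b + p \<or> b = a + p then 1 else 0)"
  by (auto simp: block_toeplitz_def Pi_mat_def Jmat_def shift_def C_def H_def A_mat_def Let_def n_def)

lemma div_minus_p: "p \<le> a \<Longrightarrow> (a - p) div p = a div p - 1"
  using p_pos by (simp add: le_div_geq)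

lemma mod_minus_p: "p \<le> a \<Longrightarrow> (a - p) mod p = a mod p"
  by (simp add: le_mod_geq)

lemma div_pos: "p \<le> a \<Longrightarrow> a div p \<ge> 1"
  using p_pos by (simp add: le_div_geq)

lemma shift_vec:
  assumes "v \<in> carrier_vec n" "a < n"
  shows "(shift *\<^sub>v v) $ a = (if p \<le> a then v $ (a - p) else 0)"
proof -
  have "(shift *\<^sub>v v) $ a = (\<Sum>b<n. if b = a - p \<and> p \<le> a then v $ b else 0)"
    using assms by (subst index_mult_vec_sum[of _ n n]) (auto simp: entries simp del: sum.delta sum.delta' intro!: sum.cong)
  also have "\<dots> = (if p \<le> a then v $ (a - p) else 0)"
    using assms p_pos by (cases "p \<le> a") (auto simp: sum.delta)
  finally show ?thesis .
qed

lemma shift_mat: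
  assumes "M \<in> carrier_mat n m" "a < n" "b < m"
  shows "(shift * M) $$ (a, b) = (if p \<le> a then M $$ (a - p, b) else 0)"
proof -
  have "(shift * M) $$ (a, b) = (\<Sum>c<n. if c = a - p \<and> p \<le> a then M $$ (c, b) else 0)"
    using assms by (subst index_mult_sum[of _ n n _ m]) (auto simp: entries simp del: sum.delta sum.delta' intro!: sum.cong)
  also have "\<dots> = (if p \<le> a then M $$ (a - p, b) else 0)"
    using assms p_pos by (cases "p \<le> a") (auto simp: sum.delta)
  finally show ?thesis .
qed

lemma shift_adjoint_mat:
  assumes "M \<in> carrier_mat n m" "a < n" "b < m"
  shows "(mat_adjoint shift * M) $$ (a, b) = (if a + p < n then M $$ (a + p, b) else 0)"
proof -
  have "(mat_adjoint shift * M) $$ (a, b) = (\<Sum>c<n. if c = a + p then M $$ (c, b) else 0)"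
    using assms by (subst index_mult_sum[of _ n n _ m]) (auto simp: entries simp del: sum.delta sum.delta' intro!: sum.cong)
  also have "\<dots> = (if a + p < n then M $$ (a + p, b) else 0)"
    using assms p_pos by (auto simp: sum.delta)
  finally show ?thesis .
qed

lemma mult_shift_adjoint:
  assumes "M \<in> carrier_mat m n" "a < m" "b < n"
  shows "(M * mat_adjoint shift) $$ (a, b) = (if p \<le> b then M $$ (a, b - p) else 0)"
proof -
  have "(M * mat_adjoint shift) $$ (a, b) = (\<Sum>c<n. if c = b - p \<and> p \<le> b then M $$ (a, c) else 0)"
    using assms by (subst index_mult_sum[of _ m n _ n]) (auto simp: entries simp del: sum.delta sum.delta' intro!: sum.cong)
  also have "\<dots> = (if p \<le> b then M $$ (a, b - p) else 0)"
    using assms p_pos by (cases "p \<le> b") (auto simp: sum.delta)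
  finally show ?thesis .
qed

lemma P_minus_shift: "P - shift * P = C"
proof (rule eq_matI)
  fix a b assume "a < dim_row C" "b < dim_col C"
  then have ab: "a < n" "b < 2 * p" by auto
  have lt: "a - p < n" using ab by linarith
  show "(P - shift * P) $$ (a, b) = C $$ (a, b)"
  proof (cases "p \<le> a")
    case True
    have "(\<Sum>k\<le>a div p. f k) - (\<Sum>k\<le>a div p - 1. f k) = f (a div p)" for f :: "nat \<Rightarrow> complex"
      using div_pos[OF True] by (cases "a div p") auto
    moreover have "(P - shift * P) $$ (a, b) = P $$ (a, b) - P $$ (a - p, b)"
      using ab True shift_mat[OF carriers(2) ab] by (subst index_minus_mat(1)) (auto simp del: index_mult_mat(1))
    ultimately show ?thesis
      using ab lt True by (auto simp: entries div_minus_p mod_minus_p)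
  next
    case False
    then have "(P - shift * P) $$ (a, b) = P $$ (a, b)"
      using ab shift_mat[OF carriers(2) ab] by (subst index_minus_mat(1)) (auto simp del: index_mult_mat(1))
    then show ?thesis
      using ab lt False by (auto simp: entries)
  qed
qed auto

lemma J_vec:
  assumes "y \<in> carrier_vec (2 * p)" "a < 2 * p"
  shows "(J *\<^sub>v y) $ a = y $ (if a < p then a + p else a - p)"
proof -
  have "(J *\<^sub>v y) $ a = (\<Sum>b<2*p. if b = (if a < p then a + p else a - p) then y $ b else 0)"
    using assms by (subst index_mult_vec_sum[of _ "2*p" "2*p"]) (auto simp: entries simp del: sum.delta sum.delta' intro!: sum.cong)
  also have "\<dots> = y $ (if a < p then a + p else a - p)"
    using assms by (subst sum.delta) auto
  finally show ?thesis .
qed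

lemma J_mat:
  assumes "M \<in> carrier_mat (2 * p) m" "a < 2 * p" "b < m"
  shows "(J * M) $$ (a, b) = M $$ (if a < p then a + p else a - p, b)"
proof -
  have "(J * M) $$ (a, b) = (\<Sum>c<2*p. if c = (if a < p then a + p else a - p) then M $$ (c, b) else 0)"
    using assms by (subst index_mult_sum[of _ "2*p" "2*p" _ m]) (auto simp: entries simp del: sum.delta sum.delta' intro!: sum.cong)
  also have "\<dots> = M $$ (if a < p then a + p else a - p, b)"
    using assms by (subst sum.delta) auto
  finally show ?thesis .
qed

lemma alph_adjoint:
  assumes "0 < k" "k \<le> N" "i < p" "j < p"
  shows "cnj (alph s a0 k $$ (i, j)) = s (int k) $$ (j, i)"
  using assms s_herm[of "int k"] s_carrier[of "int k"] by (auto simp: alph_def)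

lemma s_0: "i < p \<Longrightarrow> j < p \<Longrightarrow> s 0 $$ (i, j) = a0 $$ (i, j) + cnj (a0 $$ (j, i))"
  using a0_carrier by (subst a0_herm[symmetric]) auto

text \<open>Blocks are constant along diagonals, so subtracting the copy moved one block down and
  right leaves only the first block row and column. This hook has rank at most 2p; its corner is
  where \<alpha>_0 + adj(\<alpha>_0) = s_0 enters.\<close>

lemma displacement: "S - shift * (S * mat_adjoint shift) = C * (J * mat_adjoint C)"
proof (rule eq_matI)
  fix a b assume "a < dim_row (C * (J * mat_adjoint C))" "b < dim_col (C * (J * mat_adjoint C))"
  then have ab: "a < n" "b < n" by auto
  have m: "a mod p < p" "b mod p < p" using p_pos by auto
  have Ss: "S * mat_adjoint shift \<in> carrier_mat n n" by (intro mult_carrier_mat[of _ n n]) auto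
  have "(C * (J * mat_adjoint C)) $$ (a, b)
      = (\<Sum>k<2*p. C $$ (a, k) * cnj (C $$ (b, if k < p then k + p else k - p)))"
    using ab by (subst index_mult_sum[of _ n "2*p" _ n], simp_all del: index_mult_mat(1))
      (auto intro!: sum.cong simp: J_mat[of _ n] entries simp del: index_mult_mat(1))
  also have "\<dots> = (\<Sum>k<p. if k = a then cnj (alph s a0 (b div p) $$ (b mod p, k)) else 0)
      + (\<Sum>k<p. if k = b then alph s a0 (a div p) $$ (a mod p, k) else 0)"
    using ab by (subst sum_split_double) (auto intro!: arg_cong2[of _ _ _ _ "(+)"] sum.cong simp: entries
        simp del: sum.delta sum.delta')
  also have "\<dots> = (if a < p then cnj (alph s a0 (b div p) $$ (b mod p, a)) else 0)
      + (if b < p then alph s a0 (a div p) $$ (a mod p, b) else 0)"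
    by (simp add: sum.delta)
  finally have R: "(C * (J * mat_adjoint C)) $$ (a, b) = \<dots>" .
  have "(S - shift * (S * mat_adjoint shift)) $$ (a, b)
     = S $$ (a, b) - (if p \<le> a \<and> p \<le> b then S $$ (a - p, b - p) else 0)"
    using ab p_pos shift_mat[OF Ss ab] mult_shift_adjoint[OF carriers(1), of "a - p" b]
    by (subst index_minus_mat(1)) (auto simp del: index_mult_mat(1))
  also have "\<dots> = (if a < p then cnj (alph s a0 (b div p) $$ (b mod p, a)) else 0)
      + (if b < p then alph s a0 (a div p) $$ (a mod p, b) else 0)"
  proof (cases "p \<le> a")
    case pa: True
    show ?thesis
    proof (cases "p \<le> b")
      case True
      have lt: "a - p < n" "b - p < n" using ab by linarith+
      \<comment> \<open>Both block indices are at least 1, so truncated subtraction lowers each by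
        exactly 1.\<close>
      have eq: "int (b div p - 1) - int (a div p - 1) = int (b div p) - int (a div p)"
        using div_pos[OF True] div_pos[OF pa] by auto
      show ?thesis using True pa ab lt eq
        by (auto simp: entries div_minus_p mod_minus_p)
    next
      case False
      then show ?thesis using pa ab div_pos[OF pa] by (auto simp: entries alph_def)
    qed
  next
    case False
    show ?thesis
    proof (cases "p \<le> b")
      case True
      then show ?thesis using False ab div_pos[OF True] m alph_adjoint[of "b div p" "b mod p" a] div_le[of b]
        by (auto simp: entries)
    next
      case b: False
      then show ?thesis using False ab by (auto simp: entries alph_def s_0)
    qed
  qed
  finally show "(S - shift * (S * mat_adjoint shift)) $$ (a, b) = (C * (J * mat_adjoint C)) $$ (a, b)"
    using R by simp
qed auto

lemma S_adjoint: "mat_adjoint S = S"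
proof (rule eq_matI)
  fix a b assume "a < dim_row S" "b < dim_col S"
  then have ab: "a < n" "b < n" by (auto simp: entries)
  define k where "k = int (b div p) - int (a div p)"
  have k: "\<bar>k\<bar> \<le> int N" using ab div_le[of a] div_le[of b] by (auto simp: k_def)
  have "s (- k) $$ (b mod p, a mod p) = cnj (s k $$ (a mod p, b mod p))"
    using s_herm[OF k] s_carrier[OF k] p_pos by simp
  then show "mat_adjoint S $$ (a, b) = S $$ (a, b)"
    using ab by (auto simp: entries k_def)
qed auto

lemma S_det: "det S \<noteq> 0"
proof (rule det_nonzero_if_ker_trivial[of _ n])
  fix v assume v: "v \<in> carrier_vec n" "S *\<^sub>v v = 0\<^sub>v n"
  then have "cip v (S *\<^sub>v v) = 0" by (simp add: cip_def)
  then show "v = 0\<^sub>v n"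
    using v(1) toeplitz_pd[unfolded pd_iff[OF carriers(1)]] by force
qed auto

lemmas S_inv [simp] = minv_works[OF carriers(1) S_det]

lemma S_inv_adjoint: "mat_adjoint (minv S) = minv S"
proof (rule minv_eqI(1)[symmetric, of _ n])
  have "mat_adjoint (minv S * S) = S * mat_adjoint (minv S)"
    by (subst mat_adjoint_mult[of _ n n _ n]) (auto simp: S_adjoint)
  then show "S * mat_adjoint (minv S) = 1\<^sub>m n" by simp
qed auto

lemma E_carrier [simp, intro]: "E z \<in> carrier_mat n (2 * p)"
  unfolding E_def
  by (intro mult_carrier_mat[of _ n n] mult_carrier_mat[of _ n "2*p"]) auto

lemma Theta_carrier [simp, intro]: "Theta z \<in> carrier_mat (2 * p) (2 * p)"
  unfolding Theta_def by (intro add_carrier_mat smult_carrier_mat mult_carrier_mat[of _ _ n]) auto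

lemmas E_Theta_dims [simp] = E_carrier[THEN carrier_matD(1)] E_carrier[THEN carrier_matD(2)]
  Theta_carrier[THEN carrier_matD(1)] Theta_carrier[THEN carrier_matD(2)]

lemma H_recursion: "H z - z \<cdot>\<^sub>m (mat_adjoint shift * H z) = 1\<^sub>m n"
proof (rule eq_matI)
  fix a b assume "a < dim_row (1\<^sub>m n :: complex mat)" "b < dim_col (1\<^sub>m n :: complex mat)"
  then have ab: "a < n" "b < n" by auto
  have "(H z - z \<cdot>\<^sub>m (mat_adjoint shift * H z)) $$ (a, b)
     = H z $$ (a, b) - z * (if a + p < n then H z $$ (a + p, b) else 0)"
    using ab shift_adjoint_mat[OF carriers(6) ab]
    by (subst index_minus_mat(1)) (auto simp del: index_mult_mat(1) simp: entries)
  also have "\<dots> = 1\<^sub>m n $$ (a, b)"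
  proof (cases "a < b \<and> a mod p = b mod p")
    case True
    \<comment> \<open>With equal residues, a < b puts b into a strictly later block. Hence a + p is
      at most b, and one power of z can be split off.\<close>
    have "a div p \<le> b div p" using True by (simp add: div_le_mono)
    moreover have "a div p \<noteq> b div p" using True eq_if_div_mod_eq[of a p b] by auto
    ultimately have lt: "a div p < b div p" by simp
    have "a + p = (a div p + 1) * p + a mod p" by simp
    also have "\<dots> \<le> b div p * p + b mod p"
      using lt True by (intro add_mono mult_le_mono1) auto
    finally have ap: "a + p \<le> b" by simp
    have "b div p - a div p = Suc (b div p - Suc (a div p))" using lt by simp
    then show ?thesis using True ap ab p_pos by (simp add: entries flip: power_Suc)
  next
    case False
    then show ?thesis using ab p_pos by (auto simp: entries)
  qed
  finally show "(H z - z \<cdot>\<^sub>m (mat_adjoint shift * H z)) $$ (a, b) = 1\<^sub>m n $$ (a, b)" .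
qed auto

lemma H_right_inverse: "(1\<^sub>m n - z \<cdot>\<^sub>m mat_adjoint shift) * H z = 1\<^sub>m n"
proof -
  have "(1\<^sub>m n - z \<cdot>\<^sub>m mat_adjoint shift) * H z = 1\<^sub>m n * H z - (z \<cdot>\<^sub>m mat_adjoint shift) * H z"
    by (rule minus_mult_distrib_mat[of _ n n _ _ n]) auto
  also have "\<dots> = 1\<^sub>m n"
    using H_recursion[of z] mult_smult_assoc_mat[of "mat_adjoint shift" n n "H z" n z] by simp
  finally show ?thesis .
qed

lemma H_left_inverse: "H z * (1\<^sub>m n - z \<cdot>\<^sub>m mat_adjoint shift) = 1\<^sub>m n"
  by (rule mat_mult_left_right_inverse[OF _ _ H_right_inverse]) auto

end

section \<open>Vector identities for the transfer function\<close>

lemma vec_diff_swap: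
  fixes a b c d :: "complex vec"
  assumes "a \<in> carrier_vec n" "b \<in> carrier_vec n" "c \<in> carrier_vec n" "d \<in> carrier_vec n"
    and "a - c = b - d"
  shows "c - d = a - b"
proof (rule eq_vecI)
  fix i assume "i < dim_vec (a - b)"
  then have "i < n" using assms by simp
  moreover have "(a - c) $ i = (b - d) $ i" using assms(5) by simp
  ultimately show "(c - d) $ i = (a - b) $ i" using assms(1-4) by (simp add: algebra_simps)
qed (use assms in auto)

lemma smult_mat_vec:
  fixes A :: "complex mat"
  assumes "A \<in> carrier_mat m k" "v \<in> carrier_vec k"
  shows "(c \<cdot>\<^sub>m A) *\<^sub>v v = c \<cdot>\<^sub>v (A *\<^sub>v v)"
  using assms by (intro eq_vecI) auto

context toeplitz_data
begin

lemma J_adjoint: "mat_adjoint J = J"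
  by (rule eq_matI) (auto simp: entries)

lemma vec_carriers [simp, intro]:
  "y \<in> carrier_vec (2 * p) \<Longrightarrow> J *\<^sub>v y \<in> carrier_vec (2 * p)"
  "y \<in> carrier_vec (2 * p) \<Longrightarrow> C *\<^sub>v y \<in> carrier_vec n"
  "y \<in> carrier_vec (2 * p) \<Longrightarrow> P *\<^sub>v y \<in> carrier_vec n"
  "y \<in> carrier_vec (2 * p) \<Longrightarrow> E z *\<^sub>v y \<in> carrier_vec n"
  "y \<in> carrier_vec (2 * p) \<Longrightarrow> Theta z *\<^sub>v y \<in> carrier_vec (2 * p)"
  "d \<in> carrier_vec n \<Longrightarrow> S *\<^sub>v d \<in> carrier_vec n"
  "d \<in> carrier_vec n \<Longrightarrow> minv S *\<^sub>v d \<in> carrier_vec n"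
  "d \<in> carrier_vec n \<Longrightarrow> H z *\<^sub>v d \<in> carrier_vec n"
  "d \<in> carrier_vec n \<Longrightarrow> shift *\<^sub>v d \<in> carrier_vec n"
  "d \<in> carrier_vec n \<Longrightarrow> mat_adjoint shift *\<^sub>v d \<in> carrier_vec n"
  "d \<in> carrier_vec n \<Longrightarrow> mat_adjoint C *\<^sub>v d \<in> carrier_vec (2 * p)"
  by (rule mult_mat_vec_carrier; auto)+

lemmas vec_dims [simp] = vec_carriers[THEN carrier_vecD]

lemma H_vec:
  assumes "d \<in> carrier_vec n"
  shows "H z *\<^sub>v d - z \<cdot>\<^sub>v (mat_adjoint shift *\<^sub>v (H z *\<^sub>v d)) = d"
proof -
  have zs: "z \<cdot>\<^sub>m mat_adjoint shift \<in> carrier_mat n n" by auto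
  have "d = ((1\<^sub>m n - z \<cdot>\<^sub>m mat_adjoint shift) * H z) *\<^sub>v d"
    using assms H_right_inverse by simp
  also have "\<dots> = (1\<^sub>m n - z \<cdot>\<^sub>m mat_adjoint shift) *\<^sub>v (H z *\<^sub>v d)"
    using assms zs by (intro assoc_mult_mat_vec[of _ n n _ n]) auto
  also have "\<dots> = H z *\<^sub>v d - (z \<cdot>\<^sub>m mat_adjoint shift) *\<^sub>v (H z *\<^sub>v d)"
    using assms zs by (subst minus_mult_distrib_mat_vec[of _ n n]) auto
  finally show ?thesis using assms smult_mat_vec[of "mat_adjoint shift" n n "H z *\<^sub>v d" z] by simp
qed

lemma H_vec_cancel:
  assumes "e \<in> carrier_vec n"
  shows "H z *\<^sub>v (e - z \<cdot>\<^sub>v (mat_adjoint shift *\<^sub>v e)) = e"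
proof -
  have zs: "z \<cdot>\<^sub>m mat_adjoint shift \<in> carrier_mat n n" by auto
  have "e = (H z * (1\<^sub>m n - z \<cdot>\<^sub>m mat_adjoint shift)) *\<^sub>v e"
    using assms H_left_inverse by simp
  also have "\<dots> = H z *\<^sub>v ((1\<^sub>m n - z \<cdot>\<^sub>m mat_adjoint shift) *\<^sub>v e)"
    using assms zs by (intro assoc_mult_mat_vec[of _ n n _ n]) auto
  also have "(1\<^sub>m n - z \<cdot>\<^sub>m mat_adjoint shift) *\<^sub>v e = e - z \<cdot>\<^sub>v (mat_adjoint shift *\<^sub>v e)"
    using assms zs smult_mat_vec[of "mat_adjoint shift" n n e z]
    by (subst minus_mult_distrib_mat_vec[of _ n n]) auto
  finally show ?thesis by simp
qed

text \<open>I - z adj(T) is invertible for every z, not only in the disc; it is the value z = 1 that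
  matters later.\<close>

lemma shift_fixed_trivial:
  assumes "e \<in> carrier_vec n" "e - z \<cdot>\<^sub>v (mat_adjoint shift *\<^sub>v e) = 0\<^sub>v n"
  shows "e = 0\<^sub>v n"
  using H_vec_cancel[OF assms(1), of z] unfolding assms(2) by (auto intro!: eq_vecI)

lemma S_cancel [simp]: "d \<in> carrier_vec n \<Longrightarrow> S *\<^sub>v (minv S *\<^sub>v d) = d"
  "d \<in> carrier_vec n \<Longrightarrow> minv S *\<^sub>v (S *\<^sub>v d) = d"
  by (rule mult_cancel_vec[of _ n]; simp)+

lemma C_vec:
  assumes "y \<in> carrier_vec (2 * p)"
  shows "C *\<^sub>v y = P *\<^sub>v y - shift *\<^sub>v (P *\<^sub>v y)"
proof -
  have "C *\<^sub>v y = (P - shift * P) *\<^sub>v y" by (simp add: P_minus_shift)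
  also have "\<dots> = P *\<^sub>v y - (shift * P) *\<^sub>v y"
    using assms by (intro minus_mult_distrib_mat_vec[of _ n "2*p"] mult_carrier_mat[of _ n n]) auto
  also have "(shift * P) *\<^sub>v y = shift *\<^sub>v (P *\<^sub>v y)"
    using assms by (intro assoc_mult_mat_vec[of _ n n _ "2*p"]) auto
  finally show ?thesis .
qed

lemma E_vec:
  assumes "y \<in> carrier_vec (2 * p)"
  shows "E z *\<^sub>v y = H z *\<^sub>v (minv S *\<^sub>v (P *\<^sub>v (J *\<^sub>v y)))"
proof -
  have c: "P * J \<in> carrier_mat n (2*p)" "minv S * (P * J) \<in> carrier_mat n (2*p)"
    by (intro mult_carrier_mat[of _ n n] mult_carrier_mat[of _ n "2*p"]; auto)+
  then show ?thesis
    unfolding E_def using assms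
    by (subst assoc_mult_mat_vec[of _ n n _ "2*p"], auto,
        subst assoc_mult_mat_vec[of _ n n _ "2*p"], auto,
        subst assoc_mult_mat_vec[of _ n "2*p" _ "2*p"], auto)
qed

lemma Theta_vec:
  assumes "y \<in> carrier_vec (2 * p)"
  shows "Theta z *\<^sub>v y = y + (z - 1) \<cdot>\<^sub>v (mat_adjoint C *\<^sub>v (E z *\<^sub>v y))"
proof -
  have c: "mat_adjoint C * E z \<in> carrier_mat (2*p) (2*p)"
    by (intro mult_carrier_mat[of _ _ n]; auto)
  have "Theta z *\<^sub>v y = y + ((z - 1) \<cdot>\<^sub>m (mat_adjoint C * E z)) *\<^sub>v y"
    unfolding Theta_def using assms c by (subst add_mult_distrib_mat_vec[of _ "2*p" "2*p"]) auto
  also have "((z - 1) \<cdot>\<^sub>m (mat_adjoint C * E z)) *\<^sub>v y = (z - 1) \<cdot>\<^sub>v ((mat_adjoint C * E z) *\<^sub>v y)"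
    using assms c smult_mat_vec by blast
  also have "(mat_adjoint C * E z) *\<^sub>v y = mat_adjoint C *\<^sub>v (E z *\<^sub>v y)"
    using assms by (intro assoc_mult_mat_vec[of _ "2*p" n _ "2*p"]) auto
  finally show ?thesis .
qed

lemma displacement_vec:
  assumes "e \<in> carrier_vec n"
  shows "C *\<^sub>v (J *\<^sub>v (mat_adjoint C *\<^sub>v e)) = S *\<^sub>v e - shift *\<^sub>v (S *\<^sub>v (mat_adjoint shift *\<^sub>v e))"
proof -
  have c: "J * mat_adjoint C \<in> carrier_mat (2*p) n" "S * mat_adjoint shift \<in> carrier_mat n n"
    "shift * (S * mat_adjoint shift) \<in> carrier_mat n n"
    by (intro mult_carrier_mat[of _ n n] mult_carrier_mat[of _ _ "2*p"]; auto)+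
  have "C *\<^sub>v (J *\<^sub>v (mat_adjoint C *\<^sub>v e)) = (C * (J * mat_adjoint C)) *\<^sub>v e"
    using c assms by (subst assoc_mult_mat_vec[of _ n "2*p" _ n], auto,
      subst assoc_mult_mat_vec[of _ "2*p" "2*p" _ n], auto)
  also have "\<dots> = S *\<^sub>v e - (shift * (S * mat_adjoint shift)) *\<^sub>v e"
    using c assms unfolding displacement[symmetric] by (subst minus_mult_distrib_mat_vec[of _ n n]) auto
  also have "(shift * (S * mat_adjoint shift)) *\<^sub>v e = shift *\<^sub>v (S *\<^sub>v (mat_adjoint shift *\<^sub>v e))"
    using c assms by (subst assoc_mult_mat_vec[of _ n n _ n], auto,
      subst assoc_mult_mat_vec[of _ n n _ n], auto)
  finally show ?thesis .
qed

text \<open>Multiplying the formula for \<open>E\<close> by I - z adj(T), by S and by I - T removes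
  in turn \<open>H\<close>, the inverse of S and the partial sums. What remains involves only S, T
  and C.\<close>

lemma E_equation:
  assumes y: "y \<in> carrier_vec (2 * p)" and e: "e = E z *\<^sub>v y" and d: "d = e - z \<cdot>\<^sub>v (mat_adjoint shift *\<^sub>v e)"
  shows "S *\<^sub>v d - shift *\<^sub>v (S *\<^sub>v d) = C *\<^sub>v (J *\<^sub>v y)"
proof -
  have "d = minv S *\<^sub>v (P *\<^sub>v (J *\<^sub>v y))"
    using y H_vec[of "minv S *\<^sub>v (P *\<^sub>v (J *\<^sub>v y))" z] unfolding d e E_vec[OF y] by simp
  then show ?thesis using y by (simp add: C_vec)
qed

text \<open>I - T is injective, so the equation determines S d, then d, then e. A vector found by
  other means can thus be recognised as \<open>E z\<close> applied to y.\<close>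

lemma E_unique:
  assumes y: "y \<in> carrier_vec (2 * p)" and e: "e \<in> carrier_vec n"
    and d: "d = e - z \<cdot>\<^sub>v (mat_adjoint shift *\<^sub>v e)"
    and eq: "S *\<^sub>v d - shift *\<^sub>v (S *\<^sub>v d) = C *\<^sub>v (J *\<^sub>v y)"
  shows "E z *\<^sub>v y = e"
proof -
  have dc: "d \<in> carrier_vec n" using e d by auto
  define b where "b = S *\<^sub>v d - P *\<^sub>v (J *\<^sub>v y)"
  have b: "b \<in> carrier_vec n" using dc y by (auto simp: b_def)
  have "shift *\<^sub>v b = b"
  proof -
    have "shift *\<^sub>v b = shift *\<^sub>v (S *\<^sub>v d) - shift *\<^sub>v (P *\<^sub>v (J *\<^sub>v y))"
      unfolding b_def using dc y by (intro mult_minus_distrib_mat_vec[of _ n n]) auto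
    moreover have "S *\<^sub>v d - shift *\<^sub>v (S *\<^sub>v d) = P *\<^sub>v (J *\<^sub>v y) - shift *\<^sub>v (P *\<^sub>v (J *\<^sub>v y))"
      using eq C_vec y by simp
    moreover have "shift *\<^sub>v (S *\<^sub>v d) - shift *\<^sub>v (P *\<^sub>v (J *\<^sub>v y)) = S *\<^sub>v d - P *\<^sub>v (J *\<^sub>v y)"
      if "S *\<^sub>v d - shift *\<^sub>v (S *\<^sub>v d) = P *\<^sub>v (J *\<^sub>v y) - shift *\<^sub>v (P *\<^sub>v (J *\<^sub>v y))"
      using dc y by (intro vec_diff_swap[OF _ _ _ _ that, of n]) simp_all
    ultimately show ?thesis by (simp add: b_def)
  qed
  \<comment> \<open>A fixed vector of T vanishes: its first block is 0 and each later block copies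
    the one before.\<close>
  then have rec: "b $ a = (if p \<le> a then b $ (a - p) else 0)" if "a < n" for a
    using shift_vec[OF b that] by simp
  have "b $ a = 0" if "a < n" for a
    using that
  proof (induction a rule: less_induct)
    case (less a)
    then show ?case using rec[OF less.prems] less.IH[of "a - p"] p_pos by auto
  qed
  then have "b = 0\<^sub>v n" using b by (intro eq_vecI) auto
  then have Sd: "S *\<^sub>v d = P *\<^sub>v (J *\<^sub>v y)"
    unfolding b_def using dc y by (intro eq_vecI)
      (auto dest!: arg_cong[of _ _ "\<lambda>v. v $ _"] simp: vec_eq_iff simp del: index_mult_mat_vec)
  have "E z *\<^sub>v y = H z *\<^sub>v d"
    unfolding E_vec[OF y] Sd[symmetric] using dc by simp
  also have "\<dots> = e" unfolding d by (rule H_vec_cancel[OF e])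
  finally show ?thesis .
qed

text \<open>Both parts of C J \<Theta> y can be freed of C, the first by the equation for
  \<open>E z\<close>, the second by the displacement identity. Collecting powers of z leaves z - T
  acting on S f.\<close>

lemma Theta_intertwine:
  assumes y: "y \<in> carrier_vec (2 * p)" and e: "e = E z *\<^sub>v y" and f: "f = e - mat_adjoint shift *\<^sub>v e"
  shows "C *\<^sub>v (J *\<^sub>v (Theta z *\<^sub>v y)) = z \<cdot>\<^sub>v (S *\<^sub>v f) - shift *\<^sub>v (S *\<^sub>v f)"
proof -
  have ec: "e \<in> carrier_vec n" using y e by simp
  define e' where "e' = mat_adjoint shift *\<^sub>v e"
  have ec': "e' \<in> carrier_vec n" using ec by (simp add: e'_def)
  have "C *\<^sub>v (J *\<^sub>v (Theta z *\<^sub>v y))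
      = C *\<^sub>v (J *\<^sub>v y) + (z - 1) \<cdot>\<^sub>v (C *\<^sub>v (J *\<^sub>v (mat_adjoint C *\<^sub>v e)))"
    unfolding Theta_vec[OF y] e[symmetric] using y ec
    by (simp add: mult_add_distrib_mat_vec[of J "2*p" "2*p"] mult_add_distrib_mat_vec[of C n "2*p"]
       mult_mat_vec[of J "2*p" "2*p"] mult_mat_vec[of C n "2*p"])
  also have "C *\<^sub>v (J *\<^sub>v y) = S *\<^sub>v (e - z \<cdot>\<^sub>v e') - shift *\<^sub>v (S *\<^sub>v (e - z \<cdot>\<^sub>v e'))"
    using E_equation[OF y e refl] by (simp add: e'_def)
  also have "\<dots> = (S *\<^sub>v e - z \<cdot>\<^sub>v (S *\<^sub>v e')) - (shift *\<^sub>v (S *\<^sub>v e) - z \<cdot>\<^sub>v (shift *\<^sub>v (S *\<^sub>v e')))"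
    using ec ec' by (simp add: mult_minus_distrib_mat_vec[of _ n n] mult_mat_vec[of _ n n])
  also have "C *\<^sub>v (J *\<^sub>v (mat_adjoint C *\<^sub>v e)) = S *\<^sub>v e - shift *\<^sub>v (S *\<^sub>v e')"
    using displacement_vec[OF ec] by (simp add: e'_def)
  finally have "C *\<^sub>v (J *\<^sub>v (Theta z *\<^sub>v y)) = (S *\<^sub>v e - z \<cdot>\<^sub>v (S *\<^sub>v e')) -
      (shift *\<^sub>v (S *\<^sub>v e) - z \<cdot>\<^sub>v (shift *\<^sub>v (S *\<^sub>v e'))) + (z - 1) \<cdot>\<^sub>v (S *\<^sub>v e - shift *\<^sub>v (S *\<^sub>v e'))" .
  moreover have "z \<cdot>\<^sub>v (S *\<^sub>v f) - shift *\<^sub>v (S *\<^sub>v f) =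
     z \<cdot>\<^sub>v (S *\<^sub>v e - S *\<^sub>v e') - (shift *\<^sub>v (S *\<^sub>v e) - shift *\<^sub>v (S *\<^sub>v e'))"
    unfolding f e'_def[symmetric] using ec ec'
    by (simp add: mult_minus_distrib_mat_vec[of _ n n] mult_mat_vec[of _ n n])
  ultimately show ?thesis using ec ec'
    by (auto intro!: eq_vecI simp: algebra_simps simp del: index_mult_mat_vec)
qed

text \<open>The equation for \<open>E z\<close> evaluates the mixed terms and the displacement
  identity the pure term, so everything is expressed by the values of the S-form on e and e' =
  adj(T) e. These recombine into the S-form of e - e' with the factor 1 - |z|^2.\<close>

lemma Theta_J_form:
  assumes y: "y \<in> carrier_vec (2 * p)" and e: "e = E z *\<^sub>v y" and f: "f = e - mat_adjoint shift *\<^sub>v e"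
  shows "cip (Theta z *\<^sub>v y) (J *\<^sub>v (Theta z *\<^sub>v y))
    = cip y (J *\<^sub>v y) - of_real (1 - (cmod z)\<^sup>2) * cip f (S *\<^sub>v f)"
proof -
  have ec: "e \<in> carrier_vec n" using y e by simp
  define e' where "e' = mat_adjoint shift *\<^sub>v e"
  have ec': "e' \<in> carrier_vec n" using ec by (simp add: e'_def)
  define c where "c = mat_adjoint C *\<^sub>v e"
  have cc: "c \<in> carrier_vec (2*p)" using ec by (simp add: c_def)
  define d where "d = e - z \<cdot>\<^sub>v e'"
  have dc: "d \<in> carrier_vec n" using ec ec' by (simp add: d_def)
  have Sherm: "cip a (S *\<^sub>v b) = cnj (cip b (S *\<^sub>v a))" if "a \<in> carrier_vec n" "b \<in> carrier_vec n" for a b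
    using that cip_adjoint[of S n n a b] cip_commute[of b n "S *\<^sub>v a"] by (simp add: S_adjoint)
  have Jherm: "cip a (J *\<^sub>v b) = cnj (cip b (J *\<^sub>v a))" if "a \<in> carrier_vec (2*p)" "b \<in> carrier_vec (2*p)" for a b
    using that cip_adjoint[of J "2*p" "2*p" a b] cip_commute[of b "2*p" "J *\<^sub>v a"] by (simp add: J_adjoint)
  have shift_cip: "cip a (shift *\<^sub>v b) = cip (mat_adjoint shift *\<^sub>v a) b" if "a \<in> carrier_vec n" "b \<in> carrier_vec n" for a b
    using that by (rule cip_adjoint[OF carriers(4)])
  have C_cip: "cip c b = cip e (C *\<^sub>v b)" if "b \<in> carrier_vec (2*p)" for b
    using cip_adjoint[OF carriers(5) ec that] by (simp add: c_def)
  have CJy: "C *\<^sub>v (J *\<^sub>v y) = S *\<^sub>v d - shift *\<^sub>v (S *\<^sub>v d)"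
    using E_equation[OF y e refl] by (simp add: e'_def d_def)
  have "cip c (J *\<^sub>v y) = cip e (S *\<^sub>v d) - cip e' (S *\<^sub>v d)"
    using y ec ec' dc by (simp add: C_cip CJy cip_linear[of _ n] shift_cip e'_def)
  also have "\<dots> = cip e (S *\<^sub>v e) - z * cip e (S *\<^sub>v e') - cip e' (S *\<^sub>v e) + z * cip e' (S *\<^sub>v e')"
    using ec ec' unfolding d_def
    by (simp add: cip_linear[of _ n] mult_minus_distrib_mat_vec[of _ n n] mult_mat_vec[of _ n n])
  finally have 1: "cip c (J *\<^sub>v y) = cip e (S *\<^sub>v e) - z * cip e (S *\<^sub>v e') - cip e' (S *\<^sub>v e) + z * cip e' (S *\<^sub>v e')" .
  have 2: "cip c (J *\<^sub>v c) = cip e (S *\<^sub>v e) - cip e' (S *\<^sub>v e')"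
    using ec ec' cc by (simp add: C_cip displacement_vec[OF ec, folded c_def] cip_linear[of _ n] shift_cip e'_def)
  have 3: "cip y (J *\<^sub>v c) = cnj (cip c (J *\<^sub>v y))" using Jherm y cc by blast
  have 4: "cip f (S *\<^sub>v f) = cip e (S *\<^sub>v e) - cip e (S *\<^sub>v e') - cip e' (S *\<^sub>v e) + cip e' (S *\<^sub>v e')"
    using ec ec' unfolding f e'_def[symmetric]
    by (simp add: cip_linear[of _ n] mult_minus_distrib_mat_vec[of _ n n])
  define \<alpha> \<beta> \<gamma> where "\<alpha> = cip e (S *\<^sub>v e)" and "\<beta> = cip e' (S *\<^sub>v e')" and "\<gamma> = cip e (S *\<^sub>v e')"
  have 5: "cnj \<alpha> = \<alpha>" "cnj \<beta> = \<beta>" "cip e' (S *\<^sub>v e) = cnj \<gamma>"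
    unfolding \<alpha>_def \<beta>_def \<gamma>_def using Sherm[OF ec ec] Sherm[OF ec' ec'] Sherm[OF ec' ec] by simp_all
  \<comment> \<open>A separate name for the conjugate of z, so that a polynomial identity in z and
    \<open>zz\<close> remains.\<close>
  define zz where "zz = cnj z"
  have 6: "of_real (1 - (cmod z)\<^sup>2) = 1 - z * zz" using complex_norm_square[of z] by (simp add: zz_def)
  have "cip (Theta z *\<^sub>v y) (J *\<^sub>v (Theta z *\<^sub>v y)) = cip y (J *\<^sub>v y) + (z - 1) * cip y (J *\<^sub>v c)
      + (zz - 1) * cip c (J *\<^sub>v y) + (z - 1) * (zz - 1) * cip c (J *\<^sub>v c)"
    unfolding Theta_vec[OF y] e[symmetric] c_def[symmetric] zz_def using y cc
    by (simp add: mult_add_distrib_mat_vec[of J "2*p" "2*p"] mult_mat_vec[of J "2*p" "2*p"]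
       cip_linear[of _ "2*p"] ring_distribs)
  also have "\<dots> = cip y (J *\<^sub>v y) - (1 - z * zz) * (\<alpha> - \<gamma> - cnj \<gamma> + \<beta>)"
    unfolding 3 2 1 5(3) \<alpha>_def[symmetric] \<beta>_def[symmetric] \<gamma>_def[symmetric]
    by (simp add: 5 algebra_simps zz_def[symmetric])
  also have "\<alpha> - \<gamma> - cnj \<gamma> + \<beta> = cip f (S *\<^sub>v f)"
    unfolding 4 5(3) \<alpha>_def[symmetric] \<beta>_def[symmetric] \<gamma>_def[symmetric] ..
  finally show ?thesis unfolding 6 .
qed


section \<open>The resolvent of A and the identification of the transfer function\<close>

lemma A_mat_shift: "A_mat p N - shift * A_mat p N = (\<i> / 2) \<cdot>\<^sub>m (1\<^sub>m n + shift)"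
proof (rule eq_matI)
  fix a b assume "a < dim_row ((\<i> / 2) \<cdot>\<^sub>m (1\<^sub>m n + shift))" "b < dim_col ((\<i> / 2) \<cdot>\<^sub>m (1\<^sub>m n + shift))"
  then have ab: "a < n" "b < n" by auto
  have lt: "a - p < n" using ab by linarith
  \<comment> \<open>A is i times the sum of all powers of T, less i/2. Going down a block column,
    its entries jump by i/2 on entering the main block diagonal and by i/2 just below it; these
    jumps form the difference.\<close>
  have "(A_mat p N - shift * A_mat p N) $$ (a, b)
      = A_mat p N $$ (a, b) - (if p \<le> a then A_mat p N $$ (a - p, b) else 0)"
    using ab shift_mat[OF carriers(10) ab] by (subst index_minus_mat(1)) (auto simp del: index_mult_mat(1))
  also have "\<dots> = \<i> / 2 * ((if a = b then 1 else 0) + (if a = b + p then 1 else 0))"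
  proof (cases "a mod p = b mod p")
    case False
    then have "a \<noteq> b" "a \<noteq> b + p" by auto
    then show ?thesis using False ab lt by (simp add: entries mod_minus_p)
  next
    case m: True
    have eq1: "a = b \<longleftrightarrow> a div p = b div p" using eq_if_div_mod_eq[OF m] by blast
    have eq2: "a = b + p \<longleftrightarrow> a div p = b div p + 1"
      using m p_pos eq_if_div_mod_eq[of a p "b + p"] by auto
    define f where "f k = (if b div p > k then 0 else if b div p = k then \<i> / 2 else \<i>)" for k
    have 1: "A_mat p N $$ (a, b) = f (a div p)"
      unfolding entries(6)[OF ab] f_def using m by simp
    have 2: "A_mat p N $$ (a - p, b) = f (a div p - 1)" if "p \<le> a"
      unfolding entries(6)[OF lt ab(2)] f_def mod_minus_p[OF that] div_minus_p[OF that] using m by simp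
    show ?thesis
    proof (cases "p \<le> a")
      case True
      then show ?thesis using div_pos[OF True] unfolding 1 2[OF True] eq1 eq2 f_def by auto
    next
      case False
      then have "a div p = 0" by simp
      then show ?thesis using False unfolding 1 eq1 eq2 f_def by auto
    qed
  qed
  finally show "(A_mat p N - shift * A_mat p N) $$ (a, b) = ((\<i> / 2) \<cdot>\<^sub>m (1\<^sub>m n + shift)) $$ (a, b)"
    using ab by (simp add: entries)
qed auto

text \<open>(I - T)(A - \<mu>) is a combination of I and T, and the substitution for \<mu> makes it
  a multiple of I - cnj(z) T, whose inverse is the adjoint of \<open>H z\<close>.\<close>

lemma minv_A_mat:
  assumes z: "cmod z < 1" and mu: "\<mu> = - cnj (\<i> * (z + 1) / (z - 1)) / 2"
  shows "minv (A_mat p N - \<mu> \<cdot>\<^sub>m 1\<^sub>m n)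
      = (\<i> * (cnj z - 1)) \<cdot>\<^sub>m (mat_adjoint (H z) * (1\<^sub>m n - shift))"
proof -
  define A' where "A' = A_mat p N - \<mu> \<cdot>\<^sub>m 1\<^sub>m n"
  define B where "B = (\<i> * (cnj z - 1)) \<cdot>\<^sub>m (mat_adjoint (H z) * (1\<^sub>m n - shift))"
  have A': "A' \<in> carrier_mat n n" unfolding A'_def by auto
  have HT: "mat_adjoint (H z) * (1\<^sub>m n - shift) \<in> carrier_mat n n"
    by (intro mult_carrier_mat[of _ n n]) auto
  have B: "B \<in> carrier_mat n n" unfolding B_def using HT by auto
  have "z \<noteq> 1" using z by auto
  then have z1: "cnj z - 1 \<noteq> 0" by simp
  \<comment> \<open>Chosen so that i = r (cnj z - 1); then i/2 - \<mu> = -r and i/2 + \<mu> = r cnj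
    z.\<close>
  define r where "r = \<i> / (cnj z - 1)"
  have i_eq: "\<i> = r * cnj z - r"
  proof -
    have "\<i> = r * (cnj z - 1)" unfolding r_def using z1 by simp
    then show ?thesis by (simp add: ring_distribs)
  qed
  have mu': "\<mu> = r * (cnj z + 1) / 2" unfolding mu r_def by simp
  have "(1\<^sub>m n - shift) * A' = ((1\<^sub>m n - shift) * A_mat p N) - (1\<^sub>m n - shift) * (\<mu> \<cdot>\<^sub>m 1\<^sub>m n)"
    unfolding A'_def by (intro mult_minus_distrib_mat[of _ n n]) auto
  also have "(1\<^sub>m n - shift) * A_mat p N = (\<i> / 2) \<cdot>\<^sub>m (1\<^sub>m n + shift)"
    unfolding A_mat_shift[symmetric] by (subst minus_mult_distrib_mat[of _ n n]) auto
  also have "(1\<^sub>m n - shift) * (\<mu> \<cdot>\<^sub>m 1\<^sub>m n) = \<mu> \<cdot>\<^sub>m (1\<^sub>m n - shift)"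
    by (subst mult_smult_distrib[of _ n n]) auto
  also have "(\<i> / 2) \<cdot>\<^sub>m (1\<^sub>m n + shift) - \<mu> \<cdot>\<^sub>m (1\<^sub>m n - shift)
      = (- r) \<cdot>\<^sub>m mat_adjoint (1\<^sub>m n - z \<cdot>\<^sub>m mat_adjoint shift)"
  proof (rule eq_matI)
    have m1: "\<i> / 2 - \<mu> = - r" and m2: "\<i> / 2 + \<mu> = r * cnj z"
      unfolding mu' by (simp_all add: i_eq field_simps)
    fix a b
    assume "a < dim_row ((- r) \<cdot>\<^sub>m mat_adjoint (1\<^sub>m n - z \<cdot>\<^sub>m mat_adjoint shift))"
      "b < dim_col ((- r) \<cdot>\<^sub>m mat_adjoint (1\<^sub>m n - z \<cdot>\<^sub>m mat_adjoint shift))"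
    then have ab: "a < n" "b < n" by auto
    define x where "x = shift $$ (a, b)"
    have "((\<i> / 2) \<cdot>\<^sub>m (1\<^sub>m n + shift) - \<mu> \<cdot>\<^sub>m (1\<^sub>m n - shift)) $$ (a, b)
       = (\<i> / 2 - \<mu>) * (if a = b then 1 else 0) + (\<i> / 2 + \<mu>) * x"
      using ab by (simp add: x_def algebra_simps)
    also have "\<dots> = (- r) * ((if a = b then 1 else 0) - cnj z * x)"
      unfolding m1 m2 by (simp add: algebra_simps)
    also have "\<dots> = ((- r) \<cdot>\<^sub>m mat_adjoint (1\<^sub>m n - z \<cdot>\<^sub>m mat_adjoint shift)) $$ (a, b)"
      using ab by (simp add: x_def)
    finally show "((\<i> / 2) \<cdot>\<^sub>m (1\<^sub>m n + shift) - \<mu> \<cdot>\<^sub>m (1\<^sub>m n - shift)) $$ (a, b) = \<dots>" .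
  qed auto
  finally have 1: "(1\<^sub>m n - shift) * A'
      = (- r) \<cdot>\<^sub>m mat_adjoint (1\<^sub>m n - z \<cdot>\<^sub>m mat_adjoint shift)" .
  have "mat_adjoint (H z) * mat_adjoint (1\<^sub>m n - z \<cdot>\<^sub>m mat_adjoint shift)
      = mat_adjoint ((1\<^sub>m n - z \<cdot>\<^sub>m mat_adjoint shift) * H z)"
    by (rule mat_adjoint_mult[of _ n n _ n, symmetric]) auto
  then have 2: "mat_adjoint (H z) * mat_adjoint (1\<^sub>m n - z \<cdot>\<^sub>m mat_adjoint shift) = 1\<^sub>m n"
    by (simp add: H_right_inverse)
  have "B * A' = (\<i> * (cnj z - 1)) \<cdot>\<^sub>m (mat_adjoint (H z) * (1\<^sub>m n - shift) * A')"
    unfolding B_def using A' HT by (intro mult_smult_assoc_mat[of _ n n]) auto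
  also have "mat_adjoint (H z) * (1\<^sub>m n - shift) * A' = mat_adjoint (H z) * ((1\<^sub>m n - shift) * A')"
    using A' by (intro assoc_mult_mat[of _ n n _ n _ n]) auto
  also have "\<dots> = (- r) \<cdot>\<^sub>m 1\<^sub>m n"
    unfolding 1 by (subst mult_smult_distrib[of _ n n _ n]) (auto simp: 2)
  finally have "B * A' = 1\<^sub>m n" using z1 by (auto intro!: eq_matI simp: r_def)
  then have "A' * B = 1\<^sub>m n" by (rule mat_mult_left_right_inverse[OF B A'])
  then show ?thesis using minv_eqI(1)[OF A' B] unfolding A'_def B_def by simp
qed

text \<open>The resolvent depends on cnj z; taking adjoints makes it holomorphic in z and reverses
  the factors, so that adj(C) \<open>H z\<close> meets the inverse of S times P J and forms
  \<open>E z\<close>. The constants i and cnj c multiply to z - 1.\<close>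

lemma wA_adjoint:
  assumes z: "cmod z < 1"
  shows "mat_adjoint (wA p N s a0 (- cnj (\<i> * (z + 1) / (z - 1)) / 2)) = Theta z"
proof -
  define B where "B = mat_adjoint (H z) * (1\<^sub>m n - shift)"
  have B: "B \<in> carrier_mat n n" unfolding B_def by (intro mult_carrier_mat[of _ n n]) auto
  define D where "D = J * mat_adjoint P * minv S"
  have JP: "J * mat_adjoint P \<in> carrier_mat (2*p) n" by (intro mult_carrier_mat[of _ _ "2*p"]) auto
  have D: "D \<in> carrier_mat (2*p) n" unfolding D_def using JP by (rule mult_carrier_mat) simp
  have BP: "B * P \<in> carrier_mat n (2*p)" using B by (intro mult_carrier_mat[of _ _ n]) auto
  have DBP: "D * (B * P) \<in> carrier_mat (2*p) (2*p)" using D BP by (rule mult_carrier_mat)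
  define c where "c = \<i> * (cnj z - 1)"
  have "wA p N s a0 (- cnj (\<i> * (z + 1) / (z - 1)) / 2) = 1\<^sub>m (2*p) - \<i> \<cdot>\<^sub>m (D * (c \<cdot>\<^sub>m B) * P)"
    unfolding wA_def n_def[symmetric] minv_A_mat[OF z refl] D_def B_def c_def ..
  also have "D * (c \<cdot>\<^sub>m B) * P = D * ((c \<cdot>\<^sub>m B) * P)"
    using D B by (intro assoc_mult_mat[of _ "2*p" n _ n _ "2*p"]) auto
  also have "(c \<cdot>\<^sub>m B) * P = c \<cdot>\<^sub>m (B * P)"
    using B by (intro mult_smult_assoc_mat[of _ n n]) auto
  also have "D * (c \<cdot>\<^sub>m (B * P)) = c \<cdot>\<^sub>m (D * (B * P))"
    using D BP by (intro mult_smult_distrib[of _ "2*p" n]) auto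
  finally have w: "wA p N s a0 (- cnj (\<i> * (z + 1) / (z - 1)) / 2) = 1\<^sub>m (2*p) - \<i> \<cdot>\<^sub>m (c \<cdot>\<^sub>m (D * (B * P)))" .
  have Da: "mat_adjoint D = minv S * (P * J)"
  proof -
    have "mat_adjoint D = minv S * mat_adjoint (J * mat_adjoint P)"
      unfolding D_def using JP by (subst mat_adjoint_mult[of _ "2*p" n _ n]) (auto simp: S_inv_adjoint)
    also have "mat_adjoint (J * mat_adjoint P) = P * J"
      by (subst mat_adjoint_mult[of _ "2*p" "2*p" _ n]) (auto simp: J_adjoint)
    finally show ?thesis .
  qed
  have BPa: "mat_adjoint (B * P) = mat_adjoint C * H z"
  proof -
    have "B * P = mat_adjoint (H z) * ((1\<^sub>m n - shift) * P)"
      unfolding B_def by (intro assoc_mult_mat[of _ n n _ n _ "2*p"]) auto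
    also have "(1\<^sub>m n - shift) * P = C"
      unfolding P_minus_shift[symmetric] by (subst minus_mult_distrib_mat[of _ n n _ _ "2*p"]) auto
    finally show ?thesis by (simp add: mat_adjoint_mult[of "mat_adjoint (H z)" n n C "2*p"])
  qed
  have "mat_adjoint (D * (B * P)) = mat_adjoint (B * P) * mat_adjoint D"
    using D BP by (intro mat_adjoint_mult) auto
  also have "\<dots> = mat_adjoint C * E z"
    unfolding Da BPa E_def
    by (intro assoc_mult_mat[of _ "2*p" n _ n _ "2*p"] mult_carrier_mat[of _ n n] mult_carrier_mat[of _ n "2*p"]) auto
  finally have DBPa: "mat_adjoint (D * (B * P)) = mat_adjoint C * E z" .
  have CE: "mat_adjoint C * E z \<in> carrier_mat (2*p) (2*p)" by (intro mult_carrier_mat[of _ _ n]) auto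
  have "mat_adjoint (1\<^sub>m (2*p) - \<i> \<cdot>\<^sub>m (c \<cdot>\<^sub>m (D * (B * P)))) = 1\<^sub>m (2*p) - (- \<i>) \<cdot>\<^sub>m (cnj c \<cdot>\<^sub>m (mat_adjoint C * E z))"
    using DBP by (subst mat_adjoint_minus[of _ "2*p" "2*p"]) (auto simp: mat_adjoint_smult DBPa)
  also have "\<dots> = Theta z"
  proof (rule eq_matI)
    fix i j assume "i < dim_row (Theta z)" "j < dim_col (Theta z)"
    then have ij: "i < 2 * p" "j < 2 * p" using carrier_matD[OF Theta_carrier] by auto
    have "\<i> * cnj c = z - 1" by (simp add: c_def ring_distribs)
    then have "\<i> * (cnj c * x) = (z - 1) * x" for x by (metis mult.assoc)
    then have "(1\<^sub>m (2*p) - (- \<i>) \<cdot>\<^sub>m (cnj c \<cdot>\<^sub>m M)) $$ (i, j)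
        = (1\<^sub>m (2*p) + (z - 1) \<cdot>\<^sub>m M) $$ (i, j)" if "M \<in> carrier_mat (2*p) (2*p)" for M
      using that ij by simp
    then show "(1\<^sub>m (2*p) - (- \<i>) \<cdot>\<^sub>m (cnj c \<cdot>\<^sub>m (mat_adjoint C * E z))) $$ (i, j) = Theta z $$ (i, j)"
      unfolding Theta_def using CE by blast
  qed (use CE in auto)
  finally show ?thesis unfolding w .
qed

end

section \<open>The linear fractional transformation\<close>

definition stack :: "nat \<Rightarrow> complex mat \<Rightarrow> complex mat \<Rightarrow> complex mat" where
  "stack p R Q = mat (2 * p) p (\<lambda>(a, b). if a < p then R $$ (a, b) else Q $$ (a - p, b))"

definition top_half :: "nat \<Rightarrow> complex mat \<Rightarrow> complex mat" where
  "top_half p M = mat p p (\<lambda>(a, b). M $$ (a, b))"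

definition bot_half :: "nat \<Rightarrow> complex mat \<Rightarrow> complex mat" where
  "bot_half p M = mat p p (\<lambda>(a, b). M $$ (a + p, b))"

lemma half_carriers [simp, intro]:
  "stack p R Q \<in> carrier_mat (2 * p) p" "top_half p M \<in> carrier_mat p p" "bot_half p M \<in> carrier_mat p p"
  by (auto simp: stack_def top_half_def bot_half_def)

lemma half_dims [simp]:
  "dim_row (stack p R Q) = 2 * p" "dim_col (stack p R Q) = p"
  "dim_row (top_half p M) = p" "dim_col (top_half p M) = p"
  "dim_row (bot_half p M) = p" "dim_col (bot_half p M) = p"
  by (auto simp: stack_def top_half_def bot_half_def)

lemma half_entries:
  "a < 2 * p \<Longrightarrow> b < p \<Longrightarrow> stack p R Q $$ (a, b) = (if a < p then R $$ (a, b) else Q $$ (a - p, b))"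
  "a < p \<Longrightarrow> b < p \<Longrightarrow> top_half p M $$ (a, b) = M $$ (a, b)"
  "a < p \<Longrightarrow> b < p \<Longrightarrow> bot_half p M $$ (a, b) = M $$ (a + p, b)"
  by (auto simp: stack_def top_half_def bot_half_def)

lemma stack_halves: "M \<in> carrier_mat (2 * p) p \<Longrightarrow> stack p (top_half p M) (bot_half p M) = M"
  by (rule eq_matI) (auto simp: stack_def top_half_def bot_half_def)

lemma stack_vec:
  assumes "R \<in> carrier_mat p p" "Q \<in> carrier_mat p p" "v \<in> carrier_vec p" "a < 2 * p"
  shows "(stack p R Q *\<^sub>v v) $ a = (if a < p then (R *\<^sub>v v) $ a else (Q *\<^sub>v v) $ (a - p))"
proof -
  have "(stack p R Q *\<^sub>v v) $ a = (\<Sum>k<p. stack p R Q $$ (a, k) * v $ k)"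
    using assms by (intro index_mult_vec_sum[of _ "2*p"]) auto
  also have "\<dots> = (if a < p then (R *\<^sub>v v) $ a else (Q *\<^sub>v v) $ (a - p))"
    using assms by (auto simp: index_mult_vec_sum[of _ p p] half_entries simp del: index_mult_mat_vec)
  finally show ?thesis .
qed

text \<open>Numerator and denominator of \<open>phi\<close> are the two halves of one product of W
  with the column of R and Q, so the transformation can be studied through columns.\<close>

lemma blk_mult_stack:
  assumes "W \<in> carrier_mat (2 * p) (2 * p)" "R \<in> carrier_mat p p" "Q \<in> carrier_mat p p"
  shows "blk p W 1 1 * R + blk p W 1 2 * Q = top_half p (W * stack p R Q)"
    "blk p W 2 1 * R + blk p W 2 2 * Q = bot_half p (W * stack p R Q)"
proof -
  have c: "blk p W i j \<in> carrier_mat p p" for i j by (simp add: blk_def)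
  have "(blk p W 1 1 * R + blk p W 1 2 * Q) $$ (a, b) = top_half p (W * stack p R Q) $$ (a, b)"
    "(blk p W 2 1 * R + blk p W 2 2 * Q) $$ (a, b) = bot_half p (W * stack p R Q) $$ (a, b)"
    if ab: "a < p" "b < p" for a b
  proof -
    have e: "blk p W i j $$ (a, b) = W $$ (a + (i - 1) * p, b + (j - 1) * p)" if "a < p" "b < p" for a b i j
      using that by (simp add: blk_def)
    note d = c[THEN carrier_matD(1)] c[THEN carrier_matD(2)]
    show "(blk p W 1 1 * R + blk p W 1 2 * Q) $$ (a, b) = top_half p (W * stack p R Q) $$ (a, b)"
      "(blk p W 2 1 * R + blk p W 2 2 * Q) $$ (a, b) = bot_half p (W * stack p R Q) $$ (a, b)"
      using assms ab d by (simp_all add: index_mult_sum[OF c assms(2)] index_mult_sum[OF c assms(3)] half_entries e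
        index_mult_sum[OF assms(1) half_carriers(1)] sum_split_double del: index_mult_mat(1))
  qed
  then show "blk p W 1 1 * R + blk p W 1 2 * Q = top_half p (W * stack p R Q)"
    "blk p W 2 1 * R + blk p W 2 2 * Q = bot_half p (W * stack p R Q)"
    using assms c[THEN carrier_matD(1)] c[THEN carrier_matD(2)] by (auto intro!: eq_matI simp del: index_mult_mat(1) index_add_mat(1))
qed

lemma top_half_smult: "M \<in> carrier_mat (2 * p) p \<Longrightarrow> top_half p (c \<cdot>\<^sub>m M) = c \<cdot>\<^sub>m top_half p M"
  "M \<in> carrier_mat (2 * p) p \<Longrightarrow> bot_half p (c \<cdot>\<^sub>m M) = c \<cdot>\<^sub>m bot_half p M"
  by (auto intro!: eq_matI simp: top_half_def bot_half_def)

lemma minv_smult: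
  assumes "X \<in> carrier_mat m m" "det X \<noteq> 0" "c \<noteq> 0"
  shows "minv (c \<cdot>\<^sub>m X) = inverse c \<cdot>\<^sub>m minv X"
proof (rule minv_eqI(1)[of _ m])
  note m = minv_works[OF assms(1,2)]
  have "c \<cdot>\<^sub>m X * (inverse c \<cdot>\<^sub>m minv X) = inverse c \<cdot>\<^sub>m (c \<cdot>\<^sub>m (X * minv X))"
    using assms m by (simp add: mult_smult_assoc_mat[of _ m m _ m] mult_smult_distrib[of _ m m _ m])
  then show "c \<cdot>\<^sub>m X * (inverse c \<cdot>\<^sub>m minv X) = 1\<^sub>m m"
    using assms m by (auto intro!: eq_matI)
qed (use assms minv_works[OF assms(1,2)] in auto)

context toeplitz_data
begin

abbreviation "K \<equiv> Kmat p"

lemma K_carrier [simp, intro]: "K \<in> carrier_mat (2 * p) (2 * p)"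
  unfolding Kmat_def mult_2 by (intro smult_carrier_mat four_block_carrier_mat) auto

lemma K_dims [simp]: "dim_row K = 2 * p" "dim_col K = 2 * p"
  using carrier_matD[OF K_carrier] by auto

lemma K_entry:
  assumes "a < 2 * p" "b < 2 * p"
  shows "K $$ (a, b) = of_real (1 / sqrt 2) * (if a < p then (if b = a then 1 else if b = a + p then -1 else 0)
     else (if b = a then 1 else if b = a - p then 1 else 0))"
  using assms by (auto simp: Kmat_def)

lemma K_vec:
  assumes "u \<in> carrier_vec (2 * p)" "a < p"
  shows "(K *\<^sub>v u) $ a = of_real (1 / sqrt 2) * (u $ a - u $ (a + p))"
    "(K *\<^sub>v u) $ (a + p) = of_real (1 / sqrt 2) * (u $ a + u $ (a + p))"
proof -
  have "(K *\<^sub>v u) $ a = (\<Sum>b<p. K $$ (a, b) * u $ b) + (\<Sum>b<p. K $$ (a, b + p) * u $ (b + p))"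
    using assms by (subst index_mult_vec_sum[of _ "2*p" "2*p"]) (auto simp: sum_split_double)
  also have "\<dots> = (\<Sum>b<p. if b = a then of_real (1 / sqrt 2) * u $ b else 0)
      + (\<Sum>b<p. if b = a then - of_real (1 / sqrt 2) * u $ (b + p) else 0)"
    using assms by (intro arg_cong2[of _ _ _ _ "(+)"] sum.cong) (auto simp: K_entry)
  finally show "(K *\<^sub>v u) $ a = of_real (1 / sqrt 2) * (u $ a - u $ (a + p))"
    using assms by (simp add: diff_divide_distrib)
  have "(K *\<^sub>v u) $ (a + p) = (\<Sum>b<p. K $$ (a + p, b) * u $ b) + (\<Sum>b<p. K $$ (a + p, b + p) * u $ (b + p))"
    using assms by (subst index_mult_vec_sum[of _ "2*p" "2*p"]) (auto simp: sum_split_double)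
  also have "\<dots> = (\<Sum>b<p. if b = a then of_real (1 / sqrt 2) * u $ b else 0)
      + (\<Sum>b<p. if b = a then of_real (1 / sqrt 2) * u $ (b + p) else 0)"
    using assms by (intro arg_cong2[of _ _ _ _ "(+)"] sum.cong) (auto simp: K_entry)
  finally show "(K *\<^sub>v u) $ (a + p) = of_real (1 / sqrt 2) * (u $ a + u $ (a + p))"
    using assms by (simp add: add_divide_distrib)
qed

lemma K_adjoint_K: "mat_adjoint K * K = 1\<^sub>m (2 * p)" "K * mat_adjoint K = 1\<^sub>m (2 * p)"
proof -
  have sq: "complex_of_real (1 / sqrt 2) * of_real (1 / sqrt 2) = 1 / 2"
    by (simp flip: of_real_mult)
  have "(K * mat_adjoint K) $$ (a, b) = (1\<^sub>m (2 * p) :: complex mat) $$ (a, b)" if ab: "a < 2 * p" "b < 2 * p" for a b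
  proof -
    define f :: "nat \<Rightarrow> nat \<Rightarrow> complex" where "f a b = (if a < p then (if b = a then 1 else if b = a + p then -1 else 0)
     else (if b = a then 1 else if b = a - p then 1 else 0))" for a b
    have K: "K $$ (a, b) = of_real (1 / sqrt 2) * f a b" if "a < 2 * p" "b < 2 * p" for a b
      using K_entry[OF that] by (simp add: f_def)
    have "(K * mat_adjoint K) $$ (a, b) = (\<Sum>k<2*p. K $$ (a, k) * cnj (K $$ (b, k)))"
      using ab by (subst index_mult_sum[of _ "2*p" "2*p" _ "2*p"]) auto
    also have "\<dots> = (\<Sum>k<2*p. 1 / 2 * (f a k * f b k))"
      using ab sq by (intro sum.cong) (auto simp: K f_def field_simps)
    also have "\<dots> = 1 / 2 * ((\<Sum>k<p. f a k * f b k) + (\<Sum>k<p. f a (k + p) * f b (k + p)))"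
      by (simp only: sum_distrib_left[symmetric] sum_split_double)
    \<comment> \<open>Row a of K has one nonzero entry in each half, in columns congruent to a
      modulo p. For congruent rows the two half sums add up if a = b and cancel otherwise.\<close>
    also have "(\<Sum>k<p. f a k * f b k) = (\<Sum>k<p. if k = a mod p then (if a mod p = b mod p then 1 else 0) else 0)"
      using ab by (intro sum.cong) (auto simp: f_def mod_if)
    also have "\<dots> = (if a mod p = b mod p then 1 else 0)" using p_pos by simp
    also have "(\<Sum>k<p. f a (k + p) * f b (k + p)) = (\<Sum>k<p. if k = a mod p then (if a mod p = b mod p then (if (a < p) = (b < p) then 1 else -1) else 0) else 0)"
      using ab by (intro sum.cong) (auto simp: f_def mod_if)
    also have "\<dots> = (if a mod p = b mod p then (if (a < p) = (b < p) then 1 else -1) else 0)" using p_pos by simp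
    finally show ?thesis using ab by (auto simp: mod_if split: if_splits)
  qed
  then show 1: "K * mat_adjoint K = 1\<^sub>m (2 * p)" by (intro eq_matI) auto
  show "mat_adjoint K * K = 1\<^sub>m (2 * p)" by (rule mat_mult_left_right_inverse[OF _ _ 1]) auto
qed

lemma cip_J:
  assumes "y \<in> carrier_vec (2 * p)"
  shows "cip y (J *\<^sub>v y) = of_real (2 * Re (\<Sum>i<p. cnj (y $ i) * y $ (i + p)))"
proof -
  have "cip y (J *\<^sub>v y) = (\<Sum>i<2*p. cnj (y $ i) * (J *\<^sub>v y) $ i)"
    using assms by (simp add: cip_def)
  also have "\<dots> = (\<Sum>i<2*p. cnj (y $ i) * y $ (if i < p then i + p else i - p))"
    using assms by (intro sum.cong) (auto simp: J_vec simp del: index_mult_mat_vec)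
  also have "\<dots> = (\<Sum>i<p. cnj (y $ i) * y $ (i + p)) + (\<Sum>i<p. cnj (y $ (i + p)) * y $ i)"
    by (simp add: sum_split_double)
  also have "(\<Sum>i<p. cnj (y $ (i + p)) * y $ i) = cnj (\<Sum>i<p. cnj (y $ i) * y $ (i + p))"
    by (simp add: mult.commute)
  finally show ?thesis by (simp only: complex_add_cnj)
qed

text \<open>K rotates J into the diagonal signature: adj(K) J K = diag(I, -I). This is the link
  between the inequality for R and Q and J-nonpositivity.\<close>

lemma cip_J_K:
  assumes "u \<in> carrier_vec (2 * p)"
  shows "cip (K *\<^sub>v u) (J *\<^sub>v (K *\<^sub>v u)) = of_real ((\<Sum>i<p. (cmod (u $ i))\<^sup>2) - (\<Sum>i<p. (cmod (u $ (i + p)))\<^sup>2))"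
proof -
  have "2 * Re (cnj ((K *\<^sub>v u) $ i) * (K *\<^sub>v u) $ (i + p)) = (cmod (u $ i))\<^sup>2 - (cmod (u $ (i + p)))\<^sup>2" if "i < p" for i
    unfolding K_vec[OF assms that] by (simp add: cmod_power2) (simp add: field_simps power2_eq_square)
  then have "2 * Re (\<Sum>i<p. cnj ((K *\<^sub>v u) $ i) * (K *\<^sub>v u) $ (i + p))
      = (\<Sum>i<p. (cmod (u $ i))\<^sup>2) - (\<Sum>i<p. (cmod (u $ (i + p)))\<^sup>2)"
    by (simp only: Re_sum sum_distrib_left sum_subtractf[symmetric]) (rule sum.cong; simp)
  then show ?thesis
    by (simp only: cip_J[OF mult_mat_vec_carrier[OF K_carrier assms]])
qed

text \<open>The scalar power in \<open>Wfun\<close> multiplies numerator and denominator alike. It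
  is nonzero because 1 and -1 lie outside the disc, and the two factors i produce the sign.\<close>

lemma phi_eq:
  assumes z: "cmod z < 1" and lam: "lam = \<i> * (z + 1) / (z - 1)"
    and R: "R lam \<in> carrier_mat p p" and Q: "Q lam \<in> carrier_mat p p"
    and G: "G = Theta z * (K * stack p (R lam) (Q lam))"
    and det: "det (top_half p G) \<noteq> 0"
  shows "\<i> \<cdot>\<^sub>m phi p N s a0 R Q lam = - (bot_half p G * minv (top_half p G))"
proof -
  define c where "c = ((lam - \<i>) / lam) ^ (N + 1)"
  have z1: "z \<noteq> 1" "z \<noteq> -1" using z by auto
  have lam0: "lam \<noteq> 0" using z1 unfolding lam by (auto simp: add_eq_0_iff2)
  have "lam - \<i> = 2 * \<i> / (z - 1)" unfolding lam using z1 by (simp add: field_simps)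
  then have c: "c \<noteq> 0" unfolding c_def using lam0 z1 by simp
  have KU: "K * stack p (R lam) (Q lam) \<in> carrier_mat (2*p) p" by (intro mult_carrier_mat[of _ _ "2*p"]) auto
  have Gc: "G \<in> carrier_mat (2 * p) p" unfolding G using KU by (intro mult_carrier_mat[of _ _ "2*p"]) auto
  define W where "W = Wfun p N s a0 lam"
  have W: "W = c \<cdot>\<^sub>m (Theta z * K)"
    unfolding W_def Wfun_def c_def lam wA_adjoint[OF z] ..
  have Wc: "W \<in> carrier_mat (2*p) (2*p)" unfolding W by (intro smult_carrier_mat mult_carrier_mat[of _ _ "2*p"]) auto
  have "W * stack p (R lam) (Q lam) = c \<cdot>\<^sub>m (Theta z * K * stack p (R lam) (Q lam))"
    unfolding W by (intro mult_smult_assoc_mat[of _ "2*p" "2*p"] mult_carrier_mat[of _ _ "2*p"]) auto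
  also have "Theta z * K * stack p (R lam) (Q lam) = G"
    unfolding G by (intro assoc_mult_mat[of _ "2*p" "2*p" _ "2*p" _ p]) auto
  finally have WG: "W * stack p (R lam) (Q lam) = c \<cdot>\<^sub>m G" .
  define X Y where "X = top_half p G" and "Y = bot_half p G"
  have Xc: "X \<in> carrier_mat p p" "Y \<in> carrier_mat p p" by (auto simp: X_def Y_def)
  note mX = minv_works[OF Xc(1) det[folded X_def]]
  have "phi p N s a0 R Q lam = \<i> \<cdot>\<^sub>m ((c \<cdot>\<^sub>m Y) * minv (c \<cdot>\<^sub>m X))"
    unfolding phi_def Let_def W_def[symmetric] blk_mult_stack[OF Wc R Q] WG top_half_smult[OF Gc] X_def Y_def ..
  also have "minv (c \<cdot>\<^sub>m X) = inverse c \<cdot>\<^sub>m minv X"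
    using Xc det c by (intro minv_smult[of _ p]) (auto simp: X_def)
  also have "(c \<cdot>\<^sub>m Y) * (inverse c \<cdot>\<^sub>m minv X) = inverse c \<cdot>\<^sub>m (c \<cdot>\<^sub>m (Y * minv X))"
    using Xc mX by (simp add: mult_smult_assoc_mat[of _ p p _ p] mult_smult_distrib[of _ p p _ p])
  finally show ?thesis
    unfolding X_def[symmetric] Y_def[symmetric] using Xc mX c by (auto intro!: eq_matI simp del: index_mult_mat(1))
qed

end

section \<open>Positivity and interpolation for the transformed column\<close>

lemma half_vec:
  assumes "G \<in> carrier_mat (2 * p) p" "v \<in> carrier_vec p" "i < p"
  shows "(G *\<^sub>v v) $ i = (top_half p G *\<^sub>v v) $ i"
    "(G *\<^sub>v v) $ (i + p) = (bot_half p G *\<^sub>v v) $ i"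
  using stack_vec[OF half_carriers(2,3), of v p i G G] stack_vec[OF half_carriers(2,3), of v p "i + p" G G] assms
  by (simp_all add: stack_halves)

context toeplitz_data
begin

lemma S_form:
  assumes "f \<in> carrier_vec n"
  shows "Re (cip f (S *\<^sub>v f)) \<ge> 0" "Re (cip f (S *\<^sub>v f)) = 0 \<Longrightarrow> f = 0\<^sub>v n"
    "cip f (S *\<^sub>v f) = of_real (Re (cip f (S *\<^sub>v f)))"
proof -
  have *: "f \<noteq> 0\<^sub>v n \<Longrightarrow> cip f (S *\<^sub>v f) \<in> \<real> \<and> Re (cip f (S *\<^sub>v f)) > 0"
    using toeplitz_pd[unfolded pd_iff[OF carriers(1)]] assms by blast
  have 0: "cip (0\<^sub>v n) (S *\<^sub>v 0\<^sub>v n) = 0" by (simp add: cip_def)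
  show "Re (cip f (S *\<^sub>v f)) \<ge> 0" using * 0 by (cases "f = 0\<^sub>v n") auto
  show "Re (cip f (S *\<^sub>v f)) = 0 \<Longrightarrow> f = 0\<^sub>v n" using * by force
  show "cip f (S *\<^sub>v f) = of_real (Re (cip f (S *\<^sub>v f)))" using * 0 by (cases "f = 0\<^sub>v n") (auto elim: Reals_cases)
qed

lemma C_vec_entry:
  assumes "y \<in> carrier_vec (2 * p)" "a < n"
  shows "(C *\<^sub>v y) $ a = (if a < p then y $ a else 0)
      + (\<Sum>k<p. alph s a0 (a div p) $$ (a mod p, k) * y $ (k + p))"
proof -
  have "(C *\<^sub>v y) $ a = (\<Sum>k<2*p. C $$ (a, k) * y $ k)"
    using assms by (intro index_mult_vec_sum[of _ n]) auto
  also have "\<dots> = (\<Sum>k<p. C $$ (a, k) * y $ k) + (\<Sum>k<p. C $$ (a, k + p) * y $ (k + p))"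
    by (rule sum_split_double)
  also have "(\<Sum>k<p. C $$ (a, k) * y $ k) = (\<Sum>k<p. if k = a then y $ k else 0)"
    using assms by (intro sum.cong) (auto simp: entries)
  also have "(\<Sum>k<p. C $$ (a, k + p) * y $ (k + p))
      = (\<Sum>k<p. alph s a0 (a div p) $$ (a mod p, k) * y $ (k + p))"
    using assms by (intro sum.cong) (auto simp: entries)
  finally show ?thesis by simp
qed

lemma n_ge: "p \<le> n"
  by (simp add: n_def)

text \<open>A kernel vector makes \<Theta> y vanish in its top half, hence J-neutral. As y is
  J-nonpositive and S positive definite, the J-form identity forces f = 0, then e = 0. Now \<Theta>
  fixes y, so y too has zero top half, and the first block of C J y = 0 removes its bottom
  half.\<close>

lemma det_top_half_nonzero:
  assumes z: "cmod z < 1" and U: "U \<in> carrier_mat (2 * p) p"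
    and inj: "\<And>v. v \<in> carrier_vec p \<Longrightarrow> U *\<^sub>v v = 0\<^sub>v (2 * p) \<Longrightarrow> v = 0\<^sub>v p"
    and neg: "\<And>v. v \<in> carrier_vec p \<Longrightarrow> Re (cip (U *\<^sub>v v) (J *\<^sub>v (U *\<^sub>v v))) \<le> 0"
  shows "det (top_half p (Theta z * U)) \<noteq> 0"
proof (rule det_nonzero_if_ker_trivial)
  fix v assume v: "v \<in> carrier_vec p" and X0: "top_half p (Theta z * U) *\<^sub>v v = 0\<^sub>v p"
  define y where "y = U *\<^sub>v v"
  have y: "y \<in> carrier_vec (2 * p)" unfolding y_def using U v by auto
  have Gc: "Theta z * U \<in> carrier_mat (2*p) p" using U by (intro mult_carrier_mat[of _ _ "2*p"]) auto
  have Gv: "(Theta z * U) *\<^sub>v v = Theta z *\<^sub>v y"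
    unfolding y_def using U v by (intro assoc_mult_mat_vec[of _ "2*p" "2*p" _ p]) auto
  have top0: "(Theta z *\<^sub>v y) $ i = 0" if "i < p" for i
    using half_vec(1)[OF Gc v that] X0 that unfolding Gv by simp
  define e where "e = E z *\<^sub>v y"
  have e: "e \<in> carrier_vec n" using y by (simp add: e_def)
  define f where "f = e - mat_adjoint shift *\<^sub>v e"
  have f: "f \<in> carrier_vec n" using e by (simp add: f_def)
  have "cip (Theta z *\<^sub>v y) (J *\<^sub>v (Theta z *\<^sub>v y)) = 0"
    using y top0 by (subst cip_J) auto
  then have "Re (cip y (J *\<^sub>v y)) = (1 - (cmod z)\<^sup>2) * Re (cip f (S *\<^sub>v f))"
    using Theta_J_form[OF y e_def f_def] S_form(3)[OF f] by (simp del: of_real_diff)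
  moreover have "1 - (cmod z)\<^sup>2 > 0" using z by (simp add: power_less_one_iff)
  ultimately have "\<not> Re (cip f (S *\<^sub>v f)) > 0"
    using neg[OF v, folded y_def] mult_pos_pos[of "1 - (cmod z)\<^sup>2" "Re (cip f (S *\<^sub>v f))"] by linarith
  then have "Re (cip f (S *\<^sub>v f)) = 0" using S_form(1)[OF f] by linarith
  then have "f = 0\<^sub>v n" by (rule S_form(2)[OF f])
  then have "e - 1 \<cdot>\<^sub>v (mat_adjoint shift *\<^sub>v e) = 0\<^sub>v n" unfolding f_def by simp
  then have e0: "e = 0\<^sub>v n" by (rule shift_fixed_trivial[OF e])
  have Ty: "Theta z *\<^sub>v y = y"
    unfolding Theta_vec[OF y] e_def[symmetric] e0 using y by (intro eq_vecI) auto
  have CJy: "C *\<^sub>v (J *\<^sub>v y) = 0\<^sub>v n"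
  proof -
    have "0\<^sub>v n - z \<cdot>\<^sub>v (mat_adjoint shift *\<^sub>v 0\<^sub>v n) = 0\<^sub>v n" by (intro eq_vecI) auto
    moreover have "S *\<^sub>v 0\<^sub>v n = 0\<^sub>v n" "shift *\<^sub>v 0\<^sub>v n = 0\<^sub>v n" by (auto intro!: eq_vecI)
    ultimately show ?thesis using E_equation[OF y e_def refl] unfolding e0 by simp
  qed
  have y_top: "y $ i = 0" if "i < p" for i using top0[OF that] Ty by simp
  have y_bot: "y $ (i + p) = 0" if i: "i < p" for i
  proof -
    have "(C *\<^sub>v (J *\<^sub>v y)) $ i = (J *\<^sub>v y) $ i + (\<Sum>k<p. alph s a0 (i div p) $$ (i mod p, k) * (J *\<^sub>v y) $ (k + p))"
      using C_vec_entry[of "J *\<^sub>v y" i] y i n_ge by simp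
    also have "\<dots> = y $ (i + p)"
      using y i y_top by (simp add: J_vec del: index_mult_mat_vec)
    finally show ?thesis using CJy i n_ge by simp
  qed
  have "y $ a = 0" if "a < 2 * p" for a
    using that y_top[of a] y_bot[of "a - p"] by (cases "a < p") auto
  then have "y = 0\<^sub>v (2 * p)" using y by (intro eq_vecI) auto
  then show "v = 0\<^sub>v p" using inj[OF v] by (simp add: y_def)
qed auto

text \<open>Dividing G by its top half normalises it to the column of I and -g. So every graph
  vector (v, -g v) is \<Theta> applied to a vector from the range of U.\<close>

lemma graph_vec:
  assumes U: "U \<in> carrier_mat (2 * p) p" and G: "G = Theta z * U"
    and det: "det (top_half p G) \<noteq> 0" and g: "g = - (bot_half p G * minv (top_half p G))"
    and v: "v \<in> carrier_vec p" and y: "y = U *\<^sub>v (minv (top_half p G) *\<^sub>v v)" and i: "i < p"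
  shows "(Theta z *\<^sub>v y) $ i = v $ i" "(Theta z *\<^sub>v y) $ (i + p) = - (g *\<^sub>v v) $ i"
proof -
  have Gc: "G \<in> carrier_mat (2*p) p" unfolding G using U by (intro mult_carrier_mat[of _ _ "2*p"]) auto
  define X Y where "X = top_half p G" and "Y = bot_half p G"
  have Xc: "X \<in> carrier_mat p p" "Y \<in> carrier_mat p p" by (auto simp: X_def Y_def)
  note mX = minv_works[OF Xc(1) det[folded X_def]]
  define w where "w = minv X *\<^sub>v v"
  have w: "w \<in> carrier_vec p" using mX v by (simp add: w_def)
  have Gw: "Theta z *\<^sub>v y = G *\<^sub>v w"
    using y assoc_mult_mat_vec[OF Theta_carrier[of z] U w] unfolding G[symmetric] w_def X_def by simp
  have "X *\<^sub>v w = v" unfolding w_def using mX Xc v by (intro mult_cancel_vec[of _ p]) auto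
  then show "(Theta z *\<^sub>v y) $ i = v $ i"
    using half_vec(1)[OF Gc w i] unfolding Gw X_def[symmetric] by simp
  have "g *\<^sub>v v = - (Y *\<^sub>v w)"
    unfolding g X_def[symmetric] Y_def[symmetric] w_def using mX Xc v
    by (subst uminus_mult_mat_vec) auto
  then show "(Theta z *\<^sub>v y) $ (i + p) = - (g *\<^sub>v v) $ i"
    using half_vec(2)[OF Gc w i] Xc w i unfolding Gw Y_def[symmetric] by simp
qed

text \<open>The J-form of the graph vector (v, -g v) is -2 Re \<open>cip v (g *\<^sub>v v)\<close>.
  Inside the disc \<Theta> can only lower the J-form, so nonpositivity passes from U to the
  graph.\<close>

lemma Re_graph_nonneg:
  assumes z: "cmod z < 1" and U: "U \<in> carrier_mat (2 * p) p" and G: "G = Theta z * U"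
    and det: "det (top_half p G) \<noteq> 0" and g: "g = - (bot_half p G * minv (top_half p G))"
    and neg: "\<And>v. v \<in> carrier_vec p \<Longrightarrow> Re (cip (U *\<^sub>v v) (J *\<^sub>v (U *\<^sub>v v))) \<le> 0"
    and v: "v \<in> carrier_vec p"
  shows "Re (cip v (g *\<^sub>v v)) \<ge> 0"
proof -
  define w where "w = minv (top_half p G) *\<^sub>v v"
  have w: "w \<in> carrier_vec p" using minv_works(1)[OF half_carriers(2) det] v by (simp add: w_def)
  define y where "y = U *\<^sub>v w"
  have y: "y \<in> carrier_vec (2 * p)" unfolding y_def using U w by auto
  have z': "1 - (cmod z)\<^sup>2 \<ge> 0" using z by (simp add: power_le_one)
  define f where "f = E z *\<^sub>v y - mat_adjoint shift *\<^sub>v (E z *\<^sub>v y)"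
  have f: "f \<in> carrier_vec n" using y by (simp add: f_def)
  have gc: "g \<in> carrier_mat p p" unfolding g using minv_works(1)[OF half_carriers(2) det] by auto
  note gr = graph_vec[OF U G det g v y_def[unfolded w_def]]
  have Ty: "Theta z *\<^sub>v y \<in> carrier_vec (2*p)" using y by simp
  have "cip (Theta z *\<^sub>v y) (J *\<^sub>v (Theta z *\<^sub>v y)) = of_real (2 * Re (- cip v (g *\<^sub>v v)))"
    using v gc carrier_vecD[OF mult_mat_vec_carrier[OF gc v]] unfolding cip_J[OF Ty]
    by (simp add: cip_def gr sum_negf del: index_mult_mat_vec Re_sum)
  then have "2 * Re (- cip v (g *\<^sub>v v)) = Re (cip y (J *\<^sub>v y) - of_real (1 - (cmod z)\<^sup>2) * cip f (S *\<^sub>v f))"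
    using Theta_J_form[OF y refl f_def] by (metis Re_complex_of_real)
  also have "\<dots> = Re (cip y (J *\<^sub>v y)) - (1 - (cmod z)\<^sup>2) * Re (cip f (S *\<^sub>v f))"
    by simp
  also have "\<dots> \<le> 0"
    using neg[OF w, folded y_def] mult_nonneg_nonneg[OF z' S_form(1)[OF f]] by linarith
  finally show ?thesis by simp
qed

text \<open>With h = S f, the blocks of \<open>Theta_intertwine\<close> read \<alpha>_0 - g = z h_0
  and \<alpha>_k = z h_k - h_{k-1}. Eliminating h_0, h_1, ... successively is the induction on k;
  the case k = N is the one applied later.\<close>

lemma graph_interpolation:
  assumes U: "U \<in> carrier_mat (2 * p) p" and G: "G = Theta z * U"
    and det: "det (top_half p G) \<noteq> 0" and g: "g = - (bot_half p G * minv (top_half p G))"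
    and M: "M = S * ((1\<^sub>m n - mat_adjoint shift) * (E z * (U * minv (top_half p G))))"
    and i: "i < p" and b: "b < p" and k: "k \<le> N"
  shows "g $$ (i, b) = (\<Sum>l\<le>k. alph s a0 l $$ (i, b) * z ^ l) - z ^ Suc k * M $$ (i + k * p, b)"
proof -
  define v :: "complex vec" where "v = unit_vec p b"
  have v: "v \<in> carrier_vec p" by (simp add: v_def)
  note mXc = minv_works(1)[OF half_carriers(2) det]
  define w where "w = minv (top_half p G) *\<^sub>v v"
  have w: "w \<in> carrier_vec p" using mXc v by (simp add: w_def)
  define y where "y = U *\<^sub>v w"
  have y: "y \<in> carrier_vec (2 * p)" unfolding y_def using U w by auto
  define e where "e = E z *\<^sub>v y"
  have e: "e \<in> carrier_vec n" using y by (simp add: e_def)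
  define f where "f = e - mat_adjoint shift *\<^sub>v e"
  have f: "f \<in> carrier_vec n" using e by (simp add: f_def)
  define h where "h = S *\<^sub>v f"
  have h: "h \<in> carrier_vec n" using f by (simp add: h_def)
  have gc: "g \<in> carrier_mat p p" unfolding g using mXc by auto
  note gr = graph_vec[OF U G det g v y_def[unfolded w_def]]
  have c: "U * minv (top_half p G) \<in> carrier_mat (2*p) p" using U mXc by auto
  have c2: "E z * (U * minv (top_half p G)) \<in> carrier_mat n p" using mult_carrier_mat[OF E_carrier c] .
  have c4: "1\<^sub>m n - mat_adjoint shift \<in> carrier_mat n n" by auto
  have c3: "(1\<^sub>m n - mat_adjoint shift) * (E z * (U * minv (top_half p G))) \<in> carrier_mat n p"
    by (rule mult_carrier_mat[OF _ c2]) auto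
  have Mc: "M \<in> carrier_mat n p" unfolding M by (rule mult_carrier_mat[OF _ c3]) auto
  have "M *\<^sub>v v = S *\<^sub>v ((1\<^sub>m n - mat_adjoint shift) *\<^sub>v (E z *\<^sub>v (U *\<^sub>v (minv (top_half p G) *\<^sub>v v))))"
    unfolding M assoc_mult_mat_vec[OF carriers(1) c3 v] assoc_mult_mat_vec[OF c4 c2 v]
      assoc_mult_mat_vec[OF E_carrier c v] assoc_mult_mat_vec[OF U mXc v] ..
  also have "\<dots> = h"
    unfolding h_def f_def e_def y_def[symmetric] w_def[symmetric] using y
    by (subst minus_mult_distrib_mat_vec[of _ n n]) auto
  finally have Mh: "M $$ (a, b) = h $ a" if "a < n" for a
    using that Mc b by (auto simp: v_def scalar_prod_right_unit)
  have step: "(if a < p then - g $$ (a, b) else 0) + alph s a0 (a div p) $$ (a mod p, b)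
      = z * h $ a - (if p \<le> a then h $ (a - p) else 0)" if a: "a < n" for a
  proof -
    have Ty: "Theta z *\<^sub>v y \<in> carrier_vec (2*p)" using y by simp
    have gv: "(g *\<^sub>v v) $ i = g $$ (i, b)" if "i < p" for i
      using gc that b by (auto simp: v_def scalar_prod_right_unit)
    have "(C *\<^sub>v (J *\<^sub>v (Theta z *\<^sub>v y))) $ a = (z \<cdot>\<^sub>v h - shift *\<^sub>v h) $ a"
      unfolding h_def using Theta_intertwine[OF y e_def f_def] by simp
    also have "\<dots> = z * h $ a - (if p \<le> a then h $ (a - p) else 0)"
      using h a shift_vec[OF h a] by (auto simp del: index_mult_mat_vec)
    finally have 1: "(C *\<^sub>v (J *\<^sub>v (Theta z *\<^sub>v y))) $ a = z * h $ a - (if p \<le> a then h $ (a - p) else 0)" .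
    have "(C *\<^sub>v (J *\<^sub>v (Theta z *\<^sub>v y))) $ a = (if a < p then - g $$ (a, b) else 0)
       + (\<Sum>k<p. alph s a0 (a div p) $$ (a mod p, k) * v $ k)"
      using Ty a by (subst C_vec_entry) (auto simp: J_vec[OF Ty] gr gv simp del: index_mult_mat_vec)
    also have "(\<Sum>k<p. alph s a0 (a div p) $$ (a mod p, k) * v $ k)
        = (\<Sum>k<p. if k = b then alph s a0 (a div p) $$ (a mod p, k) else 0)"
      using b by (intro sum.cong) (auto simp: v_def)
    finally show ?thesis using 1 b by simp
  qed
  show ?thesis
    using k
  proof (induction k)
    case 0
    show ?case using step[of i] i n_ge Mh[of i] by (simp add: algebra_simps)
  next
    case (Suc k)
    have lt: "i + Suc k * p < n"
    proof -
      have "Suc k * p \<le> N * p" using Suc.prems by (rule mult_le_mono1)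
      then show ?thesis using i by (simp add: n_def)
    qed
    have "(i + Suc k * p) div p = Suc k" "(i + Suc k * p) mod p = i" using i p_pos by (simp_all del: mult_Suc)
    then have "alph s a0 (Suc k) $$ (i, b) = z * h $ (i + Suc k * p) - h $ (i + k * p)"
      using step[OF lt] by (simp add: add.commute add.left_commute)
    then have M_step: "M $$ (i + k * p, b) = z * M $$ (i + Suc k * p, b) - alph s a0 (Suc k) $$ (i, b)"
      using lt Mh[OF lt] Mh[of "i + k * p"] by simp
    have IH: "g $$ (i, b) = (\<Sum>l\<le>k. alph s a0 l $$ (i, b) * z ^ l) - z ^ Suc k * M $$ (i + k * p, b)"
      using Suc by simp
    show ?case unfolding IH M_step by (simp add: algebra_simps)
  qed
qed

end

section \<open>Caratheodory functions and Toeplitz forms\<close>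

lemma block_index_less:
  fixes k i L p :: nat
  assumes "k < L" "i < p"
  shows "k * p + i < L * p"
proof -
  have "k * p + i < Suc k * p" using assms by simp
  also have "\<dots> \<le> L * p" using assms by (intro mult_le_mono1) simp
  finally show ?thesis .
qed

lemma sum_blocks:
  fixes f :: "nat \<Rightarrow> 'a :: comm_monoid_add"
  shows "(\<Sum>a<m*p. f a) = (\<Sum>k<m. \<Sum>i<p. f (k * p + i))"
proof -
  have "(\<Sum>a<m*p. f a) = (\<Sum>k<m. sum f {k*p..<k*p+p})"
    by (rule sum.nat_group[symmetric])
  also have "\<dots> = (\<Sum>k<m. \<Sum>i<p. f (k * p + i))"
  proof (rule sum.cong[OF refl])
    fix k
    show "sum f {k*p..<k*p+p} = (\<Sum>i<p. f (k * p + i))"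
      using sum.shift_bounds_nat_ivl[of f 0 "k*p" p] by (simp add: lessThan_atLeast0 add.commute)
  qed
  finally show ?thesis .
qed

text \<open>On the circle du/u = 2 \<pi> i dt, so the integral of h(u)/u is a mean value of h. This
  carries Cauchy's theorem over to real integrals, where positivity can be used.\<close>

lemma has_integral_circle:
  assumes "((\<lambda>u. h u / u) has_contour_integral I) (circlepath 0 r)" "r > 0"
  shows "((\<lambda>t. h (of_real r * exp (2 * of_real pi * \<i> * of_real t))) has_integral I / (2 * of_real pi * \<i>)) {0..1}"
proof -
  define e where "e t = exp (2 * of_real pi * \<i> * of_real t)" for t :: real
  have "((\<lambda>t. h (circlepath 0 r t) / circlepath 0 r t * vector_derivative (circlepath 0 r) (at t within {0..1})) has_integral I) {0..1}"
    using assms(1) by (simp add: has_contour_integral_def)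
  then have "((\<lambda>t. h (of_real r * e t) * (2 * of_real pi * \<i>)) has_integral I) {0..1}"
  proof (rule has_integral_eq[rotated])
    fix t :: real assume "t \<in> {0..1}"
    then have "vector_derivative (circlepath 0 r) (at t within {0..1}) = 2 * of_real pi * \<i> * of_real r * e t"
      by (simp add: vector_derivative_circlepath01 e_def)
    moreover have "circlepath 0 r t = of_real r * e t" by (simp add: circlepath e_def)
    ultimately show "h (circlepath 0 r t) / circlepath 0 r t * vector_derivative (circlepath 0 r) (at t within {0..1})
        = h (of_real r * e t) * (2 * of_real pi * \<i>)"
      using assms(2) by (simp add: e_def)
  qed
  then have "((\<lambda>t. h (of_real r * e t) * (2 * of_real pi * \<i>) * (1 / (2 * of_real pi * \<i>))) has_integral I * (1 / (2 * of_real pi * \<i>))) {0..1}"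
    by (rule has_integral_mult_left)
  then show ?thesis by (simp add: e_def)
qed

text \<open>The conjugate of e(t) is its inverse, so the weight is e(t)^(l-k): Cauchy's formula for
  derivatives handles l \<le> k and Cauchy's theorem the rest. The weight stays a product because
  that is how it arises from a quadratic form in blocks k and l.\<close>

lemma fourier_coefficient:
  assumes f: "f holomorphic_on ball 0 1" and r: "0 < r" "r < 1"
  shows "((\<lambda>t. f (of_real r * exp (2 * of_real pi * \<i> * of_real t)) *
      (cnj (exp (2 * of_real pi * \<i> * of_real t)) ^ k * exp (2 * of_real pi * \<i> * of_real t) ^ l))
     has_integral (if l \<le> k then (deriv ^^ (k - l)) f 0 / fact (k - l) * of_real r ^ (k - l) else 0)) {0..1}"
proof -
  define e where "e t = exp (2 * of_real pi * \<i> * of_real t)" for t :: real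
  have cnj_e: "cnj (e t) * e t = 1" for t
    by (simp add: e_def exp_cnj flip: exp_add)
  have e0: "e t \<noteq> 0" for t by (simp add: e_def)
  have r0: "complex_of_real r \<noteq> 0" using r by simp
  show ?thesis
  proof (cases "l \<le> k")
    case True
    define m where "m = k - l"
    have k: "k = m + l" using True by (simp add: m_def)
    have "((\<lambda>u. f u / (u - 0) ^ Suc m) has_contour_integral (2 * pi * \<i>) / fact m * (deriv ^^ m) f 0) (circlepath 0 r)"
    proof (rule Cauchy_has_contour_integral_higher_derivative_circlepath)
      have sub: "cball 0 r \<subseteq> ball (0 :: complex) 1" using r by auto
      then show "continuous_on (cball 0 r) f" using f holomorphic_on_imp_continuous_on holomorphic_on_subset by blast
      show "f holomorphic_on ball 0 r" using f sub holomorphic_on_subset ball_subset_cball by blast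
    qed (use r in auto)
    then have "((\<lambda>u. (f u / u ^ m) / u) has_contour_integral (2 * pi * \<i>) / fact m * (deriv ^^ m) f 0) (circlepath 0 r)"
      by (simp add: field_simps)
    from has_integral_circle[OF this r(1)]
    have "((\<lambda>t. f (of_real r * e t) / (of_real r * e t) ^ m) has_integral (deriv ^^ m) f 0 / fact m) {0..1}"
      by (simp add: e_def)
    from has_integral_mult_left[OF this, of "of_real r ^ m"]
    have "((\<lambda>t. f (of_real r * e t) / (of_real r * e t) ^ m * of_real r ^ m) has_integral (deriv ^^ m) f 0 / fact m * of_real r ^ m) {0..1}" .
    moreover have "f (of_real r * e t) / (of_real r * e t) ^ m * of_real r ^ m = f (of_real r * e t) * (cnj (e t) ^ k * e t ^ l)" for t
    proof -
      have "cnj (e t) ^ k * e t ^ l * e t ^ m = (cnj (e t) * e t) ^ k"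
        unfolding k by (simp add: power_add power_mult_distrib)
      also have "\<dots> = 1" by (simp add: cnj_e)
      finally have "cnj (e t) ^ k * e t ^ l = 1 / e t ^ m" using e0 by (simp add: eq_divide_eq)
      then show ?thesis using r0 by (simp add: power_mult_distrib field_simps)
    qed
    ultimately show ?thesis using True by (simp add: e_def m_def)
  next
    case False
    \<comment> \<open>The extra 1 pays for the division by u in the mean value: u^(l-k)/u is still a
      polynomial.\<close>
    define m where "m = l - k - 1"
    have l: "l = k + Suc m" using False by (simp add: m_def)
    have "((\<lambda>u. f u * u ^ m) has_contour_integral 0) (circlepath 0 r)"
      by (rule Cauchy_theorem_disc_simple[of _ 0 1])
        (use r f in \<open>auto intro!: holomorphic_intros simp: path_image_circlepath\<close>)
    then have "((\<lambda>u. (f u * u ^ Suc m) / u) has_contour_integral 0) (circlepath 0 r)"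
      by (rule has_contour_integral_eq) (use r in \<open>auto simp: path_image_circlepath\<close>)
    from has_integral_mult_left[OF has_integral_circle[OF this r(1)], of "1 / of_real r ^ Suc m"]
    have "((\<lambda>t. f (of_real r * e t) * (of_real r * e t) ^ Suc m * (1 / of_real r ^ Suc m)) has_integral 0) {0..1}"
      by (simp add: e_def)
    moreover have "f (of_real r * e t) * (of_real r * e t) ^ Suc m * (1 / of_real r ^ Suc m) = f (of_real r * e t) * (cnj (e t) ^ k * e t ^ l)" for t
    proof -
      have "cnj (e t) ^ k * e t ^ l = (cnj (e t) * e t) ^ k * e t ^ Suc m"
        unfolding l by (simp add: power_add power_mult_distrib)
      also have "\<dots> = e t ^ Suc m" by (simp add: cnj_e)
      finally show ?thesis using r0 by (simp add: power_mult_distrib del: power_Suc)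
    qed
    ultimately show ?thesis using False by (simp add: e_def)
  qed
qed

lemma block_toeplitz_carrier: "block_toeplitz p M \<sigma> \<in> carrier_mat ((M + 1) * p) ((M + 1) * p)"
  by (simp add: block_toeplitz_def)

text \<open>The form of g is averaged over |z| = r at the vector V(t) with blocks of x as Fourier
  coefficients. Orthogonality leaves the lower block triangle, weighted by powers of r; the real
  part supplies the adjoint upper triangle. Letting r tend to 1 is a limit of polynomials in r, so
  boundary values of g never appear.\<close>

lemma caratheodory_toeplitz_psd:
  assumes p: "p > 0" and gc: "\<And>z. g z \<in> carrier_mat p p"
    and hol: "\<And>i j. i < p \<Longrightarrow> j < p \<Longrightarrow> (\<lambda>z. g z $$ (i, j)) holomorphic_on ball 0 1"
    and pos: "\<And>z v. cmod z < 1 \<Longrightarrow> v \<in> carrier_vec p \<Longrightarrow> Re (cip v (g z *\<^sub>v v)) \<ge> 0"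
    and \<sigma>: "\<And>k i j. i < p \<Longrightarrow> j < p \<Longrightarrow> \<sigma> k $$ (i, j)
       = (if k \<le> 0 then taylor_coeff p g (nat (- k)) $$ (i, j) else 0)
       + (if k \<ge> 0 then cnj (taylor_coeff p g (nat k) $$ (j, i)) else 0)"
  shows "psd (block_toeplitz p M \<sigma>)"
proof -
  define L where "L = M + 1"
  define m where "m = L * p"
  have Tc: "block_toeplitz p M \<sigma> \<in> carrier_mat m m" unfolding m_def L_def by (rule block_toeplitz_carrier)
  \<comment> \<open>The lower block triangle including the diagonal. The diagonal is counted again
    in the conjugate, in accordance with the two summands of \<sigma> at index 0.\<close>
  define d where "d x a b = (if b div p \<le> a div p then cnj (x $ a) * x $ b *
      ((deriv ^^ (a div p - b div p)) (\<lambda>z. g z $$ (a mod p, b mod p)) 0 / fact (a div p - b div p)) else 0)" for x a b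
  define w where "w x r = (\<Sum>a<m. \<Sum>b<m. d x a b * of_real r ^ (a div p - b div p))" for x and r :: real
  have "cip x (block_toeplitz p M \<sigma> *\<^sub>v x) \<in> \<real> \<and> Re (cip x (block_toeplitz p M \<sigma> *\<^sub>v x)) \<ge> 0"
    if x: "x \<in> carrier_vec m" for x
  proof -
    have "Re (w x r) \<ge> 0" if r: "0 < r" "r < 1" for r
    proof -
      define e where "e t = exp (2 * of_real pi * \<i> * of_real t)" for t :: real
      define \<Phi> where "\<Phi> t = (\<Sum>a<m. \<Sum>b<m. cnj (x $ a) * x $ b *
          (g (of_real r * e t) $$ (a mod p, b mod p) * (cnj (e t) ^ (a div p) * e t ^ (b div p))))" for t
      have "(\<Phi> has_integral w x r) {0..1}"
        unfolding \<Phi>_def w_def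
      proof (intro has_integral_sum finite_lessThan)
        fix a b
        have "((\<lambda>t. cnj (x $ a) * x $ b * (g (of_real r * e t) $$ (a mod p, b mod p) * (cnj (e t) ^ (a div p) * e t ^ (b div p))))
          has_integral cnj (x $ a) * x $ b * (if b div p \<le> a div p then (deriv ^^ (a div p - b div p)) (\<lambda>z. g z $$ (a mod p, b mod p)) 0 / fact (a div p - b div p) * of_real r ^ (a div p - b div p) else 0)) {0..1}"
          unfolding e_def using p r by (intro has_integral_mult_right fourier_coefficient hol) auto
        then show "((\<lambda>t. cnj (x $ a) * x $ b * (g (of_real r * e t) $$ (a mod p, b mod p) * (cnj (e t) ^ (a div p) * e t ^ (b div p))))
          has_integral d x a b * of_real r ^ (a div p - b div p)) {0..1}"
          by (cases "b div p \<le> a div p") (simp_all add: d_def mult.assoc)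
      qed
      then have "((\<lambda>t. Re (\<Phi> t)) has_integral Re (w x r)) {0..1}"
        using has_integral_linear[OF _ bounded_linear_Re] by (force simp: o_def)
      moreover have "Re (\<Phi> t) \<ge> 0" for t
      proof -
        define V where "V = vec p (\<lambda>i. \<Sum>k<L. x $ (k * p + i) * e t ^ k)"
        have V: "V \<in> carrier_vec p" by (simp add: V_def)
        define z where "z = of_real r * e t"
        have "cmod z < 1" using r by (simp add: z_def e_def norm_mult)
        then have "Re (cip V (g z *\<^sub>v V)) \<ge> 0" using pos V by blast
        moreover have "cip V (g z *\<^sub>v V) = \<Phi> t"
        proof -
          have "cip V (g z *\<^sub>v V) = (\<Sum>i<p. cnj (V $ i) * (\<Sum>j<p. g z $$ (i, j) * V $ j))"
            using gc[of z] V by (simp add: cip_def index_mult_vec_sum[OF gc V] del: index_mult_mat_vec)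
          also have "\<dots> = (\<Sum>i<p. (\<Sum>k<L. cnj (x $ (k * p + i)) * cnj (e t) ^ k) *
              (\<Sum>j<p. \<Sum>l<L. g z $$ (i, j) * (x $ (l * p + j) * e t ^ l)))"
            by (intro sum.cong) (auto simp: V_def sum_distrib_left)
          also have "\<dots> = (\<Sum>i<p. \<Sum>k<L. \<Sum>l<L. \<Sum>j<p. cnj (x $ (k * p + i)) * x $ (l * p + j) * (g z $$ (i, j) * (cnj (e t) ^ k * e t ^ l)))"
          proof (rule sum.cong[OF refl])
            fix i
            have "(\<Sum>k<L. cnj (x $ (k * p + i)) * cnj (e t) ^ k) * (\<Sum>j<p. \<Sum>l<L. g z $$ (i, j) * (x $ (l * p + j) * e t ^ l))
               = (\<Sum>k<L. cnj (x $ (k * p + i)) * cnj (e t) ^ k) * (\<Sum>l<L. \<Sum>j<p. g z $$ (i, j) * (x $ (l * p + j) * e t ^ l))"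
              by (subst (2) sum.swap) (rule refl)
            also have "\<dots> = (\<Sum>k<L. \<Sum>l<L. \<Sum>j<p. cnj (x $ (k * p + i)) * x $ (l * p + j) * (g z $$ (i, j) * (cnj (e t) ^ k * e t ^ l)))"
              unfolding sum_distrib_right by (intro sum.cong refl) (simp add: sum_distrib_left mult_ac)
            finally show "(\<Sum>k<L. cnj (x $ (k * p + i)) * cnj (e t) ^ k) * (\<Sum>j<p. \<Sum>l<L. g z $$ (i, j) * (x $ (l * p + j) * e t ^ l)) = \<dots>" .
          qed
          also have "\<dots> = (\<Sum>k<L. \<Sum>i<p. \<Sum>l<L. \<Sum>j<p. cnj (x $ (k * p + i)) * x $ (l * p + j) * (g z $$ (i, j) * (cnj (e t) ^ k * e t ^ l)))"
            by (rule sum.swap)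
          also have "\<dots> = \<Phi> t"
            unfolding \<Phi>_def m_def sum_blocks z_def using p by (intro sum.cong) auto
          finally show ?thesis .
        qed
        ultimately show ?thesis by simp
      qed
      ultimately show ?thesis by (rule has_integral_nonneg)
    qed
    then have ev: "eventually (\<lambda>r. Re (w x r) \<ge> 0) (at_left 1)"
      by (intro eventually_at_leftI[of 0]) auto
    have "((\<lambda>r. Re (w x r)) \<longlongrightarrow> Re (w x 1)) (at_left 1)"
      unfolding w_def by (intro tendsto_intros)
    then have w1: "Re (w x 1) \<ge> 0" using ev tendsto_lowerbound trivial_limit_at_left_real by blast
    have "cip x (block_toeplitz p M \<sigma> *\<^sub>v x) = (\<Sum>a<m. \<Sum>b<m. cnj (x $ a) * (block_toeplitz p M \<sigma> $$ (a, b) * x $ b))"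
      using Tc x by (simp add: cip_def index_mult_vec_sum[OF Tc x] sum_distrib_left del: index_mult_mat_vec)
    also have "\<dots> = (\<Sum>a<m. \<Sum>b<m. d x a b + cnj (d x b a))"
    proof (intro sum.cong refl)
      fix a b assume "a \<in> {..<m}" "b \<in> {..<m}"
      then have "block_toeplitz p M \<sigma> $$ (a, b) = \<sigma> (int (b div p) - int (a div p)) $$ (a mod p, b mod p)"
        by (simp add: block_toeplitz_def m_def L_def)
      then show "cnj (x $ a) * (block_toeplitz p M \<sigma> $$ (a, b) * x $ b) = d x a b + cnj (d x b a)"
        using p by (auto simp: \<sigma> d_def taylor_coeff_def nat_diff_distrib' algebra_simps)
    qed
    also have "\<dots> = w x 1 + (\<Sum>a<m. \<Sum>b<m. cnj (d x b a))"
      by (simp add: w_def sum.distrib)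
    also have "(\<Sum>a<m. \<Sum>b<m. cnj (d x b a)) = cnj (w x 1)"
      unfolding w_def by (subst sum.swap) simp
    finally show ?thesis using w1 by (simp add: complex_add_cnj)
  qed
  then show ?thesis unfolding psd_iff[OF Tc] by blast
qed

section \<open>Holomorphic matrix functions\<close>

text \<open>Dimensions are required on D only, since \<open>minv\<close> of a singular matrix has
  unspecified dimensions.\<close>

definition hol_mat :: "complex set \<Rightarrow> nat \<Rightarrow> nat \<Rightarrow> (complex \<Rightarrow> complex mat) \<Rightarrow> bool" where
  "hol_mat D m l A \<longleftrightarrow> (\<forall>z\<in>D. A z \<in> carrier_mat m l) \<and>
     (\<forall>i<m. \<forall>j<l. (\<lambda>z. A z $$ (i, j)) holomorphic_on D)"

lemma hol_matI:
  assumes "\<And>z. z \<in> D \<Longrightarrow> A z \<in> carrier_mat m l"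
    and "\<And>i j. i < m \<Longrightarrow> j < l \<Longrightarrow> (\<lambda>z. A z $$ (i, j)) holomorphic_on D"
  shows "hol_mat D m l A"
  using assms by (simp add: hol_mat_def)

lemma hol_matD:
  assumes "hol_mat D m l A"
  shows "z \<in> D \<Longrightarrow> A z \<in> carrier_mat m l"
    "i < m \<Longrightarrow> j < l \<Longrightarrow> (\<lambda>z. A z $$ (i, j)) holomorphic_on D"
  using assms by (simp_all add: hol_mat_def)

lemma hol_mat_const: "A \<in> carrier_mat m l \<Longrightarrow> hol_mat D m l (\<lambda>_. A)"
  by (simp add: hol_mat_def)

lemma hol_mat_mult:
  assumes A: "hol_mat D m k A" and B: "hol_mat D k l B"
  shows "hol_mat D m l (\<lambda>z. A z * B z)"
proof (rule hol_matI)
  fix i j assume ij: "i < m" "j < l"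
  have "(\<lambda>z. \<Sum>q<k. A z $$ (i, q) * B z $$ (q, j)) holomorphic_on D"
    using ij by (intro holomorphic_intros hol_matD[OF A] hol_matD[OF B]) auto
  then show "(\<lambda>z. (A z * B z) $$ (i, j)) holomorphic_on D"
    by (rule holomorphic_transform) (simp add: index_mult_sum[OF hol_matD(1)[OF A] hol_matD(1)[OF B] ij] del: index_mult_mat(1))
qed (rule mult_carrier_mat[OF hol_matD(1)[OF A] hol_matD(1)[OF B]])

lemma hol_mat_add:
  assumes A: "hol_mat D m l A" and B: "hol_mat D m l B"
  shows "hol_mat D m l (\<lambda>z. A z + B z)"
proof (rule hol_matI)
  fix i j assume ij: "i < m" "j < l"
  have "(\<lambda>z. A z $$ (i, j) + B z $$ (i, j)) holomorphic_on D"
    using ij by (intro holomorphic_intros hol_matD[OF A] hol_matD[OF B]) auto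
  then show "(\<lambda>z. (A z + B z) $$ (i, j)) holomorphic_on D"
    by (rule holomorphic_transform) (use ij hol_matD(1)[OF A] hol_matD(1)[OF B] in force)
qed (use hol_matD(1)[OF A] hol_matD(1)[OF B] in auto)

lemma hol_mat_smult:
  assumes A: "hol_mat D m l A" and c: "c holomorphic_on D"
  shows "hol_mat D m l (\<lambda>z. c z \<cdot>\<^sub>m A z)"
proof (rule hol_matI)
  fix i j assume ij: "i < m" "j < l"
  have "(\<lambda>z. c z * A z $$ (i, j)) holomorphic_on D"
    using ij c by (intro holomorphic_intros hol_matD[OF A]) auto
  then show "(\<lambda>z. (c z \<cdot>\<^sub>m A z) $$ (i, j)) holomorphic_on D"
    by (rule holomorphic_transform) (use ij hol_matD(1)[OF A] in force)
qed (use hol_matD(1)[OF A] in auto)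

lemma hol_mat_uminus:
  assumes A: "hol_mat D m l A"
  shows "hol_mat D m l (\<lambda>z. - A z)"
proof (rule hol_matI)
  fix i j assume ij: "i < m" "j < l"
  have "(\<lambda>z. - (A z $$ (i, j))) holomorphic_on D"
    using ij by (intro holomorphic_intros hol_matD[OF A]) auto
  then show "(\<lambda>z. (- A z) $$ (i, j)) holomorphic_on D"
    by (rule holomorphic_transform) (use ij hol_matD(1)[OF A] in force)
qed (use hol_matD(1)[OF A] in auto)

lemma hol_mat_halves:
  assumes A: "hol_mat D (2 * p) p A"
  shows "hol_mat D p p (\<lambda>z. top_half p (A z))" "hol_mat D p p (\<lambda>z. bot_half p (A z))"
  by (rule hol_matI; use hol_matD(2)[OF A] in \<open>simp add: half_entries\<close>)+

lemma hol_mat_stack: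
  assumes A: "hol_mat D p p A" and B: "hol_mat D p p B"
  shows "hol_mat D (2 * p) p (\<lambda>z. stack p (A z) (B z))"
proof (rule hol_matI)
  fix i j assume "i < 2 * p" "j < p"
  then show "(\<lambda>z. stack p (A z) (B z) $$ (i, j)) holomorphic_on D"
    by (cases "i < p") (auto simp: half_entries intro!: hol_matD[OF A] hol_matD[OF B])
qed auto

text \<open>An abstract function algebra covers holomorphic, pointwise analytic and meromorphic entries.\<close>

lemma det_in_function_algebra:
  fixes P :: "('b \<Rightarrow> complex) \<Rightarrow> bool"
  assumes const: "\<And>c. P (\<lambda>_. c)" and add: "\<And>f g. P f \<Longrightarrow> P g \<Longrightarrow> P (\<lambda>z. f z + g z)"
    and mult: "\<And>f g. P f \<Longrightarrow> P g \<Longrightarrow> P (\<lambda>z. f z * g z)"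
    and A: "\<And>z. A z \<in> carrier_mat m m"
    and P: "\<And>i j. i < m \<Longrightarrow> j < m \<Longrightarrow> P (\<lambda>z. A z $$ (i, j))"
  shows "P (\<lambda>z. det (A z))"
    and "\<And>i j. i < m \<Longrightarrow> j < m \<Longrightarrow> P (\<lambda>z. adj_mat (A z) $$ (i, j))"
proof -
  have sum: "P (\<lambda>z. \<Sum>x\<in>I. f x z)" if "finite I" "\<And>x. x \<in> I \<Longrightarrow> P (f x)" for f and I :: "'i set"
    using that by (induction I rule: finite_induct) (auto intro: const add)
  have prod: "P (\<lambda>z. \<Prod>x\<in>I. f x z)" if "finite I" "\<And>x. x \<in> I \<Longrightarrow> P (f x)" for f and I :: "'j set"
    using that by (induction I rule: finite_induct) (auto intro: const mult)
  have det: "P (\<lambda>z. det (B z))" if B: "\<And>z. B z \<in> carrier_mat k k"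
    and PB: "\<And>i j. i < k \<Longrightarrow> j < k \<Longrightarrow> P (\<lambda>z. B z $$ (i, j))" for B k
    unfolding det_def'[OF B]
  proof (rule sum)
    fix \<pi> assume "\<pi> \<in> {\<pi>. \<pi> permutes {0..<k}}"
    then have "\<pi> i < k" if "i < k" for i using that permutes_in_image[of \<pi> "{0..<k}" i] by auto
    then show "P (\<lambda>z. signof \<pi> * (\<Prod>i = 0..<k. B z $$ (i, \<pi> i)))"
      by (intro mult const prod PB) auto
  qed (simp add: finite_permutations)
  show "P (\<lambda>z. det (A z))" by (rule det[OF A P])
  fix i j assume ij: "i < m" "j < m"
  have "adj_mat (A z) $$ (i, j) = (-1) ^ (j + i) * det (mat_delete (A z) j i)" for z
    using ij A[of z] by (auto simp: adj_mat_def cofactor_def)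
  moreover have "P (\<lambda>z. det (mat_delete (A z) j i))"
  proof (rule det[of _ "m - 1"])
    show "mat_delete (A z) j i \<in> carrier_mat (m - 1) (m - 1)" for z
      using mat_delete_carrier[OF A] .
    fix i' j' assume ij': "i' < m - 1" "j' < m - 1"
    have "mat_delete (A z) j i $$ (i', j') = A z $$ (if i' < j then i' else Suc i', if j' < i then j' else Suc j')" for z
      using ij' A[of z] by (auto simp: mat_delete_def)
    then show "P (\<lambda>z. mat_delete (A z) j i $$ (i', j'))"
      using ij' by (auto intro!: P)
  qed
  ultimately show "P (\<lambda>z. adj_mat (A z) $$ (i, j))" by (auto intro!: mult const)
qed

lemma hol_mat_minv:
  assumes A: "hol_mat D m m A" and d: "\<And>z. z \<in> D \<Longrightarrow> det (A z) \<noteq> 0"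
  shows "hol_mat D m m (\<lambda>z. minv (A z))"
proof (rule hol_matI)
  fix i j assume ij: "i < m" "j < m"
  \<comment> \<open>The function algebra lemma wants square matrices at every point; the identity is
    a harmless filler off D.\<close>
  define B where "B z = (if z \<in> D then A z else 1\<^sub>m m)" for z
  have Bc: "B z \<in> carrier_mat m m" for z using hol_matD(1)[OF A] by (auto simp: B_def)
  have hB: "(\<lambda>z. B z $$ (i, j)) holomorphic_on D" if "i < m" "j < m" for i j
    using hol_matD(2)[OF A that] by (rule holomorphic_transform) (simp add: B_def)
  have "(\<lambda>z. det (B z)) holomorphic_on D" "(\<lambda>z. adj_mat (B z) $$ (i, j)) holomorphic_on D"
    by (rule det_in_function_algebra[where P = "\<lambda>f. f holomorphic_on D" and m = m];
        use Bc hB ij in \<open>auto intro!: holomorphic_intros\<close>)+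
  then have "(\<lambda>z. adj_mat (B z) $$ (i, j) / det (B z)) holomorphic_on D"
    by (intro holomorphic_on_divide) (auto simp: B_def d)
  then show "(\<lambda>z. minv (A z) $$ (i, j)) holomorphic_on D"
    by (rule holomorphic_transform) (simp add: B_def minv_cramer[OF hol_matD(1)[OF A] d ij])
qed (use minv_works(1)[OF hol_matD(1)[OF A] d] in auto)

text \<open>The factor z^(N+1) pushes the remainder beyond order N, provided that h is holomorphic
  at 0; formal power series make the comparison of coefficients mechanical.\<close>

lemma taylor_coeff_interpolation:
  assumes h: "h holomorphic_on ball 0 1"
    and f: "\<And>z. cmod z < 1 \<Longrightarrow> f z = (\<Sum>l\<le>N. c l * z ^ l) - z ^ Suc N * h z" and k: "k \<le> N"
  shows "(deriv ^^ k) f 0 / fact k = c k"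
proof -
  have "h analytic_on {0}" using h by (auto simp: analytic_at intro!: exI[of _ "ball 0 1"])
  then have "h has_fps_expansion fps_expansion h 0" by (rule analytic_at_imp_has_fps_expansion_0)
  then have "(\<lambda>z. (\<Sum>l\<le>N. c l * z ^ l) - z ^ Suc N * h z) has_fps_expansion
     (\<Sum>l\<le>N. fps_const (c l) * fps_X ^ l) - fps_X ^ Suc N * fps_expansion h 0"
    by (intro fps_expansion_intros)
  moreover have "eventually (\<lambda>z. f z = (\<Sum>l\<le>N. c l * z ^ l) - z ^ Suc N * h z) (nhds 0)"
    using eventually_nhds_in_open[of "ball 0 1" "0 :: complex"] by (auto elim!: eventually_mono simp: f)
  ultimately have "f has_fps_expansion (\<Sum>l\<le>N. fps_const (c l) * fps_X ^ l) - fps_X ^ Suc N * fps_expansion h 0"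
    by (subst has_fps_expansion_cong[OF _ refl])
  from fps_nth_fps_expansion[OF this, of k]
  have "(deriv ^^ k) f 0 / fact k = (\<Sum>l\<le>N. fps_nth (fps_const (c l) * fps_X ^ l) k)
      - fps_nth (fps_X ^ Suc N * fps_expansion h 0) k"
    by (simp only: fps_sub_nth fps_sum_nth)
  also have "fps_nth (fps_X ^ Suc N * fps_expansion h 0) k = 0"
    using k by (simp only: fps_X_power_mult_nth) simp
  also have "(\<Sum>l\<le>N. fps_nth (fps_const (c l) * fps_X ^ l) k) = (\<Sum>l\<le>N. if l = k then c l else 0)"
    by (intro sum.cong) auto
  finally show ?thesis using k by simp
qed

section \<open>From admissible pairs to extensions\<close>

lemma cip_gram:
  assumes A: "A \<in> carrier_mat m k" and v: "v \<in> carrier_vec k"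
  shows "cip v ((mat_adjoint A * A) *\<^sub>v v) = of_real (\<Sum>i<m. (cmod ((A *\<^sub>v v) $ i))\<^sup>2)"
proof -
  have Av: "A *\<^sub>v v \<in> carrier_vec m" using A v by simp
  have "cip v ((mat_adjoint A * A) *\<^sub>v v) = cip v (mat_adjoint A *\<^sub>v (A *\<^sub>v v))"
    using assoc_mult_mat_vec[OF mat_adjoint_carrier[OF A] A v] by simp
  also have "\<dots> = cip (A *\<^sub>v v) (A *\<^sub>v v)"
    using cip_adjoint[OF mat_adjoint_carrier[OF A] v Av] by simp
  finally show ?thesis by (simp only: cip_self[OF Av])
qed

definition contractive :: "nat \<Rightarrow> complex mat \<Rightarrow> bool" where
  "contractive p A \<longleftrightarrow> (\<forall>v\<in>carrier_vec p. (\<Sum>i<p. (cmod ((A *\<^sub>v v) $ i))\<^sup>2) \<le> (\<Sum>i<p. (cmod (v $ i))\<^sup>2))"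

text \<open>An entry is a coordinate of the image of a unit vector. This crude bound suffices to
  exclude poles.\<close>

lemma contractive_entry:
  assumes A: "A \<in> carrier_mat p p" and c: "contractive p A" and ij: "i < p" "j < p"
  shows "cmod (A $$ (i, j)) \<le> 1"
proof -
  have "(cmod (A $$ (i, j)))\<^sup>2 = (cmod ((A *\<^sub>v unit_vec p j) $ i))\<^sup>2"
    using A ij by (simp add: scalar_prod_right_unit)
  also have "\<dots> \<le> (\<Sum>i<p. (cmod ((A *\<^sub>v unit_vec p j) $ i))\<^sup>2)"
    using ij by (intro member_le_sum) auto
  also have "\<dots> \<le> (\<Sum>i<p. (cmod (unit_vec p j $ i))\<^sup>2)"
    using c by (auto simp: contractive_def)
  also have "\<dots> = (\<Sum>i<p. if i = j then 1 else 0)"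
    using ij by (intro sum.cong) auto
  also have "\<dots> = 1" using ij by simp
  finally show ?thesis by (simp add: abs_square_le_1[of "cmod _", simplified])
qed

lemma open_lower_half: "open lower_half"
  unfolding lower_half_def by (rule open_halfspace_Im_lt)

text \<open>The inequality sends the kernel of Q into that of R, and definiteness excludes a common
  kernel; so Q is invertible. Substituting the inverse of Q applied to v then turns the inequality
  into contractivity.\<close>

lemma pair_quotient:
  assumes R: "R \<in> carrier_mat p p" and Q: "Q \<in> carrier_mat p p"
    and pd: "pd (mat_adjoint R * R + mat_adjoint Q * Q)"
    and psd: "psd (mat_adjoint Q * Q - mat_adjoint R * R)"
  shows "det Q \<noteq> 0" "contractive p (R * minv Q)"
proof -
  have c: "mat_adjoint R * R \<in> carrier_mat p p" "mat_adjoint Q * Q \<in> carrier_mat p p"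
    using mult_carrier_mat[OF mat_adjoint_carrier[OF R] R] mult_carrier_mat[OF mat_adjoint_carrier[OF Q] Q] .
  have le: "(\<Sum>i<p. (cmod ((R *\<^sub>v v) $ i))\<^sup>2) \<le> (\<Sum>i<p. (cmod ((Q *\<^sub>v v) $ i))\<^sup>2)" if v: "v \<in> carrier_vec p" for v
  proof -
    have "cip v ((mat_adjoint Q * Q - mat_adjoint R * R) *\<^sub>v v)
       = cip v ((mat_adjoint Q * Q) *\<^sub>v v) - cip v ((mat_adjoint R * R) *\<^sub>v v)"
      using c v by (simp only: minus_mult_distrib_mat_vec[OF c(2,1) v])
        (rule cip_linear(2)[of _ p]; simp del: assoc_mult_mat_vec)
    also have "Re \<dots> = (\<Sum>i<p. (cmod ((Q *\<^sub>v v) $ i))\<^sup>2) - (\<Sum>i<p. (cmod ((R *\<^sub>v v) $ i))\<^sup>2)"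
      by (simp only: cip_gram[OF R v] cip_gram[OF Q v] minus_complex.simps Re_complex_of_real)
    finally have "Re (cip v ((mat_adjoint Q * Q - mat_adjoint R * R) *\<^sub>v v))
       = (\<Sum>i<p. (cmod ((Q *\<^sub>v v) $ i))\<^sup>2) - (\<Sum>i<p. (cmod ((R *\<^sub>v v) $ i))\<^sup>2)" .
    moreover have "Re (cip v ((mat_adjoint Q * Q - mat_adjoint R * R) *\<^sub>v v)) \<ge> 0"
      using psd[unfolded psd_iff[OF minus_carrier_mat[OF c(1)]]] v by blast
    ultimately show ?thesis by linarith
  qed
  have inj: "v = 0\<^sub>v p" if v: "v \<in> carrier_vec p" and Qv: "Q *\<^sub>v v = 0\<^sub>v p" for v
  proof (rule ccontr)
    assume nz: "v \<noteq> 0\<^sub>v p"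
    have "(\<Sum>i<p. (cmod ((Q *\<^sub>v v) $ i))\<^sup>2) = 0" using Qv by simp
    then have "(\<Sum>i<p. (cmod ((R *\<^sub>v v) $ i))\<^sup>2) = 0"
      using le[OF v] sum_nonneg[of "{..<p}" "\<lambda>i. (cmod ((R *\<^sub>v v) $ i))\<^sup>2"] by (simp del: index_mult_mat_vec)
    moreover have "cip v ((mat_adjoint R * R + mat_adjoint Q * Q) *\<^sub>v v)
       = cip v ((mat_adjoint R * R) *\<^sub>v v) + cip v ((mat_adjoint Q * Q) *\<^sub>v v)"
      using c v by (simp only: add_mult_distrib_mat_vec[OF c(1,2) v])
        (rule cip_linear(1)[of _ p]; simp del: assoc_mult_mat_vec)
    ultimately have "cip v ((mat_adjoint R * R + mat_adjoint Q * Q) *\<^sub>v v) = 0"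
      using \<open>(\<Sum>i<p. (cmod ((Q *\<^sub>v v) $ i))\<^sup>2) = 0\<close> by (simp only: cip_gram[OF R v] cip_gram[OF Q v]) simp
    then show False using pd[unfolded pd_iff[OF add_carrier_mat[OF c(2)]]] v nz by force
  qed
  show d: "det Q \<noteq> 0" by (rule det_nonzero_if_ker_trivial[OF Q inj])
  note mQ = minv_works[OF Q d]
  show "contractive p (R * minv Q)"
    unfolding contractive_def
  proof
    fix v :: "complex vec" assume v: "v \<in> carrier_vec p"
    have w: "minv Q *\<^sub>v v \<in> carrier_vec p" using mQ(1) v by simp
    show "(\<Sum>i<p. (cmod (((R * minv Q) *\<^sub>v v) $ i))\<^sup>2) \<le> (\<Sum>i<p. (cmod (v $ i))\<^sup>2)"
      using le[OF w] mult_cancel_vec[OF Q mQ(1,2) v] assoc_mult_mat_vec[OF R mQ(1) v] by simp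
  qed
qed

text \<open>Contractivity is a closed condition, which extends it to the points where R or Q is
  singular.\<close>

lemma contractive_limit:
  assumes A: "A \<in> carrier_mat p p" and B: "\<And>z. B z \<in> carrier_mat p p" and F: "F \<noteq> bot"
    and lim: "\<And>i j. i < p \<Longrightarrow> j < p \<Longrightarrow> ((\<lambda>z. B z $$ (i, j)) \<longlongrightarrow> A $$ (i, j)) F"
    and ev: "eventually (\<lambda>z. contractive p (B z)) F"
  shows "contractive p A"
  unfolding contractive_def
proof
  fix v :: "complex vec" assume v: "v \<in> carrier_vec p"
  have "((\<lambda>z. \<Sum>i<p. (cmod (\<Sum>j<p. B z $$ (i, j) * v $ j))\<^sup>2) \<longlongrightarrow> (\<Sum>i<p. (cmod (\<Sum>j<p. A $$ (i, j) * v $ j))\<^sup>2)) F"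
    by (intro tendsto_intros lim) auto
  moreover have "eventually (\<lambda>z. (\<Sum>i<p. (cmod (\<Sum>j<p. B z $$ (i, j) * v $ j))\<^sup>2) \<le> (\<Sum>i<p. (cmod (v $ i))\<^sup>2)) F"
    using ev
  proof eventually_elim
    case (elim z)
    then have "(\<Sum>i<p. (cmod ((B z *\<^sub>v v) $ i))\<^sup>2) \<le> (\<Sum>i<p. (cmod (v $ i))\<^sup>2)"
      using v unfolding contractive_def by blast
    then show ?case by (simp add: index_mult_vec_sum[OF B v] del: index_mult_mat_vec)
  qed
  ultimately have "(\<Sum>i<p. (cmod (\<Sum>j<p. A $$ (i, j) * v $ j))\<^sup>2) \<le> (\<Sum>i<p. (cmod (v $ i))\<^sup>2)"
    using F by (rule tendsto_upperbound)
  then show "(\<Sum>i<p. (cmod ((A *\<^sub>v v) $ i))\<^sup>2) \<le> (\<Sum>i<p. (cmod (v $ i))\<^sup>2)"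
    by (simp add: index_mult_vec_sum[OF A v] del: index_mult_mat_vec)
qed

text \<open>The quotient R / Q is bounded where it is defined, so its singularities are removable.\<close>

lemma admissible_pair_schur:
  assumes "admissible_pair p R Q"
  obtains \<theta> where "hol_mat lower_half p p \<theta>" "\<And>w. \<theta> w \<in> carrier_mat p p"
    "\<And>w. w \<in> lower_half \<Longrightarrow> contractive p (\<theta> w)"
    "eventually (\<lambda>w. det (Q w) \<noteq> 0 \<and> R w = \<theta> w * Q w) (nhds (- \<i>))"
proof -
  have Rc: "R z \<in> carrier_mat p p" and Qc: "Q z \<in> carrier_mat p p" for z
    using assms by (auto simp: admissible_pair_def)
  have merR: "(\<lambda>z. R z $$ (a, b)) meromorphic_on lower_half"
    and merQ: "(\<lambda>z. Q z $$ (a, b)) meromorphic_on lower_half"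
    and anR: "(\<lambda>z. R z $$ (a, b)) analytic_on {- \<i>}"
    and anQ: "(\<lambda>z. Q z $$ (a, b)) analytic_on {- \<i>}" if "a < p" "b < p" for a b
    using assms that by (auto simp: admissible_pair_def)
  \<comment> \<open>Away from such points the values of R and Q are unconstrained, so the two
    inequalities are used only here.\<close>
  define regular where "regular z \<longleftrightarrow> (\<forall>a<p. \<forall>b<p. (\<lambda>z. R z $$ (a, b)) analytic_on {z} \<and> (\<lambda>z. Q z $$ (a, b)) analytic_on {z})" for z
  have reg: "det (Q z) \<noteq> 0" "contractive p (R z * minv (Q z))" if "z \<in> lower_half" "regular z" for z
    using pair_quotient[OF Rc Qc, of z z] assms that by (auto simp: admissible_pair_def regular_def)
  \<comment> \<open>Cramer's formula instead of \<open>minv\<close> keeps the quotient visibly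
    meromorphic on the whole half-plane.\<close>
  define \<theta>0 where "\<theta>0 a b z = (\<Sum>k<p. R z $$ (a, k) * adj_mat (Q z) $$ (k, b)) / det (Q z)" for a b z
  have \<theta>0_eq: "\<theta>0 a b z = (R z * minv (Q z)) $$ (a, b)" if "z \<in> lower_half" "regular z" "a < p" "b < p" for a b z
  proof -
    note d = reg(1)[OF that(1,2)]
    have "(R z * minv (Q z)) $$ (a, b) = (\<Sum>k<p. R z $$ (a, k) * (adj_mat (Q z) $$ (k, b) / det (Q z)))"
      unfolding index_mult_sum[OF Rc minv_works(1)[OF Qc d] that(3,4)]
      by (intro sum.cong refl) (simp add: minv_cramer[OF Qc d _ that(4)])
    then show ?thesis by (simp add: \<theta>0_def sum_divide_distrib)
  qed
  have mer: "\<theta>0 a b meromorphic_on lower_half" if ab: "a < p" "b < p" for a b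
  proof -
    have "(\<lambda>z. det (Q z)) meromorphic_on lower_half"
      "\<And>i j. i < p \<Longrightarrow> j < p \<Longrightarrow> (\<lambda>z. adj_mat (Q z) $$ (i, j)) meromorphic_on lower_half"
      by (rule det_in_function_algebra[where P = "\<lambda>f. f meromorphic_on lower_half" and m = p];
          use Qc merQ in \<open>auto intro!: meromorphic_intros\<close>)+
    then show ?thesis unfolding \<theta>0_def using ab by (intro meromorphic_intros merR) auto
  qed
  have an: "\<theta>0 a b analytic_on {z}" if ab: "a < p" "b < p" and z: "z \<in> lower_half" "regular z" for a b z
  proof -
    have "(\<lambda>z. det (Q z)) analytic_on {z}"
      "\<And>i j. i < p \<Longrightarrow> j < p \<Longrightarrow> (\<lambda>z. adj_mat (Q z) $$ (i, j)) analytic_on {z}"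
      by (rule det_in_function_algebra[where P = "\<lambda>f. f analytic_on {z}" and m = p];
          use Qc z in \<open>auto simp: regular_def intro!: analytic_intros\<close>)+
    then show ?thesis unfolding \<theta>0_def using ab z reg(1)[OF z]
      by (intro analytic_intros) (auto simp: regular_def)
  qed
  \<comment> \<open>Singularities of meromorphic functions are isolated, so each point has a
    punctured neighbourhood of regular points, on which the quotient is bounded by 1.\<close>
  have ev: "eventually (\<lambda>w. w \<in> lower_half \<and> regular w) (at z)" if z: "z \<in> lower_half" for z
  proof -
    have 1: "eventually (\<lambda>w. (\<lambda>z. R z $$ (a, b)) analytic_on {w} \<and> (\<lambda>z. Q z $$ (a, b)) analytic_on {w}) (at z)"
      if "a < p" "b < p" for a b
      using meromorphic_on_subset[OF merR[OF that], of "{z}"] meromorphic_on_subset[OF merQ[OF that], of "{z}"] z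
      by (auto intro!: eventually_conj dest!: meromorphic_on_isolated_singularity simp: isolated_singularity_at_altdef)
    have "eventually (\<lambda>w. \<forall>a\<in>{..<p}. \<forall>b\<in>{..<p}. (\<lambda>z. R z $$ (a, b)) analytic_on {w} \<and> (\<lambda>z. Q z $$ (a, b)) analytic_on {w}) (at z)"
      by (intro eventually_ball_finite ballI 1) auto
    moreover have "eventually (\<lambda>w. w \<in> lower_half) (at z)"
      using open_lower_half z by (rule eventually_at_in_open')
    ultimately show ?thesis by eventually_elim (auto simp: regular_def)
  qed
  define \<theta> where "\<theta> z = mat p p (\<lambda>(a, b). remove_sings (\<theta>0 a b) z)" for z
  have \<theta>c: "\<theta> z \<in> carrier_mat p p" for z by (simp add: \<theta>_def)
  have \<theta>_reg: "\<theta> z = R z * minv (Q z)" if z: "z \<in> lower_half" "regular z" for z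
    using an[OF _ _ z] \<theta>0_eq[OF z] carrier_matD[OF Rc[of z]] minv_works(1)[OF Qc reg(1)[OF z]]
    by (intro eq_matI) (auto simp: \<theta>_def simp del: index_mult_mat(1))
  have ana: "(\<lambda>z. \<theta> z $$ (a, b)) analytic_on {z}" if ab: "a < p" "b < p" and z: "z \<in> lower_half" for a b z
  proof -
    have m: "\<theta>0 a b meromorphic_on {z}" using meromorphic_on_subset[OF mer[OF ab]] z by auto
    have bd: "eventually (\<lambda>w. norm (\<theta>0 a b w) \<le> 1) (at z)"
      using ev[OF z]
    proof eventually_elim
      case (elim w)
      have "R w * minv (Q w) \<in> carrier_mat p p" using mult_carrier_mat[OF Rc minv_works(1)[OF Qc reg(1)]] elim by blast
      then show ?case using contractive_entry[OF _ reg(2) ab] elim by (simp add: \<theta>0_eq ab del: index_mult_mat(1))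
    qed
    have "\<not> is_pole (\<theta>0 a b) z"
    proof
      assume "is_pole (\<theta>0 a b) z"
      then have "filterlim (\<lambda>w. norm (\<theta>0 a b w)) at_top (at z)"
        unfolding is_pole_def by (rule filterlim_at_infinity_imp_norm_at_top)
      then have "eventually (\<lambda>w. norm (\<theta>0 a b w) > 1) (at z)" by (simp add: filterlim_at_top_dense)
      with bd have "eventually (\<lambda>w. False) (at z)" by eventually_elim auto
      then show False by simp
    qed
    then obtain c where "\<theta>0 a b \<midarrow>z\<rightarrow> c"
      using meromorphic_on_not_essential[OF m] by (auto simp: not_essential_def)
    then have "remove_sings (\<theta>0 a b) analytic_on {z}"
      using remove_sings_analytic_at meromorphic_on_isolated_singularity[OF m] by blast
    then show ?thesis using ab by (simp add: \<theta>_def)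
  qed
  have hol: "hol_mat lower_half p p \<theta>"
  proof (rule hol_matI)
    fix a b assume "a < p" "b < p"
    then have "(\<lambda>z. \<theta> z $$ (a, b)) analytic_on lower_half"
      using ana analytic_on_analytic_at by blast
    then show "(\<lambda>z. \<theta> z $$ (a, b)) holomorphic_on lower_half" by (rule analytic_imp_holomorphic)
  qed (rule \<theta>c)
  have con: "contractive p (\<theta> z)" if z: "z \<in> lower_half" for z
  proof (rule contractive_limit[OF \<theta>c \<theta>c, of "at z"])
    show "((\<lambda>w. \<theta> w $$ (i, j)) \<longlongrightarrow> \<theta> z $$ (i, j)) (at z)" if "i < p" "j < p" for i j
      using analytic_at_imp_isCont[OF ana[OF that z]] by (simp add: isCont_def)
    show "eventually (\<lambda>w. contractive p (\<theta> w)) (at z)"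
      using ev[OF z] by eventually_elim (simp add: \<theta>_reg reg)
  qed simp
  have i_lower: "- \<i> \<in> lower_half" by (simp add: lower_half_def)
  \<comment> \<open>At -i the pair is analytic by assumption, so the factorisation of R holds at
    that point too and not only around it.\<close>
  have "regular (- \<i>)" using anR anQ by (simp add: regular_def)
  then have "eventually (\<lambda>w. w \<in> lower_half \<and> regular w) (nhds (- \<i>))"
    using ev[OF i_lower] i_lower by (simp add: eventually_nhds_conv_at)
  then have fin: "eventually (\<lambda>w. det (Q w) \<noteq> 0 \<and> R w = \<theta> w * Q w) (nhds (- \<i>))"
  proof eventually_elim
    case (elim w)
    note mQ = minv_works[OF Qc reg(1)[of w]]
    have "R w * minv (Q w) * Q w = R w * (minv (Q w) * Q w)"
      using elim Rc Qc mQ(1) by (intro assoc_mult_mat[of _ p p _ p _ p]) auto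
    then show ?case using elim reg(1) \<theta>_reg mQ(3) right_mult_one_mat[OF Rc[of w]] by simp
  qed
  show thesis using that[OF hol \<theta>c con fin] by blast
qed

text \<open>Splitting into halves commutes with right multiplication, so a common right factor Q
  cancels in the quotient of the halves.\<close>

lemma half_mult:
  assumes "G \<in> carrier_mat (2 * p) p" "Q \<in> carrier_mat p p"
  shows "top_half p (G * Q) = top_half p G * Q" "bot_half p (G * Q) = bot_half p G * Q"
proof -
  have "top_half p (G * Q) $$ (a, b) = (top_half p G * Q) $$ (a, b)"
    "bot_half p (G * Q) $$ (a, b) = (bot_half p G * Q) $$ (a, b)" if "a < p" "b < p" for a b
    using that assms by (auto simp: half_entries index_mult_sum[OF assms] index_mult_sum[OF half_carriers(2) assms(2)]
      index_mult_sum[OF half_carriers(3) assms(2)] simp del: index_mult_mat(1))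
  then show "top_half p (G * Q) = top_half p G * Q" "bot_half p (G * Q) = bot_half p G * Q"
    using assms by (auto intro!: eq_matI simp del: index_mult_mat(1))
qed

lemma stack_mult:
  assumes "A \<in> carrier_mat p p" "Q \<in> carrier_mat p p"
  shows "stack p A (1\<^sub>m p) * Q = stack p (A * Q) Q"
proof (rule eq_matI)
  fix a b assume "a < dim_row (stack p (A * Q) Q)" "b < dim_col (stack p (A * Q) Q)"
  then have ab: "a < 2 * p" "b < p" by auto
  have "(stack p A (1\<^sub>m p) * Q) $$ (a, b) = (\<Sum>k<p. stack p A (1\<^sub>m p) $$ (a, k) * Q $$ (k, b))"
    by (rule index_mult_sum[OF half_carriers(1) assms(2) ab])
  also have "\<dots> = stack p (A * Q) Q $$ (a, b)"
  proof (cases "a < p")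
    case True
    then show ?thesis using ab by (simp add: half_entries index_mult_sum[OF assms] del: index_mult_mat(1))
  next
    case False
    then have "(\<Sum>k<p. stack p A (1\<^sub>m p) $$ (a, k) * Q $$ (k, b)) = (\<Sum>k<p. if k = a - p then Q $$ (k, b) else 0)"
      using ab by (intro sum.cong) (auto simp: half_entries)
    then show ?thesis using ab False by (simp add: half_entries)
  qed
  finally show "(stack p A (1\<^sub>m p) * Q) $$ (a, b) = stack p (A * Q) Q $$ (a, b)" .
qed (use assms in auto)

text \<open>The imaginary part is (|z|^2 - 1) / |z - 1|^2.\<close>

lemma moebius_lower_half:
  assumes "cmod z < 1"
  shows "\<i> * (z + 1) / (z - 1) \<in> lower_half"
proof -
  have z1: "z \<noteq> 1" using assms by auto
  have "(cmod z)\<^sup>2 < 1" using assms by (simp add: power_less_one_iff)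
  then have lt: "(Re z)\<^sup>2 + (Im z)\<^sup>2 - 1 < 0" by (simp add: cmod_power2)
  have pos: "(Re z - 1)\<^sup>2 + (Im z)\<^sup>2 > 0" using z1 by (auto simp: complex_eq_iff sum_power2_gt_zero_iff)
  have "Im (\<i> * (z + 1) / (z - 1)) = Re ((z + 1) / (z - 1))"
    by (simp flip: times_divide_eq_right)
  also have "\<dots> = ((Re z)\<^sup>2 + (Im z)\<^sup>2 - 1) / ((Re z - 1)\<^sup>2 + (Im z)\<^sup>2)"
    by (simp add: Re_divide power2_eq_square algebra_simps)
  also have "\<dots> < 0" using lt pos by (rule divide_neg_pos)
  finally show ?thesis by (simp add: lower_half_def)
qed

section \<open>The function attached to an admissible pair\<close>

context toeplitz_data
begin

lemma hol_E: "hol_mat D n (2 * p) E"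
proof -
  have "hol_mat D n n H"
  proof (rule hol_matI)
    fix i j assume ij: "i < n" "j < n"
    show "(\<lambda>z. H z $$ (i, j)) holomorphic_on D"
      unfolding entries(5)[OF ij] by (cases "i \<le> j \<and> i mod p = j mod p") (auto intro!: holomorphic_intros)
  qed auto
  then show ?thesis unfolding E_def[abs_def]
    by (rule hol_mat_mult, intro hol_mat_const mult_carrier_mat[of _ n n] mult_carrier_mat[of _ n "2*p"]) auto
qed

lemma hol_Theta: "hol_mat D (2 * p) (2 * p) Theta"
  unfolding Theta_def[abs_def]
  by (intro hol_mat_add hol_mat_smult hol_mat_mult[of _ _ n] hol_E hol_mat_const holomorphic_intros) auto

lemma K_stack_form:
  assumes A: "A \<in> carrier_mat p p" "B \<in> carrier_mat p p" and v: "v \<in> carrier_vec p" and U: "U = K * stack p A B"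
  shows "cip (U *\<^sub>v v) (J *\<^sub>v (U *\<^sub>v v)) = of_real ((\<Sum>i<p. (cmod ((A *\<^sub>v v) $ i))\<^sup>2) - (\<Sum>i<p. (cmod ((B *\<^sub>v v) $ i))\<^sup>2))"
    and "U *\<^sub>v v = 0\<^sub>v (2 * p) \<Longrightarrow> A *\<^sub>v v = 0\<^sub>v p \<and> B *\<^sub>v v = 0\<^sub>v p"
proof -
  have sv: "stack p A B *\<^sub>v v \<in> carrier_vec (2 * p)" using v by (intro mult_mat_vec_carrier[OF half_carriers(1)])
  have Uv: "U *\<^sub>v v = K *\<^sub>v (stack p A B *\<^sub>v v)"
    unfolding U by (rule assoc_mult_mat_vec[OF K_carrier half_carriers(1) v])
  show "cip (U *\<^sub>v v) (J *\<^sub>v (U *\<^sub>v v)) = of_real ((\<Sum>i<p. (cmod ((A *\<^sub>v v) $ i))\<^sup>2) - (\<Sum>i<p. (cmod ((B *\<^sub>v v) $ i))\<^sup>2))"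
    unfolding Uv cip_J_K[OF sv] by (simp add: stack_vec[OF A v] del: index_mult_mat_vec)
  assume "U *\<^sub>v v = 0\<^sub>v (2 * p)"
  then have "mat_adjoint K *\<^sub>v (K *\<^sub>v (stack p A B *\<^sub>v v)) = 0\<^sub>v (2 * p)"
    unfolding Uv by (auto intro!: eq_vecI)
  then have 0: "stack p A B *\<^sub>v v = 0\<^sub>v (2 * p)"
    using mult_cancel_vec[OF _ K_carrier K_adjoint_K(1) sv] by simp
  have "(A *\<^sub>v v) $ i = 0" "(B *\<^sub>v v) $ i = 0" if "i < p" for i
    using stack_vec[OF A v, of i] stack_vec[OF A v, of "i + p"] that unfolding 0 by (simp_all del: index_mult_mat_vec)
  then show "A *\<^sub>v v = 0\<^sub>v p \<and> B *\<^sub>v v = 0\<^sub>v p"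
    using A by (auto intro!: eq_vecI simp del: index_mult_mat_vec)
qed

text \<open>All estimates are made for the column of \<theta> and I, holomorphic on the whole disc.
  The given R and Q return only near z = 0, where they differ from it by the invertible right factor
  Q.\<close>

theorem admissible_pair_gives_extension:
  assumes adm: "admissible_pair p R Q"
  shows "\<exists>g. taylor_rep p (phi p N s a0 R Q) g \<and> g 0 = a0 \<and> taylor_coeff p g 0 = a0 \<and>
     (\<forall>k. 0 < k \<and> k \<le> N \<longrightarrow> taylor_coeff p g k = s (- int k)) \<and>
     (\<forall>M > N. psd (block_toeplitz p M (ext_seq N s (taylor_coeff p g))))"
proof -
  have Rc: "R z \<in> carrier_mat p p" and Qc: "Q z \<in> carrier_mat p p" for z
    using adm by (auto simp: admissible_pair_def)
  obtain \<theta> where \<theta>: "hol_mat lower_half p p \<theta>" "\<And>w. \<theta> w \<in> carrier_mat p p"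
    "\<And>w. w \<in> lower_half \<Longrightarrow> contractive p (\<theta> w)"
    and near: "eventually (\<lambda>w. det (Q w) \<noteq> 0 \<and> R w = \<theta> w * Q w) (nhds (- \<i>))"
    using admissible_pair_schur[OF adm] by blast
  define mob where "mob z = \<i> * (z + 1) / (z - 1)" for z :: complex
  define D where "D = ball (0 :: complex) 1"
  have D: "z \<in> D \<longleftrightarrow> cmod z < 1" for z by (simp add: D_def)
  have mobD: "mob z \<in> lower_half" if "z \<in> D" for z
    using that moebius_lower_half by (simp add: D mob_def)
  have mob_hol: "mob holomorphic_on D"
    unfolding mob_def[abs_def] by (intro holomorphic_intros) (auto simp: D)
  define U where "U z = K * stack p (\<theta> (mob z)) (1\<^sub>m p)" for z
  have Uc: "U z \<in> carrier_mat (2 * p) p" for z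
    unfolding U_def by (rule mult_carrier_mat[OF K_carrier half_carriers(1)])
  have holU: "hol_mat D (2 * p) p U"
  proof -
    have "hol_mat D p p (\<lambda>z. \<theta> (mob z))"
    proof (rule hol_matI)
      fix i j assume "i < p" "j < p"
      then show "(\<lambda>z. \<theta> (mob z) $$ (i, j)) holomorphic_on D"
        using holomorphic_on_compose_gen[OF mob_hol hol_matD(2)[OF \<theta>(1)]] mobD by (auto simp: o_def image_subset_iff)
    qed (rule \<theta>(2))
    then show ?thesis unfolding U_def[abs_def]
      by (intro hol_mat_mult[of _ _ "2*p"] hol_mat_const hol_mat_stack) auto
  qed
  have neg: "Re (cip (U z *\<^sub>v v) (J *\<^sub>v (U z *\<^sub>v v))) \<le> 0" if "z \<in> D" "v \<in> carrier_vec p" for z v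
  proof -
    have "(\<Sum>i<p. (cmod ((\<theta> (mob z) *\<^sub>v v) $ i))\<^sup>2) \<le> (\<Sum>i<p. (cmod (v $ i))\<^sup>2)"
      using \<theta>(3)[OF mobD[OF that(1)]] that(2) by (simp add: contractive_def)
    then show ?thesis using K_stack_form(1)[OF \<theta>(2) one_carrier_mat that(2) U_def] that(2) by (simp del: index_mult_mat_vec)
  qed
  have inj: "v = 0\<^sub>v p" if "v \<in> carrier_vec p" "U z *\<^sub>v v = 0\<^sub>v (2 * p)" for z v
    using K_stack_form(2)[OF \<theta>(2) one_carrier_mat that(1) U_def that(2)] that(1) by simp
  define G where "G z = Theta z * U z" for z
  have Gc: "G z \<in> carrier_mat (2 * p) p" for z unfolding G_def by (rule mult_carrier_mat[OF Theta_carrier Uc])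
  have det: "det (top_half p (G z)) \<noteq> 0" if "z \<in> D" for z
    unfolding G_def using that by (intro det_top_half_nonzero Uc inj neg) (auto simp: D)
  \<comment> \<open>The zero matrix off the disc is a filler: \<open>taylor_rep\<close> asks for p x
    p matrices at every point.\<close>
  define g where "g z = (if z \<in> D then - (bot_half p (G z) * minv (top_half p (G z))) else 0\<^sub>m p p)" for z
  have g_eq: "g z = - (bot_half p (G z) * minv (top_half p (G z)))" if "z \<in> D" for z
    using that by (simp add: g_def)
  have gc: "g z \<in> carrier_mat p p" for z
    using mult_carrier_mat[OF half_carriers(3) minv_works(1)[OF half_carriers(2) det]]
    by (auto simp: g_def)
  have holG: "hol_mat D (2 * p) p G" unfolding G_def[abs_def] by (rule hol_mat_mult[OF hol_Theta holU])
  have holXi: "hol_mat D p p (\<lambda>z. minv (top_half p (G z)))"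
    by (intro hol_mat_minv hol_mat_halves holG det)
  have holg: "(\<lambda>z. g z $$ (i, j)) holomorphic_on D" if "i < p" "j < p" for i j
  proof -
    have "hol_mat D p p (\<lambda>z. - (bot_half p (G z) * minv (top_half p (G z))))"
      by (intro hol_mat_uminus hol_mat_mult[of _ _ p] hol_mat_halves holG holXi)
    from hol_matD(2)[OF this that] show ?thesis
      by (rule holomorphic_transform) (simp add: g_eq)
  qed
  \<comment> \<open>The remainder column of \<open>graph_interpolation\<close>. Its holomorphy at z
    = 0 ensures that the error vanishes there to order N + 1.\<close>
  define M where "M z = S * ((1\<^sub>m n - mat_adjoint shift) * (E z * (U z * minv (top_half p (G z)))))" for z
  have holM: "hol_mat D n p M"
    unfolding M_def[abs_def]
    by (intro hol_mat_mult[of _ n n] hol_mat_mult[of _ n "2*p"] hol_mat_mult[of _ "2*p" p] hol_mat_const hol_E holU holXi minus_carrier_mat) auto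
  have interp: "g z $$ (i, b) = (\<Sum>l\<le>N. alph s a0 l $$ (i, b) * z ^ l) - z ^ Suc N * M z $$ (i + N * p, b)"
    if "cmod z < 1" "i < p" "b < p" for z i b
    using that by (intro graph_interpolation[OF Uc G_def det g_eq M_def]) (auto simp: D)
  have coef: "(deriv ^^ k) (\<lambda>z. g z $$ (i, b)) 0 / fact k = alph s a0 k $$ (i, b)" if "k \<le> N" "i < p" "b < p" for k i b
  proof (rule taylor_coeff_interpolation[OF _ _ that(1)])
    have "i + N * p < n" using that by (simp add: n_def)
    then show "(\<lambda>z. M z $$ (i + N * p, b)) holomorphic_on ball 0 1"
      using hol_matD(2)[OF holM] that unfolding D_def by blast
  qed (use interp that in blast)
  have tc: "taylor_coeff p g k \<in> carrier_mat p p" for k by (simp add: taylor_coeff_def)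
  have coef': "taylor_coeff p g k = alph s a0 k" if "k \<le> N" for k
  proof -
    have "alph s a0 k \<in> carrier_mat p p" using that s_carrier[of "- int k"] a0_carrier by (auto simp: alph_def)
    then show ?thesis using coef[OF that] by (intro eq_matI) (auto simp: taylor_coeff_def)
  qed
  have g0: "g 0 = a0"
  proof (rule eq_matI)
    fix i b assume "i < dim_row a0" "b < dim_col a0"
    then have ib: "i < p" "b < p" using a0_carrier by auto
    have "(\<Sum>l\<le>N. alph s a0 l $$ (i, b) * 0 ^ l) = (\<Sum>l\<le>N. if l = 0 then alph s a0 l $$ (i, b) else 0)"
      by (intro sum.cong) auto
    then show "g 0 $$ (i, b) = a0 $$ (i, b)" using interp[of 0 i b] ib by (simp add: alph_def)
  qed (use gc[of 0] a0_carrier in auto)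
  have ana: "(\<lambda>z. g z $$ (a, b)) analytic_on {0}" if "a < p" "b < p" for a b
    using holg[OF that] by (auto simp: analytic_at D_def intro!: exI[of _ "ball 0 1"])
  have rep: "eventually (\<lambda>z. g z = \<i> \<cdot>\<^sub>m phi p N s a0 R Q (\<i> * (z + 1) / (z - 1))) (at 0)"
  proof -
    \<comment> \<open>The point z = 0 corresponds to \<lambda> = -i, so the neighbourhood of -i in
      \<open>near\<close> pulls back to one of 0.\<close>
    have "(mob \<longlongrightarrow> mob 0) (at 0)"
      using holomorphic_on_imp_continuous_on[OF mob_hol] unfolding D_def
      by (simp add: continuous_on_eq_continuous_at isCont_def)
    then have "filterlim mob (nhds (- \<i>)) (at 0)" by (simp add: mob_def)
    from eventually_compose_filterlim[OF near this]
    have "eventually (\<lambda>z. det (Q (mob z)) \<noteq> 0 \<and> R (mob z) = \<theta> (mob z) * Q (mob z)) (at 0)" .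
    moreover have "eventually (\<lambda>z. z \<in> D) (at 0)"
      unfolding D_def by (rule eventually_at_in_open') auto
    ultimately show ?thesis
    proof eventually_elim
      case (elim z)
      define w where "w = mob z"
      define X Y where "X = top_half p (G z)" and "Y = bot_half p (G z)"
      have Xc: "X \<in> carrier_mat p p" "Y \<in> carrier_mat p p" by (auto simp: X_def Y_def)
      have dX: "det X \<noteq> 0" using det elim by (simp add: X_def)
      note mX = minv_works[OF Xc(1) dX]
      have dQ: "det (Q w) \<noteq> 0" using elim by (simp add: w_def)
      note mQ = minv_works[OF Qc dQ]
      define G' where "G' = Theta z * (K * stack p (R w) (Q w))"
      have "stack p (R w) (Q w) = stack p (\<theta> w) (1\<^sub>m p) * Q w"
        using elim stack_mult[OF \<theta>(2) Qc, of w w] by (simp add: w_def)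
      then have "K * stack p (R w) (Q w) = U z * Q w"
        unfolding U_def w_def[symmetric] using assoc_mult_mat[OF K_carrier half_carriers(1) Qc] by simp
      then have G': "G' = G z * Q w"
        unfolding G'_def G_def using assoc_mult_mat[OF Theta_carrier Uc Qc] by simp
      have top: "top_half p G' = X * Q w" and bot: "bot_half p G' = Y * Q w"
        unfolding G' X_def Y_def using half_mult[OF Gc Qc] by auto
      have inv: "X * Q w * (minv (Q w) * minv X) = 1\<^sub>m p"
      proof -
        have "X * Q w * (minv (Q w) * minv X) = X * (Q w * (minv (Q w) * minv X))"
          using Xc(1) Qc mQ(1) mX(1) by (intro assoc_mult_mat[of _ p p _ p _ p]) auto
        also have "Q w * (minv (Q w) * minv X) = Q w * minv (Q w) * minv X"
          using Qc mQ(1) mX(1) by (intro assoc_mult_mat[of _ p p _ p _ p, symmetric]) auto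
        also have "\<dots> = minv X" using mQ(2) mX(1) by simp
        finally show ?thesis using mX(2) by simp
      qed
      have c: "X * Q w \<in> carrier_mat p p" "minv (Q w) * minv X \<in> carrier_mat p p"
        using mult_carrier_mat[OF Xc(1) Qc] mult_carrier_mat[OF mQ(1) mX(1)] .
      note mXQ = minv_eqI[OF c inv]
      have "\<i> \<cdot>\<^sub>m phi p N s a0 R Q w = - (bot_half p G' * minv (top_half p G'))"
      proof (rule phi_eq[of z w R Q G'])
        show "cmod z < 1" using elim by (simp add: D)
        show "det (top_half p G') \<noteq> 0" using mXQ(2) by (simp add: top)
      qed (simp_all add: w_def mob_def Rc Qc G'_def)
      also have "bot_half p G' * minv (top_half p G') = Y * Q w * (minv (Q w) * minv X)"
        unfolding top bot mXQ(1) ..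
      also have "\<dots> = Y * (Q w * (minv (Q w) * minv X))"
        using Xc(2) Qc mQ(1) mX(1) by (intro assoc_mult_mat[of _ p p _ p _ p]) auto
      also have "Q w * (minv (Q w) * minv X) = Q w * minv (Q w) * minv X"
        using Qc mQ(1) mX(1) by (intro assoc_mult_mat[of _ p p _ p _ p, symmetric]) auto
      also have "\<dots> = minv X" using mQ(2) mX(1) by simp
      finally show ?case using elim by (simp add: g_eq X_def Y_def w_def mob_def)
    qed
  qed
  have psd: "psd (block_toeplitz p M' (ext_seq N s (taylor_coeff p g)))" for M'
  proof (rule caratheodory_toeplitz_psd[OF p_pos gc])
    show "(\<lambda>z. g z $$ (i, j)) holomorphic_on ball 0 1" if "i < p" "j < p" for i j
      using holg[OF that] by (simp add: D_def)
    show "Re (cip v (g z *\<^sub>v v)) \<ge> 0" if "cmod z < 1" "v \<in> carrier_vec p" for z v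
      using that by (intro Re_graph_nonneg[OF _ Uc G_def det g_eq neg]) (auto simp: D)
    \<comment> \<open>Up to distance N the Taylor coefficients reproduce s by \<open>coef'\<close>.
      At k = 0 the two contributions add up to a0 + adj(a0) = s_0.\<close>
    show "ext_seq N s (taylor_coeff p g) k $$ (i, j)
       = (if k \<le> 0 then taylor_coeff p g (nat (- k)) $$ (i, j) else 0)
       + (if k \<ge> 0 then cnj (taylor_coeff p g (nat k) $$ (j, i)) else 0)" if ij: "i < p" "j < p" for k i j
    proof (cases "\<bar>k\<bar> \<le> int N")
      case True
      consider "k = 0" | "k < 0" | "k > 0" by linarith
      then show ?thesis
      proof cases
        case 1
        then show ?thesis using ij s_0[OF ij] coef'[of 0] by (simp add: ext_seq_def alph_def)
      next
        case 2
        then show ?thesis using True coef'[of "nat (- k)"] by (simp add: ext_seq_def alph_def nat_le_iff)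
      next
        case 3
        then have "taylor_coeff p g (nat k) = alph s a0 (nat k)" using True by (intro coef') auto
        moreover have "cnj (alph s a0 (nat k) $$ (j, i)) = s k $$ (i, j)"
          using alph_adjoint[of "nat k" j i] 3 True ij by auto
        ultimately show ?thesis using 3 True by (simp add: ext_seq_def)
      qed
    next
      case False
      then show ?thesis using ij carrier_matD[OF tc] by (auto simp: ext_seq_def)
    qed
  qed
  show ?thesis
    using rep ana gc g0 coef' psd by (intro exI[of _ g]) (auto simp: taylor_rep_def alph_def)
qed

end

section \<open>From extensions to admissible pairs\<close>

text \<open>The limit is the fixed point of the limiting affine map; each step contracts the
  deviation by q, up to an error that becomes small.\<close>

lemma affine_recurrence_limit:
  fixes A :: "nat \<Rightarrow> real"
  assumes rec: "\<And>m. A (Suc m) = q * A m + b m" and b: "b \<longlonglongrightarrow> \<beta>" and q: "0 \<le> q" "q < 1"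
  shows "A \<longlonglongrightarrow> \<beta> / (1 - q)"
proof -
  define L where "L = \<beta> / (1 - q)"
  have L: "\<beta> = L * (1 - q)" using q by (simp add: L_def)
  have "\<exists>no. \<forall>m\<ge>no. norm (A m - L) < r" if r: "r > 0" for r
  proof -
    \<comment> \<open>This size makes q (r/2) + \<epsilon> = r/2, so the bound below reproduces
      itself.\<close>
    define \<epsilon> where "\<epsilon> = r / 2 * (1 - q)"
    have \<epsilon>: "\<epsilon> > 0" using r q by (simp add: \<epsilon>_def)
    obtain M where M: "\<And>m. m \<ge> M \<Longrightarrow> \<bar>b m - \<beta>\<bar> < \<epsilon>"
      using LIMSEQ_D[OF b \<epsilon>] by auto
    have bd: "\<bar>A (M + k) - L\<bar> \<le> q ^ k * \<bar>A M - L\<bar> + r / 2" for k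
    proof (induction k)
      case 0
      then show ?case using r by simp
    next
      case (Suc k)
      have "A (M + Suc k) - L = q * (A (M + k) - L) + (b (M + k) - \<beta>)"
        by (simp add: rec L algebra_simps)
      then have "\<bar>A (M + Suc k) - L\<bar> \<le> q * \<bar>A (M + k) - L\<bar> + \<bar>b (M + k) - \<beta>\<bar>"
        using q by (metis abs_mult abs_of_nonneg abs_triangle_ineq)
      also have "\<dots> \<le> q * (q ^ k * \<bar>A M - L\<bar> + r / 2) + \<epsilon>"
        using Suc q M[of "M + k"] by (intro add_mono mult_left_mono) auto
      also have "\<dots> = q ^ Suc k * \<bar>A M - L\<bar> + r / 2" by (simp add: \<epsilon>_def field_simps)
      finally show ?case .
    qed
    have "(\<lambda>k. q ^ k * \<bar>A M - L\<bar>) \<longlonglongrightarrow> 0 * \<bar>A M - L\<bar>"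
      using q by (intro tendsto_intros LIMSEQ_realpow_zero) auto
    then have "eventually (\<lambda>k. q ^ k * \<bar>A M - L\<bar> < r / 2) sequentially"
      using r by (intro order_tendstoD) auto
    then obtain K where K: "\<And>k. k \<ge> K \<Longrightarrow> q ^ k * \<bar>A M - L\<bar> < r / 2"
      by (auto simp: eventually_sequentially)
    have "norm (A m - L) < r" if "m \<ge> M + K" for m
    proof -
      have "\<bar>A m - L\<bar> \<le> q ^ (m - M) * \<bar>A M - L\<bar> + r / 2" using bd[of "m - M"] that by simp
      moreover have "q ^ (m - M) * \<bar>A M - L\<bar> < r / 2" using K[of "m - M"] that by simp
      ultimately show ?thesis by simp
    qed
    then show ?thesis by blast
  qed
  then show ?thesis unfolding L_def[symmetric] by (rule LIMSEQ_I)
qed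

text \<open>The form is tested on e_a + \<omega> e_b, with a unimodular \<omega> turning the
  off-diagonal part into -2 |A_ab|; any \<omega> of modulus 1 serves when the entry is 0.\<close>

lemma psd_entry_bound:
  assumes A: "A \<in> carrier_mat m m" and psd: "psd A" and ab: "a < m" "b < m"
    and herm: "A $$ (b, a) = cnj (A $$ (a, b))"
  shows "2 * cmod (A $$ (a, b)) \<le> Re (A $$ (a, a)) + Re (A $$ (b, b))"
proof -
  define \<omega> where "\<omega> = (if A $$ (a, b) = 0 then 1 else - cnj (A $$ (a, b)) / cmod (A $$ (a, b)))"
  have \<omega>1: "\<omega> * A $$ (a, b) = - of_real (cmod (A $$ (a, b)))"
    using complex_norm_square[of "A $$ (a, b)"]
    by (auto simp: \<omega>_def power2_eq_square divide_eq_eq mult.commute)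
  have \<omega>2: "cnj \<omega> * \<omega> = 1"
    using complex_norm_square[of "A $$ (a, b)"]
    by (auto simp: \<omega>_def power2_eq_square divide_eq_eq mult.commute)
  have e: "cip (unit_vec m i) (A *\<^sub>v unit_vec m j) = A $$ (i, j)" if "i < m" "j < m" for i j
  proof -
    have "cip (unit_vec m i) (A *\<^sub>v unit_vec m j) = (\<Sum>k<m. if k = i then A $$ (k, j) else 0)"
      using A that by (auto simp: cip_def scalar_prod_right_unit simp del: sum.delta sum.delta' intro!: sum.cong)
    then show ?thesis using that by simp
  qed
  have ue: "unit_vec m i \<in> carrier_vec m" for i by simp
  have Ae: "A *\<^sub>v unit_vec m i \<in> carrier_vec m" for i using A by simp
  define x where "x = unit_vec m a + \<omega> \<cdot>\<^sub>v unit_vec m b"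
  have x: "x \<in> carrier_vec m" by (simp add: x_def)
  have "A *\<^sub>v x = A *\<^sub>v unit_vec m a + \<omega> \<cdot>\<^sub>v (A *\<^sub>v unit_vec m b)"
    unfolding x_def using A by (simp add: mult_add_distrib_mat_vec[of _ m m] mult_mat_vec[of _ m m])
  then have "cip x (A *\<^sub>v x) = A $$ (a, a) + \<omega> * A $$ (a, b) + cnj \<omega> * (A $$ (b, a) + \<omega> * A $$ (b, b))"
    using ab ue Ae by (simp add: x_def cip_linear[of _ m] e ring_distribs del: index_mult_mat_vec)
  also have "\<dots> = A $$ (a, a) + A $$ (b, b) + (\<omega> * A $$ (a, b) + cnj (\<omega> * A $$ (a, b)))"
    unfolding herm using \<omega>2 by (simp add: ring_distribs flip: mult.assoc)
  also have "\<dots> = A $$ (a, a) + A $$ (b, b) - 2 * of_real (cmod (A $$ (a, b)))"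
    unfolding \<omega>1 by simp
  finally have "Re (cip x (A *\<^sub>v x)) = Re (A $$ (a, a)) + Re (A $$ (b, b)) - 2 * cmod (A $$ (a, b))"
    by simp
  moreover have "Re (cip x (A *\<^sub>v x)) \<ge> 0" using psd[unfolded psd_iff[OF A]] x by blast
  ultimately show ?thesis by linarith
qed

section \<open>The power series of a nonnegative extension\<close>

locale toeplitz_extension = toeplitz_data +
  fixes t :: "nat \<Rightarrow> complex mat"
  assumes t_carrier: "\<And>k. k > N \<Longrightarrow> t k \<in> carrier_mat p p"
    and t_psd: "\<And>M. M > N \<Longrightarrow> psd (block_toeplitz p M (ext_seq N s t))"
begin

text \<open>The Taylor coefficients that g must have. At index 0 this is \<open>a0\<close>, which
  determines \<open>s 0\<close> only through its sum with its adjoint.\<close>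

definition \<alpha> :: "nat \<Rightarrow> complex mat" where
  "\<alpha> k = (if k \<le> N then alph s a0 k else t k)"

abbreviation "\<sigma> \<equiv> ext_seq N s t"

lemma \<alpha>_carrier [simp]: "\<alpha> k \<in> carrier_mat p p"
  using t_carrier[of k] s_carrier[of "- int k"] a0_carrier by (auto simp: \<alpha>_def alph_def)

lemma \<sigma>_entry:
  assumes "i < p" "j < p"
  shows "\<sigma> 0 $$ (i, j) = \<alpha> 0 $$ (i, j) + cnj (\<alpha> 0 $$ (j, i))"
    "k > 0 \<Longrightarrow> \<sigma> (- int k) $$ (i, j) = \<alpha> k $$ (i, j)"
    "k > 0 \<Longrightarrow> \<sigma> (int k) $$ (i, j) = cnj (\<alpha> k $$ (j, i))"
proof -
  show "\<sigma> 0 $$ (i, j) = \<alpha> 0 $$ (i, j) + cnj (\<alpha> 0 $$ (j, i))"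
    using s_0[OF assms] by (simp add: ext_seq_def \<alpha>_def alph_def)
  show "\<sigma> (- int k) $$ (i, j) = \<alpha> k $$ (i, j)" if "k > 0"
    using that by (auto simp: ext_seq_def \<alpha>_def alph_def)
  show "\<sigma> (int k) $$ (i, j) = cnj (\<alpha> k $$ (j, i))" if "k > 0"
    using that alph_adjoint[of k j i] assms carrier_matD[OF t_carrier[of k]] by (auto simp: ext_seq_def \<alpha>_def)
qed

lemma \<sigma>_herm:
  assumes "i < p" "j < p"
  shows "\<sigma> (- d) $$ (j, i) = cnj (\<sigma> d $$ (i, j))"
proof -
  obtain k where "d = int k \<or> d = - int k" by (metis int_cases2)
  then consider "d = 0" | "k > 0" "d = int k" | "k > 0" "d = - int k" by (cases k) auto
  then show ?thesis by cases (use assms in \<open>auto simp: \<sigma>_entry\<close>)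
qed

text \<open>In a Toeplitz section all diagonal entries come from \<sigma>_0, so positivity bounds
  every other entry uniformly in k. The coefficient \<open>a0\<close> is bounded separately, because
  its skew-Hermitian part is invisible to the Toeplitz form.\<close>

lemma \<alpha>_bounded: "\<exists>B. \<forall>k. \<forall>i<p. \<forall>j<p. cmod (\<alpha> k $$ (i, j)) \<le> B"
proof -
  define B0 where "B0 = (\<Sum>i<p. cmod (\<sigma> 0 $$ (i, i)))"
  define B1 where "B1 = (\<Sum>i<p. \<Sum>j<p. cmod (a0 $$ (i, j)))"
  have B1: "cmod (a0 $$ (i, j)) \<le> B1" if "i < p" "j < p" for i j
  proof -
    have "cmod (a0 $$ (i, j)) \<le> (\<Sum>j<p. cmod (a0 $$ (i, j)))" using that by (intro member_le_sum) auto
    also have "\<dots> \<le> B1" unfolding B1_def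
      using that by (intro member_le_sum[of i _ "\<lambda>i. \<Sum>j<p. cmod (a0 $$ (i, j))"]) (auto intro!: sum_nonneg)
    finally show ?thesis .
  qed
  have "cmod (\<alpha> k $$ (i, j)) \<le> B0" if k: "k > 0" and ij: "i < p" "j < p" for k i j
  proof -
    \<comment> \<open>For k > 0 this exceeds N, and the section contains block k.\<close>
    define M where "M = N + k"
    define A where "A = block_toeplitz p M \<sigma>"
    have Ac: "A \<in> carrier_mat ((M + 1) * p) ((M + 1) * p)" unfolding A_def by (rule block_toeplitz_carrier)
    have lt: "k * p + i < (M + 1) * p" "j < (M + 1) * p" using ij by (auto simp: M_def algebra_simps)
    have e: "A $$ (a, b) = \<sigma> (int (b div p) - int (a div p)) $$ (a mod p, b mod p)"
      if "a < (M + 1) * p" "b < (M + 1) * p" for a b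
      using that by (simp add: A_def block_toeplitz_def)
    have dm: "(k * p + i) div p = k" "(k * p + i) mod p = i" "j div p = 0" "j mod p = j" using ij by auto
    have h: "A $$ (j, k * p + i) = cnj (A $$ (k * p + i, j))"
      using k ij unfolding e[OF lt] e[OF lt(2,1)] dm by (simp add: \<sigma>_entry)
    have "2 * cmod (A $$ (k * p + i, j)) \<le> Re (A $$ (k * p + i, k * p + i)) + Re (A $$ (j, j))"
      by (rule psd_entry_bound[OF Ac _ lt h]) (use t_psd k in \<open>simp add: A_def M_def\<close>)
    then have "2 * cmod (\<alpha> k $$ (i, j)) \<le> Re (\<sigma> 0 $$ (i, i)) + Re (\<sigma> 0 $$ (j, j))"
      using k ij unfolding e[OF lt] e[OF lt(1,1)] e[OF lt(2,2)] dm by (simp add: \<sigma>_entry(2))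
    also have "\<dots> \<le> cmod (\<sigma> 0 $$ (i, i)) + cmod (\<sigma> 0 $$ (j, j))"
      by (intro add_mono complex_Re_le_cmod)
    also have "\<dots> \<le> B0 + B0"
      unfolding B0_def using ij by (intro add_mono member_le_sum[of _ _ "\<lambda>i. cmod (\<sigma> 0 $$ (i, i))"]) auto
    finally show ?thesis by simp
  qed
  then have "cmod (\<alpha> k $$ (i, j)) \<le> max B0 B1" if "i < p" "j < p" for k i j
    using that B1[OF that] by (cases "k = 0") (auto simp: \<alpha>_def alph_def le_max_iff_disj)
  then show ?thesis by blast
qed

text \<open>The m-fold backward shift of the series of g, entry by entry.\<close>

definition tail :: "nat \<Rightarrow> nat \<Rightarrow> nat \<Rightarrow> complex \<Rightarrow> complex" where
  "tail m i j z = (\<Sum>k. \<alpha> (m + k) $$ (i, j) * z ^ k)"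

lemma tail_sums:
  assumes "i < p" "j < p" "cmod z < 1"
  shows "(\<lambda>k. \<alpha> (m + k) $$ (i, j) * z ^ k) sums tail m i j z"
proof -
  obtain B where B: "\<And>k. cmod (\<alpha> k $$ (i, j)) \<le> B" using \<alpha>_bounded assms by blast
  have "summable (\<lambda>k. \<alpha> (m + k) $$ (i, j) * z ^ k)"
  proof (rule summable_comparison_test')
    show "summable (\<lambda>k. B * cmod z ^ k)" using assms by (intro summable_mult summable_geometric) auto
    show "norm (\<alpha> (m + k) $$ (i, j) * z ^ k) \<le> B * cmod z ^ k" if "k \<ge> 0" for k
      using B[of "m + k"] by (simp add: norm_mult norm_power mult_right_mono)
  qed
  then show ?thesis unfolding tail_def by (rule summable_sums)
qed

lemma tail_step:
  assumes "i < p" "j < p" "cmod z < 1"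
  shows "tail m i j z = \<alpha> m $$ (i, j) + z * tail (Suc m) i j z"
proof -
  have "(\<lambda>k. z * (\<alpha> (Suc m + k) $$ (i, j) * z ^ k)) sums (z * tail (Suc m) i j z)"
    by (intro sums_mult tail_sums assms)
  then have "(\<lambda>k. \<alpha> (m + Suc k) $$ (i, j) * z ^ Suc k) sums (z * tail (Suc m) i j z)"
    by (simp add: mult_ac)
  then have "(\<lambda>k. \<alpha> (m + k) $$ (i, j) * z ^ k) sums (z * tail (Suc m) i j z + \<alpha> (m + 0) $$ (i, j) * z ^ 0)"
    using sums_Suc_iff[of "\<lambda>k. \<alpha> (m + k) $$ (i, j) * z ^ k"] by simp
  then show ?thesis using sums_unique2[OF tail_sums[OF assms, of m]] by (simp add: add.commute)
qed

lemma tail_holomorphic: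
  assumes "i < p" "j < p"
  shows "tail m i j holomorphic_on ball 0 1"
  by (rule power_series_holomorphic[where a = "\<lambda>k. \<alpha> (m + k) $$ (i, j)"])
     (use tail_sums[OF assms] in auto)

definition g :: "complex \<Rightarrow> complex mat" where
  "g z = mat p p (\<lambda>(i, j). tail 0 i j z)"

text \<open>The sign and the offset \<open>Suc\<close> solve z h_k - h_{k-1} = \<alpha>_k, the
  recursion behind \<open>graph_interpolation\<close>; this column takes the place of S f.\<close>

definition tails :: "complex \<Rightarrow> complex mat" where
  "tails z = mat n p (\<lambda>(a, b). - tail (Suc (a div p)) (a mod p) b z)"

lemma g_tails_carrier [simp]: "g z \<in> carrier_mat p p" "tails z \<in> carrier_mat n p"
  by (auto simp: g_def tails_def)

lemma g_taylor: "taylor_coeff p g k = \<alpha> k"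
proof (rule eq_matI)
  fix i j assume "i < dim_row (\<alpha> k)" "j < dim_col (\<alpha> k)"
  then have ij: "i < p" "j < p" using carrier_matD[OF \<alpha>_carrier[of k]] by auto
  have "(\<lambda>z. g z $$ (i, j)) has_fps_expansion Abs_fps (\<lambda>k. \<alpha> k $$ (i, j))"
  proof (rule has_fps_expansionI)
    have "eventually (\<lambda>z. z \<in> ball 0 1) (nhds (0 :: complex))" by (rule eventually_nhds_in_open) auto
    then show "eventually (\<lambda>u. (\<lambda>n. fps_nth (Abs_fps (\<lambda>k. \<alpha> k $$ (i, j))) n * u ^ n) sums (g u $$ (i, j))) (nhds 0)"
      by eventually_elim (use tail_sums[OF ij, of _ 0] ij in \<open>simp add: g_def\<close>)
  qed
  from fps_nth_fps_expansion[OF this, of k] show "taylor_coeff p g k $$ (i, j) = \<alpha> k $$ (i, j)"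
    using ij by (simp add: taylor_coeff_def)
qed (use carrier_matD[OF \<alpha>_carrier[of k]] in \<open>auto simp: taylor_coeff_def\<close>)


lemma g_entry: "i < p \<Longrightarrow> j < p \<Longrightarrow> g z $$ (i, j) = tail 0 i j z"
  by (simp add: g_def)

section \<open>Potapov's fundamental inequality\<close>

definition blockform :: "(nat \<Rightarrow> complex) \<Rightarrow> int \<Rightarrow> (nat \<Rightarrow> complex) \<Rightarrow> complex" where
  "blockform u d w = (\<Sum>i<p. \<Sum>j<p. cnj (u i) * \<sigma> d $$ (i, j) * w j)"

lemma blockform_commute: "blockform w (- d) u = cnj (blockform u d w)"
proof -
  have "blockform w (- d) u = (\<Sum>j<p. \<Sum>i<p. cnj (w i) * \<sigma> (- d) $$ (i, j) * u j)"
    unfolding blockform_def by (rule sum.swap)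
  also have "\<dots> = cnj (blockform u d w)"
    unfolding blockform_def cnj_sum by (intro sum.cong refl) (auto simp: \<sigma>_herm mult_ac)
  finally show ?thesis .
qed

lemma blockform_scale: "blockform (\<lambda>i. c * u i) d (\<lambda>i. e * w i) = cnj c * e * blockform u d w"
  by (simp add: blockform_def sum_distrib_left mult_ac)

lemma blockform_nonneg:
  assumes L: "L > N + 1"
  shows "Re (\<Sum>k<L. \<Sum>l<L. blockform (Y k) (int l - int k) (Y l)) \<ge> 0"
proof -
  \<comment> \<open>Blocks are numbered from 0 to M, so L > N + 1 is exactly the range M > N in
    which positivity is assumed.\<close>
  define M where "M = L - 1"
  have M: "M > N" "M + 1 = L" using L by (auto simp: M_def)
  define A where "A = block_toeplitz p M \<sigma>"
  have Ac: "A \<in> carrier_mat (L * p) (L * p)" unfolding A_def M(2)[symmetric] by (rule block_toeplitz_carrier)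
  define x where "x = vec (L * p) (\<lambda>a. Y (a div p) (a mod p))"
  have x: "x \<in> carrier_vec (L * p)" by (simp add: x_def)
  have "cip x (A *\<^sub>v x) = (\<Sum>a<L*p. \<Sum>b<L*p. cnj (x $ a) * (A $$ (a, b) * x $ b))"
    using Ac x by (simp add: cip_def index_mult_vec_sum[OF Ac x] sum_distrib_left del: index_mult_mat_vec)
  also have "\<dots> = (\<Sum>k<L. \<Sum>i<p. \<Sum>l<L. \<Sum>j<p. cnj (Y k i) * \<sigma> (int l - int k) $$ (i, j) * Y l j)"
    unfolding sum_blocks using block_index_less M by (intro sum.cong refl) (auto simp: x_def A_def block_toeplitz_def)
  also have "\<dots> = (\<Sum>k<L. \<Sum>l<L. blockform (Y k) (int l - int k) (Y l))"
    unfolding blockform_def by (rule sum.cong[OF refl], rule sum.swap)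
  finally have "cip x (A *\<^sub>v x) = (\<Sum>k<L. \<Sum>l<L. blockform (Y k) (int l - int k) (Y l))" .
  moreover have "Re (cip x (A *\<^sub>v x)) \<ge> 0"
    using t_psd[OF M(1)] x unfolding A_def[symmetric] psd_iff[OF Ac] by blast
  ultimately show ?thesis by simp
qed

text \<open>The Toeplitz form is tested on the geometric block sequence
  (z^(m-1) v, ..., z v, v), followed by the blocks of x; then m tends to infinity.\<close>

lemma fundamental_inequality:
  assumes z: "cmod z < 1" and v: "v \<in> carrier_vec p" and x: "x \<in> carrier_vec n"
  shows "0 \<le> 2 * Re (cip v (g z *\<^sub>v v)) / (1 - (cmod z)\<^sup>2) - 2 * Re (cip x (tails z *\<^sub>v v)) + Re (cip x (S *\<^sub>v x))"
proof -
  define q where "q = (cmod z)\<^sup>2"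
  have q: "0 \<le> q" "q < 1" using z by (auto simp: q_def power_less_one_iff)
  define V where "V i = v $ i" for i
  define X where "X k i = x $ (k * p + i)" for k i
  define \<beta> where "\<beta> d = blockform V d V" for d
  have \<beta>_cnj: "\<beta> (- d) = cnj (\<beta> d)" for d unfolding \<beta>_def by (rule blockform_commute)
  \<comment> \<open>\<open>A\<close>, \<open>XT\<close> and \<open>XX\<close> are the geometric,
    mixed and pure x parts of the form. In \<open>A\<close> the powers increase, the reverse of
    their order in the test sequence, so that passing to m + 1 adds a row and a column in
    front.\<close>
  define A where "A m = (\<Sum>k<m. \<Sum>l<m. cnj z ^ k * z ^ l * \<beta> (int k - int l))" for m
  define XT where "XT m = (\<Sum>k<N+1. \<Sum>l<m. z ^ l * blockform (X k) (- int (Suc (k + l))) V)" for m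
  define XX where "XX = (\<Sum>k<N+1. \<Sum>l<N+1. blockform (X k) (int l - int k) (X l))"
  have total: "0 \<le> Re (A m) + 2 * Re (XT m) + Re XX" if m: "m > 0" for m
  proof -
    \<comment> \<open>Decreasing powers put v itself next to x. Block k of x is then k + l + 1
      blocks away from z^l v, which matches the offset in \<open>tails\<close>.\<close>
    define Y where "Y k = (if k < m then (\<lambda>i. z ^ (m - Suc k) * V i) else X (k - m))" for k
    define F where "F k l = blockform (Y k) (int l - int k) (Y l)" for k l
    have "(\<Sum>k<m+(N+1). \<Sum>l<m+(N+1). F k l) = (\<Sum>k<m. \<Sum>l<m. F k l) + (\<Sum>k<m. \<Sum>l<N+1. F k (m + l))
       + ((\<Sum>k<N+1. \<Sum>l<m. F (m + k) l) + (\<Sum>k<N+1. \<Sum>l<N+1. F (m + k) (m + l)))"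
      by (simp only: sum_split_add[of _ m "N + 1"] sum.distrib) (simp only: add_ac)
    moreover have "(\<Sum>k<m. \<Sum>l<m. F k l) = A m"
    proof -
      have "(\<Sum>k<m. \<Sum>l<m. F k l) = (\<Sum>k<m. \<Sum>l<m. cnj z ^ (m - Suc k) * z ^ (m - Suc l) * \<beta> (int (m - Suc k) - int (m - Suc l)))"
      proof (intro sum.cong refl)
        fix k l assume kl: "k \<in> {..<m}" "l \<in> {..<m}"
        have "F k l = blockform (\<lambda>i. z ^ (m - Suc k) * V i) (int l - int k) (\<lambda>i. z ^ (m - Suc l) * V i)"
          using kl unfolding F_def Y_def by simp
        also have "\<dots> = cnj (z ^ (m - Suc k)) * z ^ (m - Suc l) * \<beta> (int l - int k)"
          unfolding \<beta>_def by (rule blockform_scale)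
        also have "int l - int k = int (m - Suc k) - int (m - Suc l)" using kl by (auto simp: of_nat_diff)
        finally show "F k l = cnj z ^ (m - Suc k) * z ^ (m - Suc l) * \<beta> (int (m - Suc k) - int (m - Suc l))"
          by (simp only: complex_cnj_power)
      qed
      also have "\<dots> = (\<Sum>k<m. \<Sum>l<m. cnj z ^ (m - Suc k) * z ^ l * \<beta> (int (m - Suc k) - int l))"
        by (rule sum.cong[OF refl])
          (rule sum.nat_diff_reindex[of "\<lambda>l. cnj z ^ (m - Suc _) * z ^ l * \<beta> (int (m - Suc _) - int l)"])
      also have "\<dots> = A m"
        unfolding A_def
        by (rule sum.nat_diff_reindex[of "\<lambda>k. \<Sum>l<m. cnj z ^ k * z ^ l * \<beta> (int k - int l)"])
      finally show ?thesis .
    qed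
    moreover have XT: "(\<Sum>k<N+1. \<Sum>l<m. F (m + k) l) = XT m"
    proof -
      have "(\<Sum>l<m. F (m + k) l) = (\<Sum>l<m. z ^ l * blockform (X k) (- int (Suc (k + l))) V)" for k
      proof -
        have "(\<Sum>l<m. F (m + k) l) = (\<Sum>l<m. z ^ (m - Suc l) * blockform (X k) (- int (Suc (k + (m - Suc l)))) V)"
        proof (intro sum.cong refl)
          fix l assume l: "l \<in> {..<m}"
          have "F (m + k) l = blockform (X k) (int l - int (m + k)) (\<lambda>i. z ^ (m - Suc l) * V i)"
            using l unfolding F_def Y_def by simp
          also have "\<dots> = z ^ (m - Suc l) * blockform (X k) (int l - int (m + k)) V"
            using blockform_scale[of 1 "X k" "int l - int (m + k)" "z ^ (m - Suc l)" V] by simp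
          also have "int l - int (m + k) = - int (Suc (k + (m - Suc l)))" using l by (auto simp: of_nat_diff)
          finally show "F (m + k) l = z ^ (m - Suc l) * blockform (X k) (- int (Suc (k + (m - Suc l)))) V" .
        qed
        also have "\<dots> = (\<Sum>l<m. z ^ l * blockform (X k) (- int (Suc (k + l))) V)"
          by (rule sum.nat_diff_reindex[of "\<lambda>l. z ^ l * blockform (X k) (- int (Suc (k + l))) V"])
        finally show ?thesis .
      qed
      then show ?thesis by (simp add: XT_def)
    qed
    moreover have "(\<Sum>k<m. \<Sum>l<N+1. F k (m + l)) = cnj (XT m)"
    proof -
      have F_commute: "F k l = cnj (F l k)" for k l
        using blockform_commute[of "Y k" "int k - int l" "Y l"] by (simp add: F_def)
      show ?thesis unfolding XT[symmetric] cnj_sum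
        by (subst sum.swap) (intro sum.cong refl F_commute)
    qed
    moreover have "(\<Sum>k<N+1. \<Sum>l<N+1. F (m + k) (m + l)) = XX"
      unfolding XX_def F_def Y_def by simp
    moreover have "0 \<le> Re (\<Sum>k<m+(N+1). \<Sum>l<m+(N+1). F k l)"
      unfolding F_def using m by (intro blockform_nonneg) auto
    ultimately have "0 \<le> Re (A m + cnj (XT m) + (XT m + XX))" by (simp only:)
    then show ?thesis by simp
  qed
  have lim_g: "(\<lambda>m. \<Sum>l<m. z ^ l * (\<Sum>i<p. \<Sum>j<p. cnj (V i) * \<alpha> l $$ (i, j) * V j)) \<longlonglongrightarrow> cip v (g z *\<^sub>v v)"
  proof -
    have "(\<lambda>m. \<Sum>i<p. \<Sum>j<p. cnj (V i) * V j * (\<Sum>l<m. \<alpha> (0 + l) $$ (i, j) * z ^ l))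
        \<longlonglongrightarrow> (\<Sum>i<p. \<Sum>j<p. cnj (V i) * V j * tail 0 i j z)"
      by (intro tendsto_intros tail_sums[unfolded sums_def] z) auto
    also have "(\<Sum>i<p. \<Sum>j<p. cnj (V i) * V j * tail 0 i j z) = cip v (g z *\<^sub>v v)"
      using v carrier_matD[OF g_tails_carrier(1)[of z]] by (auto simp: cip_def index_mult_vec_sum[OF g_tails_carrier(1) v] g_entry V_def sum_distrib_left mult_ac
         simp del: index_mult_mat_vec intro!: sum.cong)
    also have "(\<lambda>m. \<Sum>i<p. \<Sum>j<p. cnj (V i) * V j * (\<Sum>l<m. \<alpha> (0 + l) $$ (i, j) * z ^ l))
       = (\<lambda>m. \<Sum>l<m. z ^ l * (\<Sum>i<p. \<Sum>j<p. cnj (V i) * \<alpha> l $$ (i, j) * V j))"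
    proof
      fix m
      have "(\<Sum>i<p. \<Sum>j<p. cnj (V i) * V j * (\<Sum>l<m. \<alpha> (0 + l) $$ (i, j) * z ^ l))
         = (\<Sum>i<p. \<Sum>l<m. \<Sum>j<p. z ^ l * (cnj (V i) * \<alpha> l $$ (i, j) * V j))"
        unfolding sum_distrib_left by (rule sum.cong[OF refl], subst sum.swap) (simp add: mult_ac)
      also have "\<dots> = (\<Sum>l<m. \<Sum>i<p. \<Sum>j<p. z ^ l * (cnj (V i) * \<alpha> l $$ (i, j) * V j))"
        by (rule sum.swap)
      finally show "(\<Sum>i<p. \<Sum>j<p. cnj (V i) * V j * (\<Sum>l<m. \<alpha> (0 + l) $$ (i, j) * z ^ l))
         = (\<Sum>l<m. z ^ l * (\<Sum>i<p. \<Sum>j<p. cnj (V i) * \<alpha> l $$ (i, j) * V j))"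
        by (simp add: sum_distrib_left)
    qed
    finally show ?thesis .
  qed
  define \<gamma> where "\<gamma> l = (\<Sum>i<p. \<Sum>j<p. cnj (V i) * \<alpha> l $$ (i, j) * V j)" for l
  have \<beta>_pos: "\<beta> (- int l) = \<gamma> l" if "l > 0" for l
    unfolding \<beta>_def \<gamma>_def blockform_def using that by (intro sum.cong refl) (simp add: \<sigma>_entry)
  have \<beta>_0: "\<beta> 0 = \<gamma> 0 + cnj (\<gamma> 0)"
  proof -
    have "\<beta> 0 = (\<Sum>i<p. \<Sum>j<p. cnj (V i) * \<alpha> 0 $$ (i, j) * V j) + (\<Sum>i<p. \<Sum>j<p. cnj (V i) * cnj (\<alpha> 0 $$ (j, i)) * V j)"
      unfolding \<beta>_def blockform_def by (simp add: \<sigma>_entry ring_distribs sum.distrib)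
    also have "(\<Sum>i<p. \<Sum>j<p. cnj (V i) * cnj (\<alpha> 0 $$ (j, i)) * V j) = cnj (\<gamma> 0)"
      unfolding \<gamma>_def by (subst sum.swap) (simp add: mult_ac)
    finally show ?thesis by (simp add: \<gamma>_def)
  qed
  \<comment> \<open>Splitting off the first row and column leaves |z|^2 times the previous form, by
    the Toeplitz structure. The row and the column together give twice the real part of a partial
    sum of the series, because \<beta>_0 = \<gamma>_0 + cnj \<gamma>_0 is shared between
    them.\<close>
  have A_rec: "Re (A (Suc m)) = q * Re (A m) + 2 * Re (\<Sum>l<Suc m. z ^ l * \<gamma> l)" for m
  proof -
    define W where "W = (\<Sum>l<Suc m. z ^ l * \<gamma> l)"
    have "A (Suc m) = (\<Sum>l<Suc m. z ^ l * \<beta> (- int l)) + (\<Sum>k<m. \<Sum>l<Suc m. cnj z ^ Suc k * z ^ l * \<beta> (int (Suc k) - int l))"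
      unfolding A_def by (subst sum.lessThan_Suc_shift) simp
    also have "(\<Sum>k<m. \<Sum>l<Suc m. cnj z ^ Suc k * z ^ l * \<beta> (int (Suc k) - int l))
       = (\<Sum>k<m. cnj z ^ Suc k * \<beta> (int (Suc k))) + (\<Sum>k<m. \<Sum>l<m. cnj z ^ Suc k * z ^ Suc l * \<beta> (int k - int l))"
      unfolding sum.lessThan_Suc_shift[of _ m] sum.distrib by simp
    also have "(\<Sum>k<m. \<Sum>l<m. cnj z ^ Suc k * z ^ Suc l * \<beta> (int k - int l)) = of_real q * A m"
      unfolding A_def q_def complex_norm_square by (simp add: sum_distrib_left mult_ac)
    also have "(\<Sum>l<Suc m. z ^ l * \<beta> (- int l)) = cnj (\<gamma> 0) + (\<Sum>l<Suc m. z ^ l * \<gamma> l)"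
      unfolding sum.lessThan_Suc_shift \<beta>_pos[OF zero_less_Suc] by (simp add: \<beta>_0)
    also have "(\<Sum>k<m. cnj z ^ Suc k * \<beta> (int (Suc k))) = cnj (\<Sum>l<Suc m. z ^ l * \<gamma> l) - cnj (\<gamma> 0)"
    proof -
      have "\<beta> (int (Suc k)) = cnj (\<gamma> (Suc k))" for k
        using \<beta>_cnj[of "- int (Suc k)"] \<beta>_pos[of "Suc k"] by (simp del: of_nat_Suc)
      then show ?thesis unfolding sum.lessThan_Suc_shift by simp
    qed
    finally have "A (Suc m) = cnj (\<gamma> 0) + W + (cnj W - cnj (\<gamma> 0) + of_real q * A m)" unfolding W_def .
    then show ?thesis unfolding W_def[symmetric] by simp
  qed
  have limA: "(\<lambda>m. Re (A m)) \<longlonglongrightarrow> 2 * Re (cip v (g z *\<^sub>v v)) / (1 - q)"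
  proof (rule affine_recurrence_limit[where b = "\<lambda>m. 2 * Re (\<Sum>l<Suc m. z ^ l * \<gamma> l)"])
    show "Re (A (Suc m)) = q * Re (A m) + 2 * Re (\<Sum>l<Suc m. z ^ l * \<gamma> l)" for m by (rule A_rec)
    show "(\<lambda>m. 2 * Re (\<Sum>l<Suc m. z ^ l * \<gamma> l)) \<longlonglongrightarrow> 2 * Re (cip v (g z *\<^sub>v v))"
      using LIMSEQ_Suc[OF lim_g[folded \<gamma>_def]] by (intro tendsto_intros)
  qed (use q in auto)
  \<comment> \<open>The blocks of x come after all the multiples of v, so only coefficients
    \<alpha>_j with j \<ge> 1 occur and \<open>a0\<close> does not enter.\<close>
  have limXT: "XT \<longlonglongrightarrow> - cip x (tails z *\<^sub>v v)"
  proof -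
    have XT_eq: "XT m = (\<Sum>k<N+1. \<Sum>i<p. \<Sum>j<p. cnj (X k i) * V j * (\<Sum>l<m. \<alpha> (Suc k + l) $$ (i, j) * z ^ l))" for m
    proof -
      have "(\<Sum>l<m. z ^ l * blockform (X k) (- int (Suc (k + l))) V)
         = (\<Sum>i<p. \<Sum>j<p. cnj (X k i) * V j * (\<Sum>l<m. \<alpha> (Suc k + l) $$ (i, j) * z ^ l))" for k
      proof -
        have "(\<Sum>l<m. z ^ l * blockform (X k) (- int (Suc (k + l))) V)
          = (\<Sum>l<m. \<Sum>i<p. \<Sum>j<p. cnj (X k i) * V j * (\<alpha> (Suc k + l) $$ (i, j) * z ^ l))"
          unfolding blockform_def sum_distrib_left
          by (intro sum.cong refl) (simp add: \<sigma>_entry(2)[OF _ _ zero_less_Suc] mult_ac del: of_nat_Suc)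
        also have "\<dots> = (\<Sum>i<p. \<Sum>l<m. \<Sum>j<p. cnj (X k i) * V j * (\<alpha> (Suc k + l) $$ (i, j) * z ^ l))"
          by (rule sum.swap)
        also have "\<dots> = (\<Sum>i<p. \<Sum>j<p. \<Sum>l<m. cnj (X k i) * V j * (\<alpha> (Suc k + l) $$ (i, j) * z ^ l))"
          by (rule sum.cong[OF refl], rule sum.swap)
        finally show ?thesis by (simp only: sum_distrib_left)
      qed
      then show ?thesis unfolding XT_def by simp
    qed
    have "XT \<longlonglongrightarrow> (\<Sum>k<N+1. \<Sum>i<p. \<Sum>j<p. cnj (X k i) * V j * tail (Suc k) i j z)"
      unfolding XT_eq[abs_def] by (intro tendsto_intros tail_sums[unfolded sums_def] z) auto
    also have "(\<Sum>k<N+1. \<Sum>i<p. \<Sum>j<p. cnj (X k i) * V j * tail (Suc k) i j z) = - cip x (tails z *\<^sub>v v)"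
    proof -
      have "cip x (tails z *\<^sub>v v) = (\<Sum>a<(N+1)*p. \<Sum>j<p. cnj (x $ a) * (tails z $$ (a, j) * v $ j))"
        using x v carrier_matD[OF g_tails_carrier(2)[of z]] n_def
        by (simp add: cip_def index_mult_vec_sum[OF g_tails_carrier(2) v] sum_distrib_left del: index_mult_mat_vec)
      also have "\<dots> = (\<Sum>k<N+1. \<Sum>i<p. \<Sum>j<p. - (cnj (X k i) * V j * tail (Suc k) i j z))"
        unfolding sum_blocks
      proof (intro sum.cong refl)
        fix k i j assume kij: "k \<in> {..<N + 1}" "i \<in> {..<p}" "j \<in> {..<p}"
        then have "k * p + i < n" unfolding n_def by (intro block_index_less) auto
        then show "cnj (x $ (k * p + i)) * (tails z $$ (k * p + i, j) * v $ j) = - (cnj (X k i) * V j * tail (Suc k) i j z)"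
          using kij by (simp add: tails_def X_def V_def)
      qed
      finally show ?thesis by (simp add: sum_negf)
    qed
    finally show ?thesis .
  qed
  \<comment> \<open>Differences of block indices within x are at most N, where the extended sequence
    is still s.\<close>
  have XX: "XX = cip x (S *\<^sub>v x)"
  proof -
    have lt: "k * p + i < n" if "k < N + 1" "i < p" for k i
      unfolding n_def using that by (rule block_index_less)
    have "cip x (S *\<^sub>v x) = (\<Sum>a<(N+1)*p. \<Sum>b<(N+1)*p. cnj (x $ a) * (S $$ (a, b) * x $ b))"
      using x n_def by (simp add: cip_def index_mult_vec_sum[OF carriers(1) x] sum_distrib_left del: index_mult_mat_vec)
    also have "\<dots> = (\<Sum>k<N+1. \<Sum>i<p. \<Sum>l<N+1. \<Sum>j<p. cnj (X k i) * \<sigma> (int l - int k) $$ (i, j) * X l j)"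
      unfolding sum_blocks
      by (intro sum.cong refl) (auto simp: X_def entries lt ext_seq_def)
    also have "\<dots> = XX"
      unfolding XX_def blockform_def by (rule sum.cong[OF refl], rule sum.swap)
    finally show ?thesis by simp
  qed
  have "(\<lambda>m. Re (A m) + 2 * Re (XT m) + Re XX) \<longlonglongrightarrow>
      2 * Re (cip v (g z *\<^sub>v v)) / (1 - q) + 2 * Re (- cip x (tails z *\<^sub>v v)) + Re XX"
    by (intro tendsto_intros limA limXT)
  moreover have "eventually (\<lambda>m. 0 \<le> Re (A m) + 2 * Re (XT m) + Re XX) sequentially"
    using eventually_gt_at_top[of 0] by eventually_elim (rule total)
  ultimately have "0 \<le> 2 * Re (cip v (g z *\<^sub>v v)) / (1 - q) + 2 * Re (- cip x (tails z *\<^sub>v v)) + Re XX"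
    by (rule tendsto_lowerbound) simp
  then show ?thesis by (simp add: XX q_def)
qed

end

section \<open>Construction of the pair from the power series\<close>

lemma moebius_disc:
  assumes "w \<in> lower_half"
  shows "cmod ((w + \<i>) / (w - \<i>)) < 1" "w \<noteq> \<i>"
proof -
  have im: "Im w < 0" using assms by (simp add: lower_half_def)
  then show "w \<noteq> \<i>" by auto
  have "(cmod (w + \<i>))\<^sup>2 < (cmod (w - \<i>))\<^sup>2"
    unfolding cmod_power2 using im by (simp add: power2_eq_square algebra_simps)
  then have "cmod (w + \<i>) < cmod (w - \<i>)" by (rule power_less_imp_less_base) simp
  then show "cmod ((w + \<i>) / (w - \<i>)) < 1"
    using \<open>w \<noteq> \<i>\<close> by (simp add: norm_divide divide_less_eq)
qed

context toeplitz_extension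
begin

text \<open>\<open>V z\<close> is the product of the inverse of \<open>Theta z\<close> with the block column (I, -g), written
  without the pole that the inverse has at 0.\<close>

definition V :: "complex \<Rightarrow> complex mat" where
  "V z = stack p (1\<^sub>m p) (- g z) + (1 - z) \<cdot>\<^sub>m (mat_adjoint C * (H 1 * (minv S * tails z)))"

lemma V_carriers [simp]: "minv S * tails z \<in> carrier_mat n p" "H 1 * (minv S * tails z) \<in> carrier_mat n p"
  "mat_adjoint C * (H 1 * (minv S * tails z)) \<in> carrier_mat (2 * p) p" "V z \<in> carrier_mat (2 * p) p"
proof -
  show 1: "minv S * tails z \<in> carrier_mat n p" by (rule mult_carrier_mat[OF S_inv(1) g_tails_carrier(2)])
  show 2: "H 1 * (minv S * tails z) \<in> carrier_mat n p" by (rule mult_carrier_mat[OF carriers(6) 1])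
  show 3: "mat_adjoint C * (H 1 * (minv S * tails z)) \<in> carrier_mat (2 * p) p" by (rule mult_carrier_mat[OF carriers(8) 2])
  show "V z \<in> carrier_mat (2 * p) p" unfolding V_def using 3 by (intro add_carrier_mat smult_carrier_mat)
qed

text \<open>This is the recursion z h_k - h_{k-1} = \<alpha>_k supplied by \<open>tail_step\<close>,
  run backwards: the coefficients are given and h is read off.\<close>

lemma CJ_graph:
  assumes z: "cmod z < 1" and v: "v \<in> carrier_vec p"
  shows "C *\<^sub>v (J *\<^sub>v (stack p (1\<^sub>m p) (- g z) *\<^sub>v v)) = z \<cdot>\<^sub>v (tails z *\<^sub>v v) - shift *\<^sub>v (tails z *\<^sub>v v)"
proof (rule eq_vecI)
  define y where "y = stack p (1\<^sub>m p) (- g z) *\<^sub>v v"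
  have y: "y \<in> carrier_vec (2 * p)" unfolding y_def using v by (intro mult_mat_vec_carrier[OF half_carriers(1)])
  have gm: "- g z \<in> carrier_mat p p" using g_tails_carrier(1)[of z] by simp
  have y_top: "y $ i = v $ i" if "i < p" for i
    using stack_vec[OF one_carrier_mat gm v, of i] that v by (simp add: y_def)
  have y_bot: "y $ (i + p) = - (g z *\<^sub>v v) $ i" if "i < p" for i
    using stack_vec[OF one_carrier_mat gm v, of "i + p"] that v carrier_matD[OF g_tails_carrier(1)[of z]]
    by (simp add: y_def del: index_mult_mat_vec)
  have h: "tails z *\<^sub>v v \<in> carrier_vec n" using v by (intro mult_mat_vec_carrier[OF g_tails_carrier(2)])
  fix a assume "a < dim_vec (z \<cdot>\<^sub>v (tails z *\<^sub>v v) - shift *\<^sub>v (tails z *\<^sub>v v))"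
  then have a: "a < n" using h by simp
  define i where "i = a mod p"
  define k where "k = a div p"
  have i: "i < p" using p_pos by (simp add: i_def)
  have hv: "(tails z *\<^sub>v v) $ b = (\<Sum>j<p. - tail (Suc (b div p)) (b mod p) j z * v $ j)" if "b < n" for b
    unfolding index_mult_vec_sum[OF g_tails_carrier(2) v that] using that by (intro sum.cong) (auto simp: tails_def)
  have "(C *\<^sub>v (J *\<^sub>v y)) $ a = (if a < p then (J *\<^sub>v y) $ a else 0)
      + (\<Sum>j<p. alph s a0 k $$ (i, j) * (J *\<^sub>v y) $ (j + p))"
    unfolding k_def i_def using y a by (intro C_vec_entry) auto
  also have "\<dots> = (if a < p then - (g z *\<^sub>v v) $ a else 0) + (\<Sum>j<p. \<alpha> k $$ (i, j) * v $ j)"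
    using y a div_le[OF a] by (auto simp: J_vec y_top y_bot \<alpha>_def k_def simp del: index_mult_mat_vec)
  also have "\<dots> = z * (tails z *\<^sub>v v) $ a - (if p \<le> a then (tails z *\<^sub>v v) $ (a - p) else 0)"
  proof (cases "p \<le> a")
    case False
    then have k0: "k = 0" "i = a" by (auto simp: k_def i_def)
    have "- (g z *\<^sub>v v) $ a + (\<Sum>j<p. \<alpha> 0 $$ (a, j) * v $ j) = (\<Sum>j<p. (\<alpha> 0 $$ (a, j) - tail 0 a j z) * v $ j)"
      using False by (simp add: index_mult_vec_sum[OF g_tails_carrier(1) v] g_entry sum_subtractf ring_distribs del: index_mult_mat_vec)
    also have "\<dots> = (\<Sum>j<p. z * (- tail (Suc 0) a j z * v $ j))"
      using False tail_step[OF _ _ z, of a _ 0] by (intro sum.cong) (auto simp: algebra_simps)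
    finally show ?thesis using False k0 a unfolding hv[OF a] by (simp add: sum_distrib_left)
  next
    case True
    have lt: "a - p < n" using a by linarith
    have k1: "Suc (k - 1) = k" using div_pos[OF True] by (simp add: k_def)
    have "(\<Sum>j<p. \<alpha> k $$ (i, j) * v $ j) = (\<Sum>j<p. z * (- tail (Suc k) i j z * v $ j) - (- tail k i j z * v $ j))"
      using tail_step[OF i _ z, of _ k] by (intro sum.cong) (auto simp: algebra_simps)
    then show ?thesis using True unfolding hv[OF a] hv[OF lt] div_minus_p[OF True] mod_minus_p[OF True] k_def[symmetric] i_def[symmetric] k1
      by (simp add: sum_distrib_left sum_subtractf sum_negf)
  qed
  also have "\<dots> = (z \<cdot>\<^sub>v (tails z *\<^sub>v v) - shift *\<^sub>v (tails z *\<^sub>v v)) $ a"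
    using carrier_matD[OF g_tails_carrier(2)[of z]] a shift_vec[OF h a] by (auto simp del: index_mult_mat_vec)
  finally show "(C *\<^sub>v (J *\<^sub>v (stack p (1\<^sub>m p) (- g z) *\<^sub>v v))) $ a = (z \<cdot>\<^sub>v (tails z *\<^sub>v v) - shift *\<^sub>v (tails z *\<^sub>v v)) $ a"
    unfolding y_def .
qed (use carrier_matD[OF g_tails_carrier(2)[of z]] in auto)

text \<open>Any preimage u of y under \<Theta> equals y + (1 - z) adj(C) e with e =
  \<open>E z *\<^sub>v u\<close>, and S (e - adj(T) e) should be the column h of tails. Solving the
  latter for e gives u without inverting \<Theta>; \<open>E_unique\<close> then confirms the
  guess.\<close>

lemma V_vec:
  assumes z: "cmod z < 1" and v: "v \<in> carrier_vec p"
  defines "y \<equiv> stack p (1\<^sub>m p) (- g z) *\<^sub>v v" and "u \<equiv> V z *\<^sub>v v"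
  shows "Theta z *\<^sub>v u = y" "Re (cip u (J *\<^sub>v u)) \<le> 0"
proof -
  define h where "h = tails z *\<^sub>v v"
  have h: "h \<in> carrier_vec n" unfolding h_def using v by (intro mult_mat_vec_carrier[OF g_tails_carrier(2)])
  have y: "y \<in> carrier_vec (2 * p)" unfolding y_def using v by (intro mult_mat_vec_carrier[OF half_carriers(1)])
  \<comment> \<open>\<open>H 1\<close> inverts I - adj(T), so e - adj(T) e is the inverse of S
    applied to h: the vector f of both \<Theta> identities.\<close>
  define e where "e = H 1 *\<^sub>v (minv S *\<^sub>v h)"
  have e: "e \<in> carrier_vec n" using h by (simp add: e_def)
  define e' where "e' = mat_adjoint shift *\<^sub>v e"
  have e': "e' \<in> carrier_vec n" using e by (simp add: e'_def)
  define c where "c = mat_adjoint C *\<^sub>v e"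
  have c: "c \<in> carrier_vec (2 * p)" using e by (simp add: c_def)
  have u_eq: "u = y + (1 - z) \<cdot>\<^sub>v c"
  proof -
    have "u = y + ((1 - z) \<cdot>\<^sub>m (mat_adjoint C * (H 1 * (minv S * tails z)))) *\<^sub>v v"
      unfolding u_def V_def y_def by (rule add_mult_distrib_mat_vec[OF half_carriers(1) smult_carrier_mat[OF V_carriers(3)] v])
    also have "((1 - z) \<cdot>\<^sub>m (mat_adjoint C * (H 1 * (minv S * tails z)))) *\<^sub>v v
        = (1 - z) \<cdot>\<^sub>v ((mat_adjoint C * (H 1 * (minv S * tails z))) *\<^sub>v v)"
      by (rule smult_mat_vec[OF V_carriers(3) v])
    also have "(mat_adjoint C * (H 1 * (minv S * tails z))) *\<^sub>v v = c"
      unfolding c_def e_def h_def assoc_mult_mat_vec[OF carriers(8) V_carriers(2) v]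
        assoc_mult_mat_vec[OF carriers(6) V_carriers(1) v] assoc_mult_mat_vec[OF S_inv(1) g_tails_carrier(2) v] ..
    finally show ?thesis .
  qed
  have u: "u \<in> carrier_vec (2 * p)" unfolding u_eq using y c by simp
  define f where "f = e - e'"
  have f: "f \<in> carrier_vec n" using e e' by (simp add: f_def)
  have "f = minv S *\<^sub>v h"
    using H_vec[of "minv S *\<^sub>v h" 1] h unfolding f_def e'_def e_def by simp
  then have Sf: "S *\<^sub>v f = h" using h by simp
  then have h_eq: "h = S *\<^sub>v e - S *\<^sub>v e'"
    unfolding f_def using e e' by (simp add: mult_minus_distrib_mat_vec[of _ n n])
  define d where "d = e - z \<cdot>\<^sub>v (mat_adjoint shift *\<^sub>v e)"
  have Eu: "E z *\<^sub>v u = e"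
  proof (rule E_unique[OF u e d_def])
    have "C *\<^sub>v (J *\<^sub>v u) = C *\<^sub>v (J *\<^sub>v y) + (1 - z) \<cdot>\<^sub>v (C *\<^sub>v (J *\<^sub>v c))"
      unfolding u_eq using y c
      by (simp add: mult_add_distrib_mat_vec[of J "2*p" "2*p"] mult_add_distrib_mat_vec[of C n "2*p"]
         mult_mat_vec[of J "2*p" "2*p"] mult_mat_vec[of C n "2*p"])
    also have "C *\<^sub>v (J *\<^sub>v y) = z \<cdot>\<^sub>v h - shift *\<^sub>v h"
      unfolding y_def h_def by (rule CJ_graph[OF z v])
    also have "\<dots> = z \<cdot>\<^sub>v (S *\<^sub>v e - S *\<^sub>v e') - (shift *\<^sub>v (S *\<^sub>v e) - shift *\<^sub>v (S *\<^sub>v e'))"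
      unfolding h_eq using e e' by (simp add: mult_minus_distrib_mat_vec[of _ n n])
    also have "C *\<^sub>v (J *\<^sub>v c) = S *\<^sub>v e - shift *\<^sub>v (S *\<^sub>v e')"
      unfolding c_def e'_def by (rule displacement_vec[OF e])
    finally have 1: "C *\<^sub>v (J *\<^sub>v u) = z \<cdot>\<^sub>v (S *\<^sub>v e - S *\<^sub>v e') - (shift *\<^sub>v (S *\<^sub>v e) - shift *\<^sub>v (S *\<^sub>v e'))
       + (1 - z) \<cdot>\<^sub>v (S *\<^sub>v e - shift *\<^sub>v (S *\<^sub>v e'))" .
    have "S *\<^sub>v d - shift *\<^sub>v (S *\<^sub>v d) = (S *\<^sub>v e - z \<cdot>\<^sub>v (S *\<^sub>v e')) - (shift *\<^sub>v (S *\<^sub>v e) - z \<cdot>\<^sub>v (shift *\<^sub>v (S *\<^sub>v e')))"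
      unfolding d_def e'_def[symmetric] using e e'
      by (simp add: mult_minus_distrib_mat_vec[of _ n n] mult_mat_vec[of _ n n])
    then show "S *\<^sub>v d - shift *\<^sub>v (S *\<^sub>v d) = C *\<^sub>v (J *\<^sub>v u)"
      unfolding 1 using e e' by (auto intro!: eq_vecI simp: algebra_simps simp del: index_mult_mat_vec)
  qed
  have "Theta z *\<^sub>v u = u + (z - 1) \<cdot>\<^sub>v c"
    using Theta_vec[OF u] by (simp add: Eu c_def)
  also have "\<dots> = y" unfolding u_eq using y c by (intro eq_vecI) (auto simp: algebra_simps)
  finally show Tu: "Theta z *\<^sub>v u = y" .
  have gm: "- g z \<in> carrier_mat p p" using g_tails_carrier(1)[of z] by simp
  have gd: "dim_row (g z) = p" "dim_col (g z) = p" using carrier_matD[OF g_tails_carrier(1)[of z]] by auto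
  have "cip y (J *\<^sub>v y) = of_real (2 * Re (\<Sum>i<p. cnj (v $ i) * - ((g z *\<^sub>v v) $ i)))"
  proof -
    have "y $ i = v $ i" "y $ (i + p) = - (g z *\<^sub>v v) $ i" if "i < p" for i
      using stack_vec[OF one_carrier_mat gm v, of i] stack_vec[OF one_carrier_mat gm v, of "i + p"] that v gd
      by (simp_all add: y_def del: index_mult_mat_vec)
    then show ?thesis unfolding cip_J[OF y] by (simp del: index_mult_mat_vec Re_sum)
  qed
  also have "(\<Sum>i<p. cnj (v $ i) * - ((g z *\<^sub>v v) $ i)) = - cip v (g z *\<^sub>v v)"
    using gd by (simp add: cip_def sum_negf del: index_mult_mat_vec)
  finally have "cip y (J *\<^sub>v y) = of_real (- 2 * Re (cip v (g z *\<^sub>v v)))" by simp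
  then have "- 2 * Re (cip v (g z *\<^sub>v v)) = Re (cip u (J *\<^sub>v u) - of_real (1 - (cmod z)\<^sup>2) * cip f (S *\<^sub>v f))"
    using Theta_J_form[OF u Eu[symmetric] f_def[unfolded e'_def]] unfolding Tu by (metis Re_complex_of_real)
  also have "\<dots> = Re (cip u (J *\<^sub>v u)) - (1 - (cmod z)\<^sup>2) * Re (cip f h)"
    unfolding Sf by simp
  finally have 1: "Re (cip u (J *\<^sub>v u)) = (1 - (cmod z)\<^sup>2) * Re (cip f h) - 2 * Re (cip v (g z *\<^sub>v v))" by simp
  have pos: "1 - (cmod z)\<^sup>2 > 0" using z by (simp add: power_less_one_iff)
  \<comment> \<open>The choice x = f minimises the quadratic expression in x, since S f = h; linear
    and quadratic terms then combine to minus the form of f.\<close>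
  have "Re (cip f h) \<le> 2 * Re (cip v (g z *\<^sub>v v)) / (1 - (cmod z)\<^sup>2)"
    using fundamental_inequality[OF z v f] unfolding Sf h_def[symmetric] by simp
  then have "(1 - (cmod z)\<^sup>2) * Re (cip f h) \<le> 2 * Re (cip v (g z *\<^sub>v v))"
    using pos by (simp add: pos_le_divide_eq mult.commute)
  then show "Re (cip u (J *\<^sub>v u)) \<le> 0" using 1 by simp
qed

lemma V_holomorphic: "hol_mat (ball 0 1) (2 * p) p V"
proof -
  have "hol_mat (ball 0 1) p p g"
  proof (rule hol_matI)
    fix i j assume ij: "i < p" "j < p"
    show "(\<lambda>z. g z $$ (i, j)) holomorphic_on ball 0 1"
      using tail_holomorphic[OF ij, of 0] by (simp add: g_entry[OF ij])
  qed simp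
  moreover have "hol_mat (ball 0 1) n p tails"
  proof (rule hol_matI)
    fix a b assume ab: "a < n" "b < p"
    have "(\<lambda>z. - tail (Suc (a div p)) (a mod p) b z) holomorphic_on ball 0 1"
      using ab p_pos by (intro holomorphic_intros tail_holomorphic) auto
    then show "(\<lambda>z. tails z $$ (a, b)) holomorphic_on ball 0 1" using ab by (simp add: tails_def)
  qed simp
  ultimately show ?thesis unfolding V_def[abs_def]
    by (intro hol_mat_add hol_mat_smult hol_mat_stack hol_mat_uminus hol_mat_const holomorphic_intros
        hol_mat_mult[of _ "2*p" n] hol_mat_mult[of _ n n]) auto
qed

text \<open>The pair consists of the coordinates of \<open>V\<close> after the unitary change by K,
  in which J becomes diag(I, -I). Applying \<Theta> to \<open>V\<close> returns the column of I and
  -g, so the transformation gives back g.\<close>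

theorem extension_comes_from_pair:
  "\<exists>R Q. admissible_pair p R Q \<and> (\<exists>g. taylor_rep p (phi p N s a0 R Q) g \<and> (\<forall>k > N. taylor_coeff p g k = t k))"
proof -
  define mob where "mob z = \<i> * (z + 1) / (z - 1)" for z :: complex
  define imob where "imob w = (w + \<i>) / (w - \<i>)" for w :: complex
  have imob_mob: "imob (mob z) = z" if "cmod z < 1" for z
  proof -
    have z1: "z - 1 \<noteq> 0" using that by auto
    have "mob z + \<i> = 2 * \<i> * z / (z - 1)" "mob z - \<i> = 2 * \<i> / (z - 1)"
      unfolding mob_def using z1 by (simp_all add: field_simps)
    then show ?thesis unfolding imob_def using z1 by simp
  qed
  define B where "B w = mat_adjoint K * V (imob w)" for w
  have Bc: "B w \<in> carrier_mat (2 * p) p" for w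
    unfolding B_def by (rule mult_carrier_mat[OF mat_adjoint_carrier[OF K_carrier] V_carriers(4)])
  define R where "R w = top_half p (B w)" for w
  define Q where "Q w = bot_half p (B w)" for w
  have Rc: "R w \<in> carrier_mat p p" and Qc: "Q w \<in> carrier_mat p p" for w by (auto simp: R_def Q_def)
  have KB: "V (imob w) = K * stack p (R w) (Q w)" for w
  proof -
    have "K * stack p (R w) (Q w) = K * (mat_adjoint K * V (imob w))"
      unfolding R_def Q_def stack_halves[OF Bc] by (simp add: B_def)
    also have "\<dots> = K * mat_adjoint K * V (imob w)"
      by (rule assoc_mult_mat[OF K_carrier mat_adjoint_carrier[OF K_carrier] V_carriers(4), symmetric])
    also have "\<dots> = V (imob w)"
      unfolding K_adjoint_K(2) by (rule left_mult_one_mat[OF V_carriers(4)])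
    finally show ?thesis by simp
  qed
  have ana: "(\<lambda>w. R w $$ (a, b)) analytic_on lower_half" "(\<lambda>w. Q w $$ (a, b)) analytic_on lower_half"
    if ab: "a < p" "b < p" for a b
  proof -
    have "hol_mat lower_half (2 * p) p (\<lambda>w. V (imob w))"
    proof (rule hol_matI)
      fix i j assume ij: "i < 2 * p" "j < p"
      have "imob holomorphic_on lower_half"
        unfolding imob_def[abs_def] using moebius_disc(2) by (intro holomorphic_intros) auto
      moreover have "imob ` lower_half \<subseteq> ball 0 1" using moebius_disc(1) by (auto simp: imob_def)
      ultimately show "(\<lambda>w. V (imob w) $$ (i, j)) holomorphic_on lower_half"
        using holomorphic_on_compose_gen[OF _ hol_matD(2)[OF V_holomorphic ij]] by (simp add: o_def)
    qed simp
    then have "hol_mat lower_half (2 * p) p B"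
      unfolding B_def[abs_def] by (intro hol_mat_mult[of _ _ "2*p"] hol_mat_const) auto
    from hol_mat_halves[OF this] show "(\<lambda>w. R w $$ (a, b)) analytic_on lower_half" "(\<lambda>w. Q w $$ (a, b)) analytic_on lower_half"
      unfolding R_def[symmetric] Q_def[symmetric] analytic_on_open[OF open_lower_half] using ab by (auto dest: hol_matD(2))
  qed
  have pos: "pd (mat_adjoint (R w) * R w + mat_adjoint (Q w) * Q w)"
    "psd (mat_adjoint (Q w) * Q w - mat_adjoint (R w) * R w)" if w: "w \<in> lower_half" for w
  proof -
    have zd: "cmod (imob w) < 1" using moebius_disc(1)[OF w] by (simp add: imob_def)
    have c: "mat_adjoint (R w) * R w \<in> carrier_mat p p" "mat_adjoint (Q w) * Q w \<in> carrier_mat p p"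
      using mult_carrier_mat[OF mat_adjoint_carrier[OF Rc] Rc] mult_carrier_mat[OF mat_adjoint_carrier[OF Qc] Qc] .
    define nR where "nR v = (\<Sum>i<p. (cmod ((R w *\<^sub>v v) $ i))\<^sup>2)" for v
    define nQ where "nQ v = (\<Sum>i<p. (cmod ((Q w *\<^sub>v v) $ i))\<^sup>2)" for v
    have sum: "cip v ((mat_adjoint (R w) * R w + mat_adjoint (Q w) * Q w) *\<^sub>v v) = of_real (nR v + nQ v)"
      and diff: "cip v ((mat_adjoint (Q w) * Q w - mat_adjoint (R w) * R w) *\<^sub>v v) = of_real (nQ v - nR v)"
      if v: "v \<in> carrier_vec p" for v
    proof -
      have cv: "(mat_adjoint (R w) * R w) *\<^sub>v v \<in> carrier_vec p" "(mat_adjoint (Q w) * Q w) *\<^sub>v v \<in> carrier_vec p"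
        using mult_mat_vec_carrier[OF c(1) v] mult_mat_vec_carrier[OF c(2) v] .
      show "cip v ((mat_adjoint (R w) * R w + mat_adjoint (Q w) * Q w) *\<^sub>v v) = of_real (nR v + nQ v)"
        "cip v ((mat_adjoint (Q w) * Q w - mat_adjoint (R w) * R w) *\<^sub>v v) = of_real (nQ v - nR v)"
        unfolding add_mult_distrib_mat_vec[OF c v] minus_mult_distrib_mat_vec[OF c(2,1) v]
          cip_add(1)[OF v cv] cip_add(2)[OF v cv(2,1)] cip_gram[OF Rc v] cip_gram[OF Qc v] nR_def nQ_def
        by simp_all
    qed
    have nonneg: "nR v \<ge> 0" "nQ v \<ge> 0" for v by (auto simp: nR_def nQ_def intro!: sum_nonneg)
    \<comment> \<open>A common kernel vector of R and Q is annihilated by \<open>V\<close>, hence by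
      \<Theta> times \<open>V\<close>, whose top half is the identity.\<close>
    have "nR v + nQ v > 0" if v: "v \<in> carrier_vec p" and nz: "v \<noteq> 0\<^sub>v p" for v
    proof (rule ccontr)
      assume "\<not> nR v + nQ v > 0"
      then have "nR v = 0" "nQ v = 0" using nonneg[of v] by linarith+
      then have RQ0: "\<forall>i<p. (R w *\<^sub>v v) $ i = 0 \<and> (Q w *\<^sub>v v) $ i = 0"
        unfolding nR_def nQ_def by (simp add: sum_nonneg_eq_0_iff del: index_mult_mat_vec)
      have "stack p (R w) (Q w) *\<^sub>v v = 0\<^sub>v (2 * p)"
        using RQ0 by (intro eq_vecI) (auto simp: stack_vec[OF Rc Qc v] simp del: index_mult_mat_vec)
      then have "V (imob w) *\<^sub>v v = 0\<^sub>v (2 * p)"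
        unfolding KB assoc_mult_mat_vec[OF K_carrier half_carriers(1) v] by (auto intro!: eq_vecI)
      moreover have Theta0: "Theta (imob w) *\<^sub>v 0\<^sub>v (2 * p) = 0\<^sub>v (2 * p)" by (auto intro!: eq_vecI)
      ultimately have y0: "stack p (1\<^sub>m p) (- g (imob w)) *\<^sub>v v = 0\<^sub>v (2 * p)"
        using V_vec(1)[OF zd v] Theta0 by simp
      have "v $ i = 0" if "i < p" for i
        using stack_vec[OF one_carrier_mat uminus_carrier_mat[OF g_tails_carrier(1)[of "imob w"]] v, of i] that v
        unfolding y0 by simp
      then have "v = 0\<^sub>v p" using v by (intro eq_vecI) auto
      with nz show False by simp
    qed
    then show "pd (mat_adjoint (R w) * R w + mat_adjoint (Q w) * Q w)"
      unfolding pd_iff[OF add_carrier_mat[OF c(2)]] using sum by (simp del: assoc_mult_mat_vec)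
    have "nQ v - nR v \<ge> 0" if v: "v \<in> carrier_vec p" for v
      using V_vec(2)[OF zd v] K_stack_form(1)[OF Rc Qc v KB] by (simp add: nR_def nQ_def del: index_mult_mat_vec)
    then show "psd (mat_adjoint (Q w) * Q w - mat_adjoint (R w) * R w)"
      unfolding psd_iff[OF minus_carrier_mat[OF c(1)]] using diff by (simp del: assoc_mult_mat_vec)
  qed
  have i_lower: "{- \<i>} \<subseteq> lower_half" by (simp add: lower_half_def)
  have adm: "admissible_pair p R Q"
    unfolding admissible_pair_def
    using Rc Qc ana[THEN analytic_on_imp_meromorphic_on] analytic_on_subset[OF ana(1) i_lower]
      analytic_on_subset[OF ana(2) i_lower] pos by blast
  have "g z = \<i> \<cdot>\<^sub>m phi p N s a0 R Q (\<i> * (z + 1) / (z - 1))" if z: "cmod z < 1" for z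
  proof -
    define w where "w = mob z"
    define G where "G = Theta z * (K * stack p (R w) (Q w))"
    have Vz: "K * stack p (R w) (Q w) = V z" using KB[of w] imob_mob[OF z] by (simp add: w_def)
    \<comment> \<open>Here the denominator of the transformation becomes the identity, so g is
      recovered at every point of the disc.\<close>
    have Gst: "G = stack p (1\<^sub>m p) (- g z)"
    proof (rule mat_eq_if_mult_vec_eq[of _ "2*p" p])
      show "G \<in> carrier_mat (2 * p) p" unfolding G_def Vz by (rule mult_carrier_mat[OF Theta_carrier V_carriers(4)])
      show "G *\<^sub>v v = stack p (1\<^sub>m p) (- g z) *\<^sub>v v" if v: "v \<in> carrier_vec p" for v
        unfolding G_def Vz assoc_mult_mat_vec[OF Theta_carrier V_carriers(4) v] by (rule V_vec(1)[OF z v])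
    qed simp
    have gd: "dim_row (g z) = p" "dim_col (g z) = p" using carrier_matD[OF g_tails_carrier(1)[of z]] by auto
    have top: "top_half p G = 1\<^sub>m p" and bot: "bot_half p G = - g z"
      unfolding Gst by (rule eq_matI; simp add: half_entries gd)+
    have m1: "minv (1\<^sub>m p) = 1\<^sub>m p" by (rule minv_eqI(1)[of _ p]) auto
    have "\<i> \<cdot>\<^sub>m phi p N s a0 R Q w = - (bot_half p G * minv (top_half p G))"
    proof (rule phi_eq[of z w R Q G])
      show "w = \<i> * (z + 1) / (z - 1)" by (simp add: w_def mob_def)
      show "det (top_half p G) \<noteq> 0" by (simp add: top)
    qed (simp_all add: z Rc Qc G_def)
    also have "\<dots> = g z" unfolding top bot m1 using gd by (intro eq_matI) auto
    finally show ?thesis by (simp add: w_def mob_def)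
  qed
  moreover have "eventually (\<lambda>z. cmod z < 1) (at (0 :: complex))"
    using eventually_at_in_open'[of "ball 0 1" "0 :: complex"] by simp
  ultimately have rep: "eventually (\<lambda>z. g z = \<i> \<cdot>\<^sub>m phi p N s a0 R Q (\<i> * (z + 1) / (z - 1))) (at 0)"
    by (auto elim: eventually_mono)
  have "(\<lambda>z. g z $$ (a, b)) analytic_on {0}" if "a < p" "b < p" for a b
    using tail_holomorphic[OF that, of 0] that by (auto simp: analytic_at g_entry intro!: exI[of _ "ball 0 1"])
  then have "taylor_rep p (phi p N s a0 R Q) g"
    using rep by (simp add: taylor_rep_def)
  moreover have "\<forall>k > N. taylor_coeff p g k = t k" by (simp add: g_taylor \<alpha>_def)
  ultimately show ?thesis using adm by blast
qed

end

section \<open>Parametrization of all nonnegative extensions\<close>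

theorem theorem6p2:
  fixes p N :: nat and s :: "int \<Rightarrow> complex mat" and a0 :: "complex mat"
  assumes "p \<ge> 1"
    and "\<forall>k. \<bar>k\<bar> \<le> int N \<longrightarrow> s k \<in> carrier_mat p p"
    and "\<forall>k. \<bar>k\<bar> \<le> int N \<longrightarrow> s (- k) = mat_adjoint (s k)"
    and "pd (block_toeplitz p N s)"
    and "a0 \<in> carrier_mat p p"
    and "a0 + mat_adjoint a0 = s 0"
  shows
    "(\<forall>R Q. admissible_pair p R Q \<longrightarrow>
        (\<exists>g. taylor_rep p (phi p N s a0 R Q) g \<and>
             g 0 = a0 \<and>
             taylor_coeff p g 0 = a0 \<and>
             (\<forall>k. 0 < k \<and> k \<le> N \<longrightarrow> taylor_coeff p g k = s (- int k)) \<and>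
             (\<forall>M > N. psd (block_toeplitz p M (ext_seq N s (taylor_coeff p g)))))) \<and>
     (\<forall>t :: nat \<Rightarrow> complex mat.
        (\<forall>k > N. t k \<in> carrier_mat p p) \<and>
        (\<forall>M > N. psd (block_toeplitz p M (ext_seq N s t))) \<longrightarrow>
        (\<exists>R Q. admissible_pair p R Q \<and>
           (\<exists>g. taylor_rep p (phi p N s a0 R Q) g \<and>
                (\<forall>k > N. taylor_coeff p g k = t k))))"
proof -
  interpret toeplitz_data p N s a0
    by unfold_locales (use assms in auto)
  show ?thesis
  proof (intro conjI allI impI, goal_cases)
    case (1 R Q)
    then show ?case by (rule admissible_pair_gives_extension)
  next
    case (2 t)
    interpret toeplitz_extension p N s a0 t
      by unfold_locales (use 2 in auto)
    show ?case by (rule extension_comes_from_pair)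
  qed
qed

end
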